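(* Let $k_1,k_2\in\mathbb{Z}$ be such that $k_1k_2\ne 0$, and let $m\in\mathbb{R}$, $m\ge -1$. Then for a nonzero radial T-function $\varphi(r)$ on $D$, the semicommutator $\left(T_{e^{ik_1\theta}r^m},T_{e^{ik_2\theta}\varphi}\right]=T_{e^{ik_1\theta}r^m}T_{e^{ik_2\theta}\varphi}-T_{e^{i(k_1+k_2)\theta}r^m\varphi}$ has finite rank on $L_h^2$ if and only if one of the following conditions holds: (1) $m=k_1$, $k_2>\max\{-2,-k_1-2\}$ and $\varphi(r)=Cr^{k_2}$ for some constant $C$. (2) $m=-k_1$, $k_2<\min\{2,-k_1+2\}$ and $\varphi(r)=Cr^{-k_2}$ for some constant $C$.
   Context: $D$ is the open unit disk in $\mathbb{C}$ and $dA$ is Lebesgue area measure on $D$ normalized so that $D$ has measure $1$. $L_h^2$ is the harmonic Bergman space: the closed subspace of $L^2(D,dA)$ consisting of (complex-valued) harmonic functions. $Q$ is the orthogonal projection of $L^2(D,dA)$ onto $L_h^2$, given by $Qf(z)=\int_D\left(\frac{1}{(1-z\bar w)^2}+\frac{1}{(1-\bar z w)^2}-1\right)f(w)\,dA(w)$; the integral formula extends $Q$ to $L^1(D,dA)$. For $u\in L^1(D,dA)$ the operator $h\mapsto Q(uh)$ is densely defined on the harmonic polynomials in $L_h^2$. $u$ is called a T-function if this operator is bounded in the $L_h^2$ norm; then the Toeplitz operator $T_u:L_h^2\to L_h^2$ is its continuous extension. (Every $u \in L^1(D,dA)$ essentially bounded on some annulus $r_0<|z|<1$ is a T-function.) $T_u$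 is defined only when $u$ is a T-function, so "the semicommutator has finite rank" includes that $r^m\varphi$ is a T-function. Points of $D$ are written $re^{i\theta}$; a radial T-function is a T-function depending only on $r$, and for $k\in\mathbb{Z}$, $e^{ik\theta}\varphi(r)$ is a T-function iff $\varphi$ is. A bounded operator has finite rank if the closure of its range is finite dimensional. *)

theory Defs
  imports "HOL-Analysis.Analysis"
begin

abbreviation disk :: "complex set"
  where "disk \<equiv> ball 0 1"

definition dA :: "complex measure"
  where "dA = uniform_measure (lebesgue_on disk) disk"

text \<open>Second derivatives are taken over the reals: \<open>f' z\<close> is the real Frechet derivative of \<open>f\<close>,
  \<open>f'' z\<close> that of \<open>f'\<close>, and \<open>f'' z 1 1\<close>, \<open>f'' z \<i> \<i>\<close> are the second partial derivatives
  in the directions of the real and imaginary axes.\<close>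

definition harmonic_on :: "(complex \<Rightarrow> complex) \<Rightarrow> complex set \<Rightarrow> bool"  (infixl "(harmonic'_on)" 50)
  where "f harmonic_on S \<longleftrightarrow> open S \<and>
    (\<exists>(f' :: complex \<Rightarrow> complex \<Rightarrow>\<^sub>L complex) (f'' :: complex \<Rightarrow> complex \<Rightarrow>\<^sub>L complex \<Rightarrow>\<^sub>L complex).
       (\<forall>z\<in>S. (f has_derivative blinfun_apply (f' z)) (at z)) \<and>
       (\<forall>z\<in>S. (f' has_derivative blinfun_apply (f'' z)) (at z)) \<and>
       continuous_on S f'' \<and>
       (\<forall>z\<in>S. blinfun_apply (blinfun_apply (f'' z) 1) 1
              + blinfun_apply (blinfun_apply (f'' z) \<i>) \<i> = 0))"

text \<open>Functions on the disk are represented by functions on the plane. A harmonic function is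
  determined by its values on the disk, so elements of the harmonic Bergman space are genuine
  functions, normalised to vanish off the disk; no quotient by null sets is needed.\<close>

definition Lh2 :: "(complex \<Rightarrow> complex) set"
  where "Lh2 = {f. f harmonic_on disk \<and> integrable dA (\<lambda>z. (cmod (f z))\<^sup>2) \<and> (\<forall>z. z \<notin> disk \<longrightarrow> f z = 0)}"

definition L2norm :: "(complex \<Rightarrow> complex) \<Rightarrow> real"
  where "L2norm f = sqrt (LINT z|dA. (cmod (f z))\<^sup>2)"

definition Q :: "(complex \<Rightarrow> complex) \<Rightarrow> complex \<Rightarrow> complex"
  where "Q f z = (if z \<in> disk
     then LINT w|dA. (1 / (1 - z * cnj w)\<^sup>2 + 1 / (1 - cnj z * w)\<^sup>2 - 1) * f w
     else 0)"

text \<open>\<open>polynomial_function\<close> on the complex plane means polynomial in the real and imaginary parts,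
  with complex coefficients.\<close>

definition harmonic_polynomials :: "(complex \<Rightarrow> complex) set"
  where "harmonic_polynomials = {h \<in> Lh2. \<exists>p. polynomial_function p \<and> (\<forall>z\<in>disk. h z = p z)}"

text \<open>The condition \<open>Q (u h) \<in> Lh2\<close> is a genuine requirement: for integrable \<open>u\<close> the function
  \<open>Q (u h)\<close> is harmonic, but need not be square integrable, and \<open>L2norm\<close> is a junk value then.\<close>

definition T_function :: "(complex \<Rightarrow> complex) \<Rightarrow> bool"
  where "T_function u \<longleftrightarrow> integrable dA u \<and>
    (\<exists>B. \<forall>h\<in>harmonic_polynomials.
       Q (\<lambda>w. u w * h w) \<in> Lh2 \<and> L2norm (Q (\<lambda>w. u w * h w)) \<le> B * L2norm h)"

definition bounded_operator :: "((complex \<Rightarrow> complex) \<Rightarrow> complex \<Rightarrow> complex) \<Rightarrow> bool"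
  where "bounded_operator T \<longleftrightarrow>
    (\<forall>f\<in>Lh2. T f \<in> Lh2) \<and>
    (\<forall>f\<in>Lh2. \<forall>g\<in>Lh2. T (\<lambda>z. f z + g z) = (\<lambda>z. T f z + T g z)) \<and>
    (\<forall>c. \<forall>f\<in>Lh2. T (\<lambda>z. c * f z) = (\<lambda>z. c * T f z)) \<and>
    (\<exists>B. \<forall>f\<in>Lh2. L2norm (T f) \<le> B * L2norm f)"

text \<open>The continuous extension of \<open>h \<mapsto> Q (u h)\<close> from the dense subspace of harmonic polynomials.
  It is meaningful only if \<open>u\<close> is a T-function. Extensionality off \<open>Lh2\<close> makes it unique as a
  HOL function.\<close>

definition Toeplitz :: "(complex \<Rightarrow> complex) \<Rightarrow> (complex \<Rightarrow> complex) \<Rightarrow> complex \<Rightarrow> complex"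
  where "Toeplitz u = (THE T. bounded_operator T \<and> T \<in> extensional Lh2 \<and>
    (\<forall>h\<in>harmonic_polynomials. T h = Q (\<lambda>w. u w * h w)))"

definition Lh2_closure :: "(complex \<Rightarrow> complex) set \<Rightarrow> (complex \<Rightarrow> complex) set"
  where "Lh2_closure X = {g \<in> Lh2. \<forall>e>0. \<exists>f\<in>X. L2norm (\<lambda>z. f z - g z) < e}"

definition finite_dimensional :: "(complex \<Rightarrow> complex) set \<Rightarrow> bool"
  where "finite_dimensional X \<longleftrightarrow>
    (\<exists>B. finite B \<and> (\<forall>g\<in>X. \<exists>c :: (complex \<Rightarrow> complex) \<Rightarrow> complex. g = (\<lambda>z. \<Sum>b\<in>B. c b * b z)))"

definition finite_rank :: "((complex \<Rightarrow> complex) \<Rightarrow> complex \<Rightarrow> complex) \<Rightarrow> bool"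
  where "finite_rank S \<longleftrightarrow> bounded_operator S \<and> finite_dimensional (Lh2_closure (S ` Lh2))"

text \<open>The function with value \<open>exp (\<i> k \<theta>) * \<psi> r\<close> at the point \<open>r * exp (\<i> \<theta>)\<close>.\<close>

definition polar :: "int \<Rightarrow> (real \<Rightarrow> complex) \<Rightarrow> complex \<Rightarrow> complex"
  where "polar k \<psi> z = cis (of_int k * Arg z) * \<psi> (cmod z)"

end

theory Submission
  imports Defs "HOL-Complex_Analysis.Complex_Analysis" "HOL-Library.Function_Algebras"
begin

text \<open>On the disk let \<open>e\<^sub>n\<close> be \<open>z ^ n\<close> for \<open>n \<ge> 0\<close> and \<open>(cnj z) ^ \<bar>n\<bar>\<close> for \<open>n < 0\<close>. These functions form an
  orthogonal basis of the harmonic Bergman space, and the squared norm of \<open>e\<^sub>n\<close> is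
  \<open>1 / (\<bar>n\<bar> + 1)\<close>. A quasihomogeneous symbol \<open>exp (\<i> k \<theta>) \<psi>(r)\<close> acts as a weighted shift
  \<open>e\<^sub>n \<mapsto> t\<^sub>n e\<^sub>n\<^sub>+\<^sub>k\<close>, where \<open>t\<^sub>n\<close> is \<open>\<bar>n + k\<bar> + 1\<close> times the integral of \<open>\<psi>(\<bar>z\<bar>) \<bar>z\<bar> ^ (\<bar>n\<bar> + \<bar>n + k\<bar>)\<close>
  (\<open>Toeplitz_polar\<close>), and the symbol is a T-function iff it is integrable and the weights are bounded
  (\<open>T_function_polar_iff\<close>). The semicommutator is therefore a weighted shift too, and it has finite
  rank iff almost all of its weights vanish (\<open>finite_rank_shift_iff\<close>).

  Let \<open>M s\<close> be the integral of \<open>\<phi>(\<bar>z\<bar>) \<bar>z\<bar> ^ s\<close> over the disk. For \<open>n\<close> large and positive, the weight at \<open>n\<close> vanishes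
  iff \<open>(s + k2 + 2) M s\<close> takes the same value at \<open>s = 2 n + k2\<close> and at \<open>s + d\<close>, where \<open>d = m + k1\<close>; for \<open>n\<close>
  large and negative the same holds with \<open>- k2\<close> for \<open>k2\<close> and \<open>d = m - k1\<close>
  (\<open>semicommutator_finitely_supported_iff\<close>). If \<open>d = 0\<close>, the condition is empty. If \<open>d \<noteq> 0\<close>, it holds
  precisely for the multiples of \<open>r ^ k2\<close>, respectively \<open>r ^ (- k2)\<close>, for which \<open>(s + k2 + 2) M s\<close>,
  respectively \<open>(s - k2 + 2) M s\<close>, is constant (\<open>radial_eq_power_if_recurrence\<close>). As \<open>k1 \<noteq> 0\<close>, at most
  one of the two steps is zero; as \<open>k2 \<noteq> 0\<close>, a nonzero \<open>\<phi>\<close> is not a multiple of both powers. So exactly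
  one step is zero, which gives \<open>m = k1\<close> or \<open>m = - k1\<close> and the form of \<open>\<phi>\<close>. The inequalities for \<open>k2\<close>
  express that the symbols \<open>\<phi>\<close> and \<open>r ^ m * \<phi>\<close> are integrable near the origin.

  That the recurrence determines \<open>\<phi>\<close> is shown by real methods. The function
  \<open>M s / (s + a + d) - M (s + d) / (s + a)\<close> of \<open>s\<close>, where \<open>a\<close> is \<open>k2 + 2\<close> respectively \<open>- k2 + 2\<close>, is a
  bounded linear functional of the power \<open>x ^ s\<close> on the unit interval, so by Weierstrass's theorem it vanishes for all large real \<open>s\<close> as soon as it vanishes on
  a progression of step \<open>2\<close>. Hence \<open>(s + a) M s\<close> is constant along a progression of step \<open>d\<close>, and \<open>\<phi>\<close> minus
  a multiple of a power has vanishing moments along it; the same approximation argument makes all its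
  moments vanish. By rotation invariance this difference is orthogonal to all polynomials in \<open>z\<close> and
  \<open>cnj z\<close>, and so it vanishes almost everywhere (\<open>radial_null_if_even_moments_vanish\<close>).

  The existence and uniqueness of the Toeplitz operators rests on the expansion of harmonic functions
  (\<open>Lh2_expansion\<close>), which comes from writing a harmonic function on the disk as \<open>F + cnj G\<close> with
  holomorphic \<open>F\<close> and \<open>G\<close>.\<close>

section \<open>Area measure on the disk\<close>

text \<open>This carries the invariance of Lebesgue measure under orthogonal maps of \<open>real^2\<close> over to the
  complex plane.\<close>

lemma lborel_complex_conv_vec:
  "distr lborel borel (\<lambda>v::real^2. Complex (v $ 1) (v $ 2)) = (lborel :: complex measure)"
proof (rule lborel_eqI[symmetric])
  fix l u :: complex
  assume le: "\<And>b. b \<in> Basis \<Longrightarrow> l \<bullet> b \<le> u \<bullet> b"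
  have le': "Re l \<le> Re u" "Im l \<le> Im u"
    using le[of 1] le[of \<i>] by (auto simp: Basis_complex_def)
  have m: "(\<lambda>v::real^2. Complex (v $ 1) (v $ 2)) \<in> borel_measurable borel"
    by (intro borel_measurable_continuous_onI continuous_intros)
  have eq: "(\<lambda>v::real^2. Complex (v $ 1) (v $ 2)) -` box l u = box (vector [Re l, Im l]) (vector [Re u, Im u])"
    by (auto simp: box_def Basis_vec_def Basis_complex_def inner_axis forall_2 vector_2 exhaust_2)
  have "emeasure (distr lborel borel (\<lambda>v::real^2. Complex (v $ 1) (v $ 2))) (box l u)
      = emeasure lborel (box (vector [Re l, Im l] :: real^2) (vector [Re u, Im u]))"
    using m by (subst emeasure_distr) (auto simp: eq)
  also have "\<dots> = (\<Prod>b\<in>Basis. (u - l) \<bullet> b)"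
  proof -
    have B: "(Basis :: (real^2) set) = {axis 1 1, axis 2 1}"
      by (auto simp: Basis_vec_def UNIV_2)
    have ne: "axis 1 1 \<noteq> (axis 2 1 :: real^2)" by (simp add: axis_eq_axis)
    show ?thesis
      using le' ne by (subst emeasure_lborel_box_eq)
        (auto simp: B Basis_complex_def inner_axis vector_2 ennreal_mult)
  qed
  finally show "emeasure (distr lborel borel (\<lambda>v::real^2. Complex (v $ 1) (v $ 2))) (box l u)
     = (\<Prod>b\<in>Basis. (u - l) \<bullet> b)" .
qed simp

lemma lborel_distr_rotation:
  fixes c :: complex
  assumes c: "cmod c = 1"
  shows "distr lborel borel (\<lambda>z. c * z) = lborel"
proof (rule lborel_eqI[symmetric])
  fix l u :: complex
  assume le: "\<And>b. b \<in> Basis \<Longrightarrow> l \<bullet> b \<le> u \<bullet> b"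
  define g :: "real^2 \<Rightarrow> complex" where "g = (\<lambda>v. Complex (v $ 1) (v $ 2))"
  define g' :: "complex \<Rightarrow> real^2" where "g' = (\<lambda>z. vector [Re z, Im z])"
  define T :: "real^2 \<Rightarrow> real^2" where "T = (\<lambda>v. g' (cnj c * g v))"
  have gg': "g (g' z) = z" "g' (g v) = v" for z v
    by (auto simp: g_def g'_def vector_2 vec_eq_iff forall_2)
  have cc: "c * cnj c = 1" "cnj c * c = 1" using c
    by (simp_all add: complex_norm_square[symmetric] mult.commute[of "cnj c"])
  have m: "g \<in> borel_measurable borel" unfolding g_def
    by (intro borel_measurable_continuous_onI continuous_intros)
  have nrm: "norm v = cmod (g v)" for v :: "real^2"
    by (simp add: norm_vec_def L2_set_def g_def cmod_def UNIV_2)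
  have nrm': "norm (g' z) = cmod z" for z by (simp add: nrm gg')
  have orth: "orthogonal_transformation T"
  proof (subst orthogonal_transformation, safe)
    show "linear T"
      by (rule linearI) (auto simp: T_def g_def g'_def vec_eq_iff forall_2 vector_2 algebra_simps)
    show "norm (T v) = norm v" for v
      by (simp add: T_def nrm gg' norm_mult c)
  qed
  have meas: "(\<lambda>z. c * z) -` B \<in> sets borel" if "B \<in> sets borel" for B
    using that measurable_sets[of "\<lambda>z. c * z" borel borel B]
    by (simp add: borel_measurable_continuous_onI continuous_intros)
  have emg: "emeasure lborel B = emeasure lborel (g -` B)" if "B \<in> sets borel" for B
  proof -
    have "emeasure lborel B = emeasure (distr lborel borel g) B"
      using lborel_complex_conv_vec by (simp add: g_def)
    also have "\<dots> = emeasure lborel (g -` B)" using that m by (subst emeasure_distr) auto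
    finally show ?thesis .
  qed
  let ?B = "box l u"
  have im: "g -` ((\<lambda>z. c * z) -` ?B) = T ` (g -` ?B)"
  proof (intro equalityI subsetI)
    fix v assume "v \<in> g -` ((\<lambda>z. c * z) -` ?B)"
    then have "g' (c * g v) \<in> g -` ?B" "v = T (g' (c * g v))"
      by (auto simp: T_def gg' cc mult.assoc[symmetric])
    then show "v \<in> T ` (g -` ?B)" by blast
  next
    fix v assume "v \<in> T ` (g -` ?B)"
    then show "v \<in> g -` ((\<lambda>z. c * z) -` ?B)"
      by (auto simp: T_def gg' cc mult.assoc[symmetric])
  qed
  have gB: "g -` ?B \<in> sets borel" using measurable_sets[OF m, of ?B] by simp
  have bd: "bounded (g -` ?B)"
  proof -
    have "g -` ?B = g' ` ?B" by (force simp: gg' image_iff intro: exI[of _ "g _"])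
    moreover have "bounded (g' ` ?B)"
      using bounded_box[of l u] unfolding bounded_iff by (auto simp: nrm')
    ultimately show ?thesis by simp
  qed
  have lm: "g -` ?B \<in> lmeasurable"
    using gB bd by (simp add: bounded_set_imp_lmeasurable)
  have "emeasure (distr lborel borel (\<lambda>z. c * z)) ?B = emeasure lborel ((\<lambda>z. c * z) -` ?B)"
    by (subst emeasure_distr) auto
  also have "\<dots> = emeasure lborel (g -` ((\<lambda>z. c * z) -` ?B))"
    by (rule emg) (simp add: meas)
  also have "\<dots> = emeasure lebesgue (T ` (g -` ?B))"
    unfolding im[symmetric] using meas[of ?B] measurable_sets[OF m] by simp
  also have "\<dots> = emeasure lebesgue (g -` ?B)"
    using measurable_orthogonal_image[OF orth lm] measure_orthogonal_image[OF orth lm] lm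
    by (simp add: emeasure_eq_measure2)
  also have "\<dots> = emeasure lborel ?B"
    using gB by (simp add: emg)
  also have "\<dots> = (\<Prod>b\<in>Basis. (u - l) \<bullet> b)"
    using le by (simp add: emeasure_lborel_box_eq)
  finally show "emeasure (distr lborel borel (\<lambda>z. c * z)) ?B = (\<Prod>b\<in>Basis. (u - l) \<bullet> b)" .
qed simp

text \<open>The completed measure is needed, since radial symbols are only assumed to be Lebesgue measurable.\<close>

lemma
  fixes c :: complex
  assumes c: "cmod c = 1"
  shows lebesgue_distr_rotation: "distr lebesgue lebesgue (\<lambda>z. c * z) = lebesgue"
    and lebesgue_measurable_rotation: "(\<lambda>z. c * z) \<in> lebesgue \<rightarrow>\<^sub>M lebesgue"
proof -
  have [measurable]: "(\<lambda>z. c * z) \<in> borel \<rightarrow>\<^sub>M borel" by measurable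
  have eq0: "distr lebesgue lborel (\<lambda>z. c * z) = lborel"
    using lborel_distr_rotation[OF c] by (simp add: distr_completion cong: distr_cong)
  show "(\<lambda>z. c * z) \<in> lebesgue \<rightarrow>\<^sub>M lebesgue"
    by (simp add: completion.measurable_completion2 eq0 measurable_completion)
  show "distr lebesgue lebesgue (\<lambda>z. c * z) = lebesgue"
    using completion.completion_distr_eq[of "\<lambda>z. c * z" lborel lborel] 
    by (simp add: eq0 measurable_completion)
qed

lemma emeasure_ball_complex:
  "r \<ge> 0 \<Longrightarrow> emeasure lebesgue (ball (0::complex) r) = ennreal (pi * r\<^sup>2)"
  by (simp add: emeasure_ball unit_ball_vol_2)

lemma dA_eq: "dA = density (lebesgue_on disk) (\<lambda>_. ennreal (1 / pi))"
proof -
  have "emeasure (lebesgue_on disk) disk = ennreal pi"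
    using emeasure_ball_complex[of 1] by (simp add: emeasure_restrict_space)
  moreover have "1 / ennreal pi = ennreal (1 / pi)"
    using divide_ennreal[of 1 pi] by simp
  ultimately show ?thesis
    unfolding dA_def uniform_measure_def
  proof (intro density_cong AE_I2)
    show "(\<lambda>x. indicator disk x / emeasure (lebesgue_on disk) disk) \<in> borel_measurable (lebesgue_on disk)"
      by (subst measurable_cong[where g = "\<lambda>_. 1 / emeasure (lebesgue_on disk) disk"]) auto
  qed (auto simp: indicator_def)
qed

lemma space_dA [simp]: "space dA = disk" and sets_dA: "sets dA = sets (lebesgue_on disk)"
  by (simp_all add: dA_eq)

lemma emeasure_dA: "A \<in> sets dA \<Longrightarrow> emeasure dA A = ennreal (1 / pi) * emeasure lebesgue A"
  by (simp add: dA_eq emeasure_density sets_restrict_space_iff nn_integral_cmult_indicator emeasure_restrict_space)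

lemma measurable_dA_lebesgueI: "f \<in> measurable lebesgue N \<Longrightarrow> f \<in> measurable dA N"
  by (simp add: dA_eq measurable_restrict_space1)

lemma measurable_dA_borelI: "f \<in> measurable borel N \<Longrightarrow> f \<in> measurable dA N"
  by (intro measurable_dA_lebesgueI) (simp add: measurable_completion)

lemma emeasure_dA_disk: "emeasure dA disk = 1"
proof -
  have "emeasure dA disk = ennreal (1 / pi) * ennreal pi"
    using emeasure_ball_complex[of 1] by (subst emeasure_dA) (auto simp: sets_dA)
  then show ?thesis by (simp flip: ennreal_mult)
qed

lemma finite_measure_dA: "finite_measure dA"
  by standard (simp add: emeasure_dA_disk)

lemma AE_dA_disk: "AE z in dA. z \<in> disk"
  using AE_space[of dA] by simp

lemma AE_dA_nonzero: "AE z in dA. z \<noteq> 0"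
proof (rule AE_I')
  have "emeasure dA {0} = 0" by (subst emeasure_dA) (auto simp: sets_dA sets_restrict_space_iff)
  then show "{0} \<in> null_sets dA" by (auto simp: null_sets_def sets_dA sets_restrict_space_iff)
qed auto

lemma dA_distr_rotation:
  fixes c :: complex
  assumes c: "cmod c = 1"
  shows "distr dA dA (\<lambda>z. c * z) = dA" and "(\<lambda>z. c * z) \<in> dA \<rightarrow>\<^sub>M dA"
proof -
  have m: "(\<lambda>z. c * z) \<in> lebesgue \<rightarrow>\<^sub>M lebesgue" by (rule lebesgue_measurable_rotation[OF c])
  show mm: "(\<lambda>z. c * z) \<in> dA \<rightarrow>\<^sub>M dA"
    unfolding dA_eq using m c
    by (auto simp: norm_mult intro!: measurable_restrict_space3)
  show "distr dA dA (\<lambda>z. c * z) = dA"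
  proof (rule measure_eqI)
    fix A assume "A \<in> sets (distr dA dA (\<lambda>z. c * z))"
    then have A: "A \<in> sets dA" by simp
    then have A': "A \<in> sets lebesgue" "A \<subseteq> disk" by (auto simp: sets_dA sets_restrict_space_iff)
    have eq: "(\<lambda>z. c * z) -` A \<inter> disk = (\<lambda>z. c * z) -` A" using A'(2) c by (auto simp: norm_mult subset_iff)
    have "emeasure (distr dA dA (\<lambda>z. c * z)) A = emeasure dA ((\<lambda>z. c * z) -` A)"
      using mm A by (simp add: emeasure_distr eq)
    also have "\<dots> = ennreal (1 / pi) * emeasure lebesgue ((\<lambda>z. c * z) -` A)"
      using measurable_sets[OF mm A] by (subst emeasure_dA) (auto simp: eq)
    also have "emeasure lebesgue ((\<lambda>z. c * z) -` A) = emeasure (distr lebesgue lebesgue (\<lambda>z. c * z)) A"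
      using m A' by (subst emeasure_distr) auto
    also have "\<dots> = emeasure lebesgue A" by (simp add: lebesgue_distr_rotation[OF c])
    finally show "emeasure (distr dA dA (\<lambda>z. c * z)) A = emeasure dA A" using A by (simp add: emeasure_dA)
  qed simp
qed

lemma integral_dA_rotate:
  fixes f :: "complex \<Rightarrow> complex"
  assumes c: "cmod c = 1" and f: "integrable dA f"
  shows "(LINT z|dA. f (c * z)) = (LINT z|dA. f z)"
proof -
  have "(LINT z|dA. f z) = (LINT z|distr dA dA (\<lambda>z. c * z). f z)" by (simp add: dA_distr_rotation[OF c])
  also have "\<dots> = (LINT z|dA. f (c * z))"
    using f by (intro integral_distr dA_distr_rotation[OF c]) auto
  finally show ?thesis ..
qed

text \<open>Integration in polar coordinates for radial integrands: \<open>{z. cmod z > x}\<close> has normalised area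
  \<open>1 - x\<^sup>2\<close> for \<open>x\<close> in the unit interval, and a measure on the line is determined by such tails.\<close>

lemma dA_distr_cmod:
  "distr dA borel cmod = density lborel (\<lambda>r. ennreal (2 * r) * indicator {0..1} r)"
proof (rule measure_eqI_lessThan)
  have m: "cmod \<in> dA \<rightarrow>\<^sub>M borel" by (rule measurable_dA_borelI) simp
  interpret finite_measure dA by (rule finite_measure_dA)
  show "emeasure (distr dA borel cmod) {x<..} < \<infinity>" for x
    using m by (subst emeasure_distr) (auto simp: less_top[symmetric])
  fix x :: real
  define y where "y = max 0 (min 1 x)"
  have y: "0 \<le> y" "y \<le> 1" by (auto simp: y_def)
  have eq: "cmod -` {x<..} \<inter> disk = (if x < 0 then disk else disk - cball 0 y)"
    by (auto simp: y_def intro: less_le_trans[OF _ norm_ge_zero])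
  have "emeasure (distr dA borel cmod) {x<..} = emeasure dA (cmod -` {x<..} \<inter> disk)"
    using m by (simp add: emeasure_distr)
  also have "\<dots> = ennreal (1 - y\<^sup>2)"
  proof (cases "x < 0")
    case True
    then show ?thesis unfolding eq by (simp add: y_def emeasure_dA_disk)
  next
    case False
    have "emeasure lebesgue (disk - cball 0 y) = ennreal (pi * (1 - y\<^sup>2))"
    proof (cases "y = 1")
      case True
      then have "disk - cball 0 y = {}" by auto
      then show ?thesis unfolding \<open>disk - cball 0 y = {}\<close> using True by simp
    next
      case False
      then have "cball (0::complex) y \<subseteq> disk" using y by auto
      then have "emeasure lebesgue (disk - cball 0 y) = emeasure lebesgue disk - emeasure lebesgue (cball (0::complex) y)"
        by (intro emeasure_Diff) (auto simp: emeasure_cball y)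
      also have "\<dots> = ennreal pi - ennreal (pi * y\<^sup>2)"
        using emeasure_ball_complex[of 1] y by (simp add: emeasure_cball unit_ball_vol_2)
      also have "\<dots> = ennreal (pi * (1 - y\<^sup>2))"
        using y by (subst ennreal_minus) (auto simp: algebra_simps)
      finally show ?thesis .
    qed
    then have "emeasure dA (disk - cball 0 y) = ennreal (1 / pi) * ennreal (pi * (1 - y\<^sup>2))"
      by (subst emeasure_dA) (auto simp: sets_dA sets_restrict_space_iff)
    also have "\<dots> = ennreal (1 - y\<^sup>2)"
      using y by (subst ennreal_mult[symmetric]) (auto simp: power_le_one)
    finally show ?thesis unfolding eq using False by simp
  qed
  also have "\<dots> = (\<integral>\<^sup>+r. ennreal (2 * r) * indicator {y..1} r \<partial>lborel)"
  proof -
    have "(\<integral>\<^sup>+r. ennreal (2 * r) * indicator {y..1} r \<partial>lborel) = ennreal (1\<^sup>2 - y\<^sup>2)"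
      using y by (intro nn_integral_FTC_Icc) (auto intro!: derivative_eq_intros)
    then show ?thesis by simp
  qed
  also have "\<dots> = (\<integral>\<^sup>+r. ennreal (2 * r) * indicator {0..1} r * indicator {x<..} r \<partial>lborel)"
  proof (rule nn_integral_cong_AE)
    show "AE r in lborel. ennreal (2 * r) * indicator {y..1} r = ennreal (2 * r) * indicator {0..1} r * indicator {x<..} r"
      using AE_lborel_singleton[of y]
      by eventually_elim (auto simp: y_def indicator_def max_def min_def split: if_splits)
  qed
  also have "\<dots> = emeasure (density lborel (\<lambda>r. ennreal (2 * r) * indicator {0..1} r)) {x<..}"
    by (subst emeasure_density) auto
  finally show "emeasure (distr dA borel cmod) {x<..} =
      emeasure (density lborel (\<lambda>r. ennreal (2 * r) * indicator {0..1} r)) {x<..}" .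
qed auto

lemma has_bochner_integral_cmod_powr:
  fixes a :: real
  assumes a: "a > -2"
  shows "has_bochner_integral dA (\<lambda>z. cmod z powr a) (2 / (a + 2))"
proof (rule has_bochner_integral_nn_integral)
  have m: "cmod \<in> dA \<rightarrow>\<^sub>M borel" by (rule measurable_dA_borelI) simp
  show "(\<lambda>z. cmod z powr a) \<in> borel_measurable dA" by (rule measurable_dA_borelI) simp
  have "(\<integral>\<^sup>+z. ennreal (cmod z powr a) \<partial>dA) = (\<integral>\<^sup>+r. ennreal (r powr a) \<partial>distr dA borel cmod)"
    using m by (subst nn_integral_distr) auto
  also have "\<dots> = (\<integral>\<^sup>+r. ennreal (2 * r) * indicator {0..1} r * ennreal (r powr a) \<partial>lborel)"
    by (simp add: dA_distr_cmod nn_integral_density)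
  also have "\<dots> = (\<integral>\<^sup>+r. ennreal 2 * (ennreal (r powr (a+1)) * indicator {0..1} r) \<partial>lborel)"
  proof (intro nn_integral_cong)
    fix r :: real
    show "ennreal (2 * r) * indicator {0..1} r * ennreal (r powr a)
        = ennreal 2 * (ennreal (r powr (a+1)) * indicator {0..1} r)"
    proof (cases "0 \<le> r \<and> r \<le> 1")
      case True
      then have "ennreal (2 * r) * ennreal (r powr a) = ennreal (2 * r * r powr a)"
        by (intro ennreal_mult[symmetric]) auto
      also have "2 * r * r powr a = 2 * r powr (a+1)" using True by (simp add: powr_add)
      also have "ennreal \<dots> = ennreal 2 * ennreal (r powr (a+1))"
        by (intro ennreal_mult) auto
      finally show ?thesis using True by (simp add: indicator_def)
    qed (auto simp: indicator_def)
  qed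
  also have "\<dots> = ennreal 2 * (\<integral>\<^sup>+r. ennreal (r powr (a+1)) * indicator {0..1} r \<partial>lborel)"
    by (rule nn_integral_cmult) auto
  also have "(\<integral>\<^sup>+r. ennreal (r powr (a+1)) * indicator {0..1} r \<partial>lborel) = ennreal (1 / (a + 2))"
    using nn_integral_has_integral_lebesgue'[OF _ has_integral_powr_from_0[of "a+1" 1]] a
    by (simp add: add.commute)
  also have "ennreal 2 * ennreal (1 / (a + 2)) = ennreal (2 / (a + 2))"
    using a by (subst ennreal_mult[symmetric]) auto
  finally show "(\<integral>\<^sup>+z. ennreal (cmod z powr a) \<partial>dA) = ennreal (2 / (a + 2))" .
qed (use a in auto)

lemma integrable_dA_mult_bounded:
  fixes f g :: "complex \<Rightarrow> complex"
  assumes f: "integrable dA f" and g: "g \<in> borel_measurable dA"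
    and B: "\<And>z. z \<in> disk \<Longrightarrow> cmod (g z) \<le> B"
  shows "integrable dA (\<lambda>z. g z * f z)"
proof (rule Bochner_Integration.integrable_bound)
  show "integrable dA (\<lambda>z. B * cmod (f z))" using f by simp
  show "(\<lambda>z. g z * f z) \<in> borel_measurable dA" using f g by measurable
  show "AE z in dA. cmod (g z * f z) \<le> norm (B * cmod (f z))"
    using B by (intro AE_I2) (auto simp: norm_mult intro!: mult_right_mono order_trans[OF _ abs_ge_self])
qed

lemma integrable_dA_bounded:
  fixes g :: "complex \<Rightarrow> complex"
  assumes g: "g \<in> borel_measurable dA" and B: "\<And>z. z \<in> disk \<Longrightarrow> cmod (g z) \<le> B"
  shows "integrable dA g"
  by (rule finite_measure.integrable_const_bound[OF finite_measure_dA, of _ B])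
     (use assms in \<open>auto intro!: AE_I2\<close>)

section \<open>Quasihomogeneous functions\<close>

lemma polar_mult: "polar k \<psi> z * polar l \<eta> z = polar (k + l) (\<lambda>r. \<psi> r * \<eta> r) z"
  by (simp add: polar_def distrib_right flip: cis_mult)

lemma cnj_polar: "cnj (polar k \<psi> z) = polar (- k) (\<lambda>r. cnj (\<psi> r)) z"
  by (simp add: polar_def cis_cnj)

lemma polar_zero_index: "polar 0 \<psi> z = \<psi> (cmod z)"
  by (simp add: polar_def)

lemma cis_int_Arg: "z \<noteq> 0 \<Longrightarrow> cis (of_int k * Arg z) = sgn z powi k"
  by (simp add: cis_Arg flip: cis_power_int)

lemma measurable_cis_int_Arg: "(\<lambda>z. cis (of_int k * Arg z)) \<in> borel_measurable dA"
proof (rule measurable_dA_borelI)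
  have "(\<lambda>z. cis (of_int k * Arg z)) =
      (\<lambda>z. if z = 0 then 1 else if k \<ge> 0 then sgn z ^ nat k else inverse (sgn z) ^ nat (- k))"
    by (auto simp: cis_int_Arg power_int_def Arg_zero)
  also have "\<dots> \<in> borel_measurable borel" by (measurable; simp add: sgn_div_norm)
  finally show "(\<lambda>z. cis (of_int k * Arg z)) \<in> borel_measurable borel" .
qed

lemma integrable_polar_iff:
  "integrable dA (polar k \<psi>) \<longleftrightarrow> integrable dA (\<lambda>z. \<psi> (cmod z))"
proof
  assume "integrable dA (polar k \<psi>)"
  from integrable_dA_mult_bounded[OF this measurable_cis_int_Arg[of "- k"], of 1]
  show "integrable dA (\<lambda>z. \<psi> (cmod z))"
    by (simp add: polar_def mult.assoc[symmetric] cis_mult)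
next
  assume "integrable dA (\<lambda>z. \<psi> (cmod z))"
  from integrable_dA_mult_bounded[OF this measurable_cis_int_Arg[of k], of 1]
  show "integrable dA (polar k \<psi>)"
    by (simp add: polar_def[abs_def])
qed

text \<open>The rotation by \<open>\<pi> / k\<close> preserves \<open>dA\<close> and changes the sign of the integrand.\<close>

lemma integral_polar_nonzero:
  assumes k: "k \<noteq> 0"
  shows "(LINT z|dA. polar k \<psi> z) = 0"
proof (cases "integrable dA (polar k \<psi>)")
  case True
  define c where "c = cis (pi / of_int k)"
  have eq: "polar k \<psi> (c * z) = - polar k \<psi> z" if "z \<noteq> 0" for z
  proof -
    have "cis (of_int k * Arg (c * z)) = sgn (c * z) powi k"
      using that by (intro cis_int_Arg) (auto simp: c_def)
    also have "\<dots> = c powi k * sgn z powi k"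
      by (simp add: sgn_mult power_int_mult_distrib c_def)
    also have "c powi k = -1" using k by (simp add: c_def cis_power_int)
    finally show ?thesis using that by (simp add: polar_def norm_mult c_def cis_int_Arg)
  qed
  have "(LINT z|dA. polar k \<psi> z) = (LINT z|dA. polar k \<psi> (c * z))"
    using True by (intro integral_dA_rotate[symmetric]) (auto simp: c_def)
  also have "\<dots> = (LINT z|dA. - polar k \<psi> z)"
  proof (rule integral_cong_AE)
    have "(\<lambda>z. polar k \<psi> (c * z)) \<in> borel_measurable dA"
      using measurable_compose[OF dA_distr_rotation(2), of c "polar k \<psi>" borel] True
      by (auto simp: c_def)
    then show "(\<lambda>z. polar k \<psi> (c * z)) \<in> borel_measurable dA" .
    show "AE z in dA. polar k \<psi> (c * z) = - polar k \<psi> z"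
      using AE_dA_nonzero by eventually_elim (rule eq)
  qed (use True in auto)
  finally show ?thesis by simp
qed (simp add: not_integrable_integral_eq)

lemma monomial_polar:
  "z ^ i * cnj z ^ j = polar (int i - int j) (\<lambda>r. complex_of_real (r ^ (i + j))) z"
proof -
  have 1: "z ^ m = rcis (cmod z ^ m) (real m * Arg z)" for m
    by (subst rcis_cmod_Arg[symmetric, of z]) (simp add: DeMoivre2)
  have 2: "cnj z ^ m = rcis (cmod z ^ m) (- (real m * Arg z))" for m
  proof -
    have "cnj z ^ m = cnj (z ^ m)" by simp
    also have "\<dots> = cnj (rcis (cmod z ^ m) (real m * Arg z))" by (simp only: 1)
    also have "\<dots> = rcis (cmod z ^ m) (- (real m * Arg z))"
      by (simp only: rcis_def complex_cnj_mult cis_cnj complex_cnj_complex_of_real)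
    finally show ?thesis .
  qed
  show ?thesis unfolding 1 2 rcis_mult
    by (simp add: polar_def rcis_def power_add algebra_simps)
qed

text \<open>The orthogonal basis of the harmonic Bergman space: on the disk, \<open>hbasis n\<close> is
  \<open>r ^ \<bar>n\<bar> * exp (\<i> n \<theta>)\<close>.\<close>

definition hbasis :: "int \<Rightarrow> complex \<Rightarrow> complex"
  where "hbasis n z = (if z \<in> disk then if n \<ge> 0 then z ^ nat n else cnj z ^ nat (- n) else 0)"

lemma hbasis_polar:
  assumes "z \<in> disk"
  shows "hbasis n z = polar n (\<lambda>r. complex_of_real (r ^ nat \<bar>n\<bar>)) z"
proof -
  have "hbasis n z = z ^ nat n * cnj z ^ nat (- n)" using assms by (simp add: hbasis_def)
  moreover have "int (nat n) - int (nat (- n)) = n" "nat n + nat (- n) = nat \<bar>n\<bar>" by auto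
  ultimately show ?thesis by (simp only: monomial_polar)
qed

lemma measurable_hbasis: "hbasis n \<in> borel_measurable dA"
proof -
  have "(\<lambda>z::complex. if n \<ge> 0 then z ^ nat n else cnj z ^ nat (- n)) \<in> borel_measurable dA"
    by (intro measurable_dA_borelI borel_measurable_continuous_onI) (cases "n \<ge> 0"; auto intro!: continuous_intros)
  then show ?thesis
    by (rule iffD2[OF measurable_cong, rotated]) (simp add: hbasis_def)
qed

lemma norm_hbasis: "z \<in> disk \<Longrightarrow> cmod (hbasis n z) = cmod z ^ nat \<bar>n\<bar>"
  by (simp add: hbasis_polar polar_def norm_mult norm_power)

lemma norm_hbasis_le_1: "cmod (hbasis n z) \<le> 1"
proof (cases "z \<in> disk")
  case True
  then show ?thesis by (simp add: norm_hbasis power_le_one del: mem_ball)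
qed (simp add: hbasis_def)

lemma integral_cmod_power: "(LINT z|dA. complex_of_real (cmod z ^ n)) = 2 / of_nat (n + 2)"
proof -
  have "(LINT z|dA. complex_of_real (cmod z ^ n)) = (LINT z|dA. complex_of_real (cmod z powr real n))"
  proof (rule integral_cong_AE)
    show "AE z in dA. complex_of_real (cmod z ^ n) = complex_of_real (cmod z powr real n)"
      using AE_dA_nonzero by eventually_elim (simp add: powr_realpow)
  qed (auto intro!: measurable_dA_borelI)
  also have "\<dots> = complex_of_real (2 / (real n + 2))"
    using has_bochner_integral_cmod_powr[of "real n"] by (simp add: has_bochner_integral_iff)
  finally show ?thesis by simp
qed

section \<open>Harmonic functions as sums of holomorphic and antiholomorphic ones\<close>

text \<open>The Laplacian alone yields the Cauchy--Riemann equations for \<open>\<partial>f\<close> only if mixed derivatives may be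
  exchanged. Both mixed derivatives are compared with the second difference of \<open>f\<close> over a small
  parallelogram.\<close>

lemma second_derivative_symmetric:
  fixes f :: "'a::real_normed_vector \<Rightarrow> 'b::real_normed_vector"
    and f' :: "'a \<Rightarrow> 'a \<Rightarrow>\<^sub>L 'b" and f'' :: "'a \<Rightarrow> 'a \<Rightarrow>\<^sub>L 'a \<Rightarrow>\<^sub>L 'b"
  assumes "open S" "z0 \<in> S"
    and f': "\<And>z. z \<in> S \<Longrightarrow> (f has_derivative blinfun_apply (f' z)) (at z)"
    and f'': "\<And>z. z \<in> S \<Longrightarrow> (f' has_derivative blinfun_apply (f'' z)) (at z)"
    and cont: "continuous_on S f''"
  shows "f'' z0 a b = f'' z0 b a"
proof -
  have key: "norm (f'' z0 a b - f'' z0 b a) \<le> 2 * e * (norm a * norm b)" if "e > 0" for e :: real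
  proof -
    have "isCont f'' z0" using cont assms(1,2) by (simp add: continuous_on_eq_continuous_at)
    then obtain d1 where d1: "d1 > 0" "\<And>z. dist z z0 < d1 \<Longrightarrow> dist (f'' z) (f'' z0) < e"
      using \<open>e > 0\<close> unfolding continuous_at_eps_delta by blast
    obtain d2 where d2: "d2 > 0" "ball z0 d2 \<subseteq> S" using assms(1,2) open_contains_ball by blast
    define d where "d = min d1 d2"
    have d: "d > 0" "ball z0 d \<subseteq> S" "\<And>z. z \<in> ball z0 d \<Longrightarrow> norm (f'' z - f'' z0) \<le> e"
      using d1 d2 less_imp_le[OF d1(2)] by (auto simp: d_def dist_norm norm_minus_commute)
    define h where "h = d / (2 * (norm a + norm b + 1))"
    have nab: "norm a + norm b + 1 > 0" by (simp add: add_nonneg_pos)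
    have h: "h > 0" unfolding h_def using d(1) nab by (intro divide_pos_pos) auto
    have hd: "h * (norm a + norm b) < d"
    proof -
      have "h * (norm a + norm b) \<le> h * (norm a + norm b + 1)" using h by (intro mult_left_mono) auto
      also have "\<dots> = d / 2" unfolding h_def using nab by (simp add: field_simps)
      finally show ?thesis using d(1) by simp
    qed
    \<comment> \<open>The second difference of \<open>f\<close> over the parallelogram spanned by \<open>h a\<close> and \<open>h b\<close> is
      \<open>h\<^sup>2\<close> times either mixed derivative, up to an error that is small relative to \<open>h\<^sup>2\<close>.\<close>
    have claim: "norm ((f (z0 + h *\<^sub>R a + h *\<^sub>R b) - f (z0 + h *\<^sub>R a)) - (f (z0 + h *\<^sub>R b) - f z0) - (h * h) *\<^sub>R f'' z0 b a)
        \<le> e * (h * h) * (norm a * norm b)"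
      if hd: "h * (norm a + norm b) < d" for a b
    proof -
      have inb: "z0 + t *\<^sub>R a + s *\<^sub>R b \<in> ball z0 d" if "0 \<le> t" "t \<le> h" "0 \<le> s" "s \<le> h" for t s
      proof -
        have "norm (t *\<^sub>R a + s *\<^sub>R b) \<le> t * norm a + s * norm b"
          using that by (intro norm_triangle_le) auto
        also have "\<dots> \<le> h * norm a + h * norm b"
          using that by (intro add_mono mult_right_mono) auto
        also have "\<dots> < d" using hd by (simp add: algebra_simps)
        finally show ?thesis by (simp add: dist_norm norm_minus_commute add.assoc)
           (metis add.commute minus_add_distrib norm_minus_cancel uminus_add_conv_diff)
      qed
      define g where "g t = f (z0 + t *\<^sub>R a + h *\<^sub>R b) - f (z0 + t *\<^sub>R a) - t *\<^sub>R (h *\<^sub>R f'' z0 b a)" for t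
      have "norm (g h - g 0) \<le> (h * norm b * e * norm a) * norm (h - 0)"
      proof (rule differentiable_bound)
        show "convex {0..h}" by simp
        show "h \<in> {0..h}" "0 \<in> {0..h}" using h by auto
        fix t assume t: "t \<in> {0..h}"
        let ?q = "z0 + t *\<^sub>R a"
        let ?p = "?q + h *\<^sub>R b"
        have p1: "?p \<in> ball z0 d" and p2: "?q \<in> ball z0 d"
          using inb[of t h] inb[of t 0] t h by auto
        show "(g has_derivative (\<lambda>x. x *\<^sub>R (f' (?p) a - f' (?q) a - h *\<^sub>R f'' z0 b a)))
            (at t within {0..h})"
        proof -
          have along: "((\<lambda>t. f (w + t *\<^sub>R a)) has_derivative (\<lambda>x. x *\<^sub>R f' (w + t *\<^sub>R a) a)) (at t within {0..h})"
            if "w + t *\<^sub>R a \<in> S" for w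
          proof -
            have "((\<lambda>t. w + t *\<^sub>R a) has_derivative (\<lambda>x. x *\<^sub>R a)) (at t within {0..h})"
              by (auto intro!: derivative_eq_intros)
            from has_derivative_compose[OF this f'[OF that]] show ?thesis
              by (simp add: blinfun.scaleR_right)
          qed
          have "((\<lambda>t. f ((z0 + h *\<^sub>R b) + t *\<^sub>R a) - f (z0 + t *\<^sub>R a) - t *\<^sub>R (h *\<^sub>R f'' z0 b a)) has_derivative
            (\<lambda>x. x *\<^sub>R f' ((z0 + h *\<^sub>R b) + t *\<^sub>R a) a - x *\<^sub>R f' (?q) a - x *\<^sub>R (h *\<^sub>R f'' z0 b a))) (at t within {0..h})"
            using p1 p2 d(2)
            by (intro has_derivative_diff along has_derivative_scaleR_left has_derivative_ident)
               (auto simp: add_ac)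
          then show ?thesis by (simp add: g_def[abs_def] scaleR_diff_right add_ac)
        qed
        have "norm (f' (?p) - f' (?q) - f'' z0 (?p - (?q)))
            \<le> norm (?p - (?q)) * e"
        proof (rule differentiable_bound_linearization[where S = "ball z0 d"])
          show "(f' has_derivative blinfun_apply (f'' x)) (at x within ball z0 d)" if "x \<in> ball z0 d" for x
            by (rule has_derivative_at_withinI, rule f'') (use that d(2) in auto)
          show "onorm (blinfun_apply (f'' x) - blinfun_apply (f'' z0)) \<le> e" if "x \<in> ball z0 d" for x
            using d(3)[OF that] by (simp add: norm_blinfun.rep_eq minus_blinfun.rep_eq fun_diff_def)
          show "?q + s *\<^sub>R (?p - (?q)) \<in> ball z0 d" if "s \<in> {0..1}" for s
            using inb[of t "s * h"] that t h by (auto simp: mult_left_le_one_le)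
          show "z0 \<in> ball z0 d" using d by simp
        qed
        then have le: "norm (f' (?p) - f' (?q) - h *\<^sub>R f'' z0 b) \<le> h * norm b * e"
          using h by (simp add: blinfun.scaleR_right)
        have "norm (f' (?p) a - f' (?q) a - h *\<^sub>R f'' z0 b a)
          = norm ((f' (?p) - f' (?q) - h *\<^sub>R f'' z0 b) a)"
          by (simp add: blinfun.diff_left blinfun.scaleR_left)
        also have "\<dots> \<le> norm (f' (?p) - f' (?q) - h *\<^sub>R f'' z0 b) * norm a"
          by (rule norm_blinfun)
        also have "\<dots> \<le> h * norm b * e * norm a" using le by (intro mult_right_mono) auto
        finally have le2: "norm (f' (?p) a - f' (?q) a - h *\<^sub>R f'' z0 b a) \<le> h * norm b * e * norm a" .
        show "onorm (\<lambda>x. x *\<^sub>R (f' (?p) a - f' (?q) a - h *\<^sub>R f'' z0 b a)) \<le> h * norm b * e * norm a"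
          by (rule onorm_le) (use le2 in \<open>simp add: mult.commute mult_left_mono\<close>)
      qed
      then show ?thesis using h by (simp add: g_def algebra_simps)
    qed
    let ?D = "f (z0 + h *\<^sub>R a + h *\<^sub>R b) - f (z0 + h *\<^sub>R a) - (f (z0 + h *\<^sub>R b) - f z0)"
    have A: "norm (?D - (h * h) *\<^sub>R f'' z0 b a) \<le> e * (h * h) * (norm a * norm b)"
      using claim[of a b] hd by simp
    have B: "norm (?D - (h * h) *\<^sub>R f'' z0 a b) \<le> e * (h * h) * (norm a * norm b)"
      using claim[of b a] hd by (simp add: algebra_simps)
    have "(h * h) * norm (f'' z0 a b - f'' z0 b a) = norm ((?D - (h * h) *\<^sub>R f'' z0 b a) - (?D - (h * h) *\<^sub>R f'' z0 a b))"
      using h by (simp add: scaleR_diff_right[symmetric])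
    also have "\<dots> \<le> e * (h * h) * (norm a * norm b) + e * (h * h) * (norm a * norm b)"
      using norm_triangle_ineq4 A B by (meson add_mono order_trans)
    also have "\<dots> = (h * h) * (2 * e * (norm a * norm b))" by simp
    finally show ?thesis using h by (simp only: mult_le_cancel_left_pos mult_pos_pos)
  qed
  have "norm (f'' z0 a b - f'' z0 b a) \<le> 0"
  proof (rule field_le_epsilon)
    fix e :: real assume "e > 0"
    define e' where "e' = e / (2 * (norm a * norm b + 1))"
    have p: "norm a * norm b + 1 > 0" by (simp add: add_nonneg_pos)
    have e': "e' > 0" unfolding e'_def using p \<open>e > 0\<close> by (intro divide_pos_pos) auto
    have "norm (f'' z0 a b - f'' z0 b a) \<le> 2 * e' * (norm a * norm b)" by (rule key[OF e'])
    also have "\<dots> \<le> 2 * e' * (norm a * norm b + 1)" using e' by (intro mult_left_mono) auto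
    also have "\<dots> = e" unfolding e'_def using p by (simp add: field_simps)
    finally show "norm (f'' z0 a b - f'' z0 b a) \<le> 0 + e" by simp
  qed
  then show ?thesis by simp
qed

lemma harmonic_onI:
  assumes "open S"
    and "\<And>z. z \<in> S \<Longrightarrow> (f has_derivative blinfun_apply (f' z)) (at z)"
    and "\<And>z. z \<in> S \<Longrightarrow> (f' has_derivative blinfun_apply (f'' z)) (at z)"
    and "continuous_on S f''"
    and "\<And>z. z \<in> S \<Longrightarrow> f'' z 1 1 + f'' z \<i> \<i> = 0"
  shows "f harmonic_on S"
  unfolding harmonic_on_def using assms by (intro conjI exI[of _ f'] exI[of _ f'']) auto

lemma harmonic_onE:
  assumes "f harmonic_on S"
  obtains f' f'' where "open S" 
    "\<And>z. z \<in> S \<Longrightarrow> (f has_derivative blinfun_apply (f' z)) (at z)"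
    "\<And>z. z \<in> S \<Longrightarrow> (f' has_derivative blinfun_apply (f'' z)) (at z)"
    "continuous_on S f''"
    "\<And>z. z \<in> S \<Longrightarrow> f'' z 1 1 + f'' z \<i> \<i> = 0"
  using assms unfolding harmonic_on_def by blast

lemma harmonic_on_cong:
  assumes "f harmonic_on S" and eq: "\<And>z. z \<in> S \<Longrightarrow> f z = g z"
  shows "g harmonic_on S"
proof -
  have S: "open S" using assms(1) by (simp add: harmonic_on_def)
  have "(g has_derivative D) (at z)" if "(f has_derivative D) (at z)" "z \<in> S" for D z
    using has_derivative_transform_within_open[OF that(1) S that(2) eq] .
  with assms(1) show ?thesis unfolding harmonic_on_def by blast
qed

lemma harmonic_on_add:
  assumes "f harmonic_on S" "g harmonic_on S"
  shows "(\<lambda>z. f z + g z) harmonic_on S"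
proof (rule harmonic_onE[OF assms(1)], rule harmonic_onE[OF assms(2)])
  fix f' f'' g' g''
  assume S: "open S"
    and f: "\<And>z. z \<in> S \<Longrightarrow> (f has_derivative blinfun_apply (f' z)) (at z)"
      "\<And>z. z \<in> S \<Longrightarrow> (f' has_derivative blinfun_apply (f'' z)) (at z)" "continuous_on S f''"
      "\<And>z. z \<in> S \<Longrightarrow> f'' z 1 1 + f'' z \<i> \<i> = 0"
    and g: "\<And>z. z \<in> S \<Longrightarrow> (g has_derivative blinfun_apply (g' z)) (at z)"
      "\<And>z. z \<in> S \<Longrightarrow> (g' has_derivative blinfun_apply (g'' z)) (at z)" "continuous_on S g''"
      "\<And>z. z \<in> S \<Longrightarrow> g'' z 1 1 + g'' z \<i> \<i> = 0"
  show ?thesis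
  proof (rule harmonic_onI[OF S])
    fix z assume z: "z \<in> S"
    show "((\<lambda>z. f z + g z) has_derivative blinfun_apply (f' z + g' z)) (at z)"
      using f(1)[OF z] g(1)[OF z] by (auto simp: plus_blinfun.rep_eq intro!: has_derivative_add)
    show "((\<lambda>z. f' z + g' z) has_derivative blinfun_apply (f'' z + g'' z)) (at z)"
      using f(2)[OF z] g(2)[OF z] by (auto simp: plus_blinfun.rep_eq intro!: has_derivative_add)
    have "(f'' z + g'' z) 1 1 + (f'' z + g'' z) \<i> \<i> = (f'' z 1 1 + f'' z \<i> \<i>) + (g'' z 1 1 + g'' z \<i> \<i>)"
      by (simp add: blinfun.add_left)
    then show "(f'' z + g'' z) 1 1 + (f'' z + g'' z) \<i> \<i> = 0" using f(4)[OF z] g(4)[OF z] by simp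
  qed (use f(3) g(3) in \<open>auto intro!: continuous_intros\<close>)
qed

lemma harmonic_on_cnj:
  assumes "f harmonic_on S"
  shows "(\<lambda>z. cnj (f z)) harmonic_on S"
proof (rule harmonic_onE[OF assms])
  fix f' f''
  assume S: "open S"
    and f: "\<And>z. z \<in> S \<Longrightarrow> (f has_derivative blinfun_apply (f' z)) (at z)"
      "\<And>z. z \<in> S \<Longrightarrow> (f' has_derivative blinfun_apply (f'' z)) (at z)" "continuous_on S f''"
      "\<And>z. z \<in> S \<Longrightarrow> f'' z 1 1 + f'' z \<i> \<i> = 0"
  define C where "C = Blinfun cnj"
  have C: "blinfun_apply C = cnj" unfolding C_def by (rule bounded_linear_Blinfun_apply[OF bounded_linear_cnj])
  define M :: "(complex \<Rightarrow>\<^sub>L complex) \<Rightarrow>\<^sub>L complex \<Rightarrow>\<^sub>L complex" where "M = Blinfun (\<lambda>X. C o\<^sub>L X)"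
  have bM: "bounded_linear (\<lambda>X :: complex \<Rightarrow>\<^sub>L complex. C o\<^sub>L X)"
    by (rule bounded_bilinear.bounded_linear_right[OF bounded_bilinear_blinfun_compose])
  have M: "blinfun_apply M = (\<lambda>X. C o\<^sub>L X)"
    unfolding M_def by (rule bounded_linear_Blinfun_apply[OF bM])
  show ?thesis
  proof (rule harmonic_onI[OF S])
    fix z assume z: "z \<in> S"
    show "((\<lambda>z. cnj (f z)) has_derivative blinfun_apply (C o\<^sub>L f' z)) (at z)"
      using has_derivative_cnj[OF f(1)[OF z]] by (simp add: C o_def blinfun_compose.rep_eq)
    show "((\<lambda>z. C o\<^sub>L f' z) has_derivative blinfun_apply (M o\<^sub>L f'' z)) (at z)"
      using bounded_linear.has_derivative[OF bM f(2)[OF z]] by (simp add: M o_def blinfun_compose.rep_eq)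
    show "(M o\<^sub>L f'' z) 1 1 + (M o\<^sub>L f'' z) \<i> \<i> = 0"
      using f(4)[OF z] by (simp add: M C flip: complex_cnj_add)
  qed (use f(3) in \<open>auto intro!: continuous_intros\<close>)
qed

lemma holomorphic_imp_harmonic_on:
  assumes "F holomorphic_on S" "open S"
  shows "F harmonic_on S"
proof -
  let ?m = "blinfun_mult_right :: complex \<Rightarrow> _"
  define B where "B = Blinfun ?m"
  have bm: "bounded_linear ?m" by (rule bounded_linear_blinfun_mult_right)
  have B: "blinfun_apply B = ?m" unfolding B_def by (rule bounded_linear_Blinfun_apply[OF bm])
  have h': "deriv F holomorphic_on S" and h'': "deriv (deriv F) holomorphic_on S"
    using assms by (auto intro!: holomorphic_deriv)
  show ?thesis
  proof (rule harmonic_onI[OF assms(2)])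
    fix z assume z: "z \<in> S"
    show "(F has_derivative blinfun_apply (?m (deriv F z))) (at z)"
      using holomorphic_derivI[OF assms z, of UNIV] by (simp add: has_field_derivative_def blinfun_mult_right.rep_eq)
    have "(deriv F has_derivative (\<lambda>h. deriv (deriv F) z * h)) (at z)"
      using holomorphic_derivI[OF h' assms(2) z, of UNIV] by (simp add: has_field_derivative_def)
    from bounded_linear.has_derivative[OF bm this]
    show "((\<lambda>z. ?m (deriv F z)) has_derivative blinfun_apply (B o\<^sub>L ?m (deriv (deriv F) z))) (at z)"
      by (simp add: B o_def blinfun_compose.rep_eq blinfun_mult_right.rep_eq)
    show "(B o\<^sub>L ?m (deriv (deriv F) z)) 1 1 + (B o\<^sub>L ?m (deriv (deriv F) z)) \<i> \<i> = 0"
      by (simp add: B blinfun_mult_right.rep_eq mult.assoc)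
  qed (auto intro!: continuous_intros bounded_linear.continuous_on[OF bm holomorphic_on_imp_continuous_on[OF h'']])
qed

text \<open>For harmonic \<open>f\<close>, the derivative \<open>\<partial>f = (f\<^sub>x - \<i> f\<^sub>y) / 2\<close> satisfies the Cauchy--Riemann equations:
  one of them is Laplace's equation, the other the symmetry of the second derivative.\<close>

lemma harmonic_on_wirtinger:
  assumes "f harmonic_on S"
  obtains f' \<delta> where "\<And>z. z \<in> S \<Longrightarrow> (f has_derivative f' z) (at z)"
    "\<And>z. \<delta> z = (f' z 1 - \<i> * f' z \<i>) / 2" "\<delta> holomorphic_on S"
proof -
  obtain f' f'' where f: "\<And>z. z\<in>S \<Longrightarrow> (f has_derivative blinfun_apply (f' z)) (at z)"
    "\<And>z. z\<in>S \<Longrightarrow> (f' has_derivative blinfun_apply (f'' z)) (at z)" "continuous_on S f''"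
    "\<And>z. z\<in>S \<Longrightarrow> blinfun_apply (blinfun_apply (f'' z) 1) 1 + blinfun_apply (blinfun_apply (f'' z) \<i>) \<i> = 0"
    and S: "open S"
    using assms(1) unfolding harmonic_on_def by blast
  define D where "D z = (f' z 1 - \<i> * f' z \<i>) / 2" for z
  have "D holomorphic_on S"
  proof (subst holomorphic_on_open[OF S], safe)
    fix z assume z: "z \<in> S"
    have sym: "f'' z \<i> 1 = f'' z 1 \<i>"
      by (rule second_derivative_symmetric[OF S z f(1,2,3)]) auto
    define c where "c = (f'' z 1 1 - \<i> * f'' z 1 \<i>) / 2"
    have "(D has_derivative (\<lambda>h. (f'' z h 1 - \<i> * f'' z h \<i>) / 2)) (at z)"
      unfolding D_def by (auto intro!: derivative_eq_intros f(2)[OF z])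
    moreover have "(\<lambda>h. (f'' z h 1 - \<i> * f'' z h \<i>) / 2) = (*) c"
    proof
      fix h :: complex
      have h: "h = Re h *\<^sub>R 1 + Im h *\<^sub>R \<i>" by (simp add: complex_eq_iff)
      have lap: "f'' z \<i> \<i> = - f'' z 1 1" using f(4)[OF z] by (simp add: add_eq_0_iff)
      have e: "f'' z h = Re h *\<^sub>R f'' z 1 + Im h *\<^sub>R f'' z \<i>"
        by (subst h) (simp only: blinfun.add_right blinfun.scaleR_right)
      show "(f'' z h 1 - \<i> * f'' z h \<i>) / 2 = c * h"
        unfolding e c_def by (simp add: blinfun.add_left blinfun.scaleR_left sym lap complex_eq_iff algebra_simps)
    qed
    ultimately show "\<exists>D'. (D has_field_derivative D') (at z)"
      by (auto simp: has_field_derivative_def)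
  qed
  with f(1) show ?thesis using D_def by (intro that[of "\<lambda>z. blinfun_apply (f' z)" D]) auto
qed

text \<open>\<open>F\<close> and \<open>G\<close> are primitives of the holomorphic functions \<open>\<partial>f\<close> and \<open>\<partial>(cnj f)\<close>; then
  \<open>f - F - cnj G\<close> has zero derivative, and the constant is absorbed into \<open>F\<close>.\<close>

theorem harmonic_on_convex_decompose:
  assumes f: "f harmonic_on S" and cvx: "convex S"
  obtains F G where "F holomorphic_on S" "G holomorphic_on S" "\<And>z. z \<in> S \<Longrightarrow> f z = F z + cnj (G z)"
proof -
  have S: "open S" using f by (simp add: harmonic_on_def)
  obtain f' P where f': "\<And>z. z \<in> S \<Longrightarrow> (f has_derivative f' z) (at z)"
    "\<And>z. P z = (f' z 1 - \<i> * f' z \<i>) / 2" "P holomorphic_on S"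
    using harmonic_on_wirtinger[OF f] by metis
  obtain g' R where g': "\<And>z. z \<in> S \<Longrightarrow> ((\<lambda>z. cnj (f z)) has_derivative g' z) (at z)"
    "\<And>z. R z = (g' z 1 - \<i> * g' z \<i>) / 2" "R holomorphic_on S"
    using harmonic_on_wirtinger[OF harmonic_on_cnj[OF f]] by metis
  have g'f': "g' z = (\<lambda>h. cnj (f' z h))" if "z \<in> S" for z
    using has_derivative_unique[OF g'(1)[OF that] has_derivative_cnj[OF f'(1)[OF that]]] .
  obtain F where F0: "\<And>z. z \<in> S \<Longrightarrow> (F has_field_derivative P z) (at z within S)"
    using holomorphic_convex_primitive'[OF cvx S f'(3)] by blast
  have F: "(F has_field_derivative P z) (at z)" if "z \<in> S" for z
    using F0[OF that] at_within_open[OF that S] by simp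
  obtain G where G0: "\<And>z. z \<in> S \<Longrightarrow> (G has_field_derivative R z) (at z within S)"
    using holomorphic_convex_primitive'[OF cvx S g'(3)] by blast
  have G: "(G has_field_derivative R z) (at z)" if "z \<in> S" for z
    using G0[OF that] at_within_open[OF that S] by simp
  have "\<exists>c. \<forall>z\<in>S. f z - F z - cnj (G z) = c"
  proof (rule has_derivative_zero_constant[OF cvx])
    fix z assume z: "z \<in> S"
    interpret bounded_linear "f' z" using f'(1)[OF z] by (rule has_derivative_bounded_linear)
    have "((\<lambda>z. f z - F z - cnj (G z)) has_derivative (\<lambda>h. f' z h - P z * h - cnj (R z * h))) (at z)"
      using f'(1)[OF z] F[OF z] G[OF z] unfolding has_field_derivative_def
      by (intro has_derivative_diff has_derivative_cnj)
    moreover have "(\<lambda>h. f' z h - P z * h - cnj (R z * h)) = (\<lambda>h. 0)"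
    proof
      fix h :: complex
      have h: "h = Re h *\<^sub>R 1 + Im h *\<^sub>R \<i>" by (simp add: complex_eq_iff)
      have e: "f' z h = Re h *\<^sub>R f' z 1 + Im h *\<^sub>R f' z \<i>"
        by (subst h) (simp only: add scaleR)
      show "f' z h - P z * h - cnj (R z * h) = 0"
        unfolding e f'(2) g'(2) g'f'[OF z]
        by (simp add: complex_eq_iff algebra_simps) (simp add: field_simps)
    qed
    ultimately show "((\<lambda>z. f z - F z - cnj (G z)) has_derivative (\<lambda>h. 0)) (at z within S)"
      by (auto intro: has_derivative_at_withinI)
  qed
  then obtain c where c: "\<And>z. z \<in> S \<Longrightarrow> f z - F z - cnj (G z) = c" by blast
  show ?thesis
  proof (rule that[of "\<lambda>z. F z + c" G])
    have "F holomorphic_on S" and G_hol: "G holomorphic_on S"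
      using F G S by (auto simp: holomorphic_on_open)
    then show "(\<lambda>z. F z + c) holomorphic_on S" by (intro holomorphic_intros)
    show "G holomorphic_on S" by (rule G_hol)
    show "f z = F z + c + cnj (G z)" if "z \<in> S" for z using c[OF that] by (simp add: algebra_simps)
  qed
qed

section \<open>Orthogonal expansions in the harmonic Bergman space\<close>

lemma borel_measurable_dA_continuous:
  fixes f :: "complex \<Rightarrow> complex"
  assumes "continuous_on disk f" shows "f \<in> borel_measurable dA"
  using continuous_imp_measurable_on_sets_lebesgue[OF assms]
  by (simp add: measurable_cong_sets[OF sets_dA refl])

lemma harmonic_on_imp_continuous_on: "f harmonic_on S \<Longrightarrow> continuous_on S f"
  by (erule harmonic_onE)
     (auto intro!: continuous_at_imp_continuous_on has_derivative_continuous)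

lemma Lh2_measurable: "f \<in> Lh2 \<Longrightarrow> f \<in> borel_measurable dA"
  by (auto simp: Lh2_def intro!: borel_measurable_dA_continuous harmonic_on_imp_continuous_on)

lemma Lh2_square_integrable: "f \<in> Lh2 \<Longrightarrow> integrable dA (\<lambda>z. (cmod (f z))\<^sup>2)"
  by (simp add: Lh2_def)

lemma Lh2_outside: "f \<in> Lh2 \<Longrightarrow> z \<notin> disk \<Longrightarrow> f z = 0"
  by (simp add: Lh2_def)

lemma Lh2_integrable:
  assumes "f \<in> Lh2" shows "integrable dA f"
proof (rule Bochner_Integration.integrable_bound)
  show "integrable dA (\<lambda>z. 1 + (cmod (f z))\<^sup>2)"
    by (intro Bochner_Integration.integrable_add Lh2_square_integrable[OF assms]
        finite_measure.integrable_const[OF finite_measure_dA])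
  show "AE z in dA. cmod (f z) \<le> norm (1 + (cmod (f z))\<^sup>2)"
  proof (rule AE_I2)
    fix z
    have "2 * cmod (f z) \<le> 1 + (cmod (f z))\<^sup>2" using sum_squares_ge_zero[of "cmod (f z) - 1" 0]
      by (simp add: power2_eq_square algebra_simps)
    then have "cmod (f z) \<le> 1 + (cmod (f z))\<^sup>2" using norm_ge_zero[of "f z"] by linarith
    then show "cmod (f z) \<le> norm (1 + (cmod (f z))\<^sup>2)" by simp
  qed
qed (rule Lh2_measurable[OF assms])

lemma L2norm_nonneg: "L2norm f \<ge> 0"
  by (simp add: L2norm_def)

lemma L2norm_square: "(L2norm f)\<^sup>2 = (LINT z|dA. (cmod (f z))\<^sup>2)"
  by (simp add: L2norm_def integral_nonneg_AE)

lemma borel_measurable_cnj [measurable (raw)]: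
  "f \<in> borel_measurable M \<Longrightarrow> (\<lambda>z. cnj (f z)) \<in> borel_measurable M"
  by (rule borel_measurable_continuous_on[of cnj]) (auto intro!: continuous_intros)

lemma integrable_mult_cnj_hbasis:
  assumes "integrable dA f" shows "integrable dA (\<lambda>z. f z * cnj (hbasis n z))"
  using integrable_dA_mult_bounded[OF assms, of "\<lambda>z. cnj (hbasis n z)" 1] norm_hbasis_le_1 measurable_hbasis
  by (simp add: mult.commute borel_measurable_cnj)

text \<open>\<open>1 / hweight n\<close> is the square of the norm of \<open>hbasis n\<close>.\<close>

definition hweight :: "int \<Rightarrow> real"
  where "hweight n = real_of_int \<bar>n\<bar> + 1"

lemma hweight_pos: "hweight n > 0"
  by (simp add: hweight_def)

lemma hweight_neq_0 [simp]: "hweight n \<noteq> 0"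
  using hweight_pos[of n] by simp

text \<open>The coefficient of \<open>hbasis n\<close> in the orthogonal expansion; it makes sense for every integrable
  function, which matters because \<open>Q\<close> is applied to products with integrable symbols.\<close>

definition hcoeff :: "int \<Rightarrow> (complex \<Rightarrow> complex) \<Rightarrow> complex"
  where "hcoeff n f = complex_of_real (hweight n) * (LINT z|dA. f z * cnj (hbasis n z))"

lemma integrable_hbasis: "integrable dA (hbasis n)"
  using norm_hbasis_le_1 measurable_hbasis by (intro integrable_dA_bounded[of _ 1]) auto

lemma integral_polar_mult_cnj_hbasis:
  "(LINT z|dA. polar k \<psi> z * cnj (hbasis n z)) =
     (if k = n then LINT z|dA. \<psi> (cmod z) * of_real (cmod z ^ nat \<bar>n\<bar>) else 0)"
proof -
  have "(LINT z|dA. polar k \<psi> z * cnj (hbasis n z)) = (LINT z|dA. polar (k - n) (\<lambda>r. \<psi> r * of_real (r ^ nat \<bar>n\<bar>)) z)"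
    by (intro Bochner_Integration.integral_cong) (auto simp: hbasis_polar cnj_polar polar_mult)
  then show ?thesis
    using integral_polar_nonzero[of "k - n"] by (simp add: polar_zero_index)
qed

lemma integrable_mult_hbasis:
  assumes "integrable dA f" shows "integrable dA (\<lambda>z. f z * hbasis n z)"
  using integrable_dA_mult_bounded[OF assms measurable_hbasis, of n 1] norm_hbasis_le_1 by (simp add: mult.commute)

lemma hbasis_orthogonal:
  "(LINT z|dA. hbasis m z * cnj (hbasis n z)) = (if m = n then 1 / complex_of_real (hweight n) else 0)"
proof -
  have "(LINT z|dA. hbasis m z * cnj (hbasis n z)) =
      (LINT z|dA. polar m (\<lambda>r. complex_of_real (r ^ nat \<bar>m\<bar>)) z * cnj (hbasis n z))"
    by (intro Bochner_Integration.integral_cong) (auto simp: hbasis_polar)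
  also have "\<dots> = (if m = n then LINT z|dA. of_real (cmod z ^ (nat \<bar>n\<bar> + nat \<bar>n\<bar>)) else 0)"
    by (simp add: integral_polar_mult_cnj_hbasis power_add)
  also have "(LINT z|dA. complex_of_real (cmod z ^ (nat \<bar>n\<bar> + nat \<bar>n\<bar>))) = 1 / complex_of_real (hweight n)"
  proof -
    have e: "of_nat (nat \<bar>n\<bar> + nat \<bar>n\<bar> + 2) = 2 * complex_of_real (hweight n)"
      by (simp add: hweight_def complex_eq_iff)
    show ?thesis unfolding integral_cmod_power e by simp
  qed
  finally show ?thesis .
qed

lemma integrable_norm_square_bounded:
  fixes g :: "complex \<Rightarrow> complex"
  assumes g: "g \<in> borel_measurable dA" and b: "\<And>z. cmod (g z) \<le> B"
  shows "integrable dA (\<lambda>z. (cmod (g z))\<^sup>2)"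
proof -
  have "integrable dA (\<lambda>z. g z * cnj (g z))"
    using g b by (intro integrable_dA_mult_bounded[where f = "\<lambda>z. cnj (g z)"] integrable_dA_bounded borel_measurable_cnj) auto
  then show ?thesis
    by (simp add: complex_norm_square[symmetric] complex_of_real_integrable_eq flip: of_real_power)
qed

lemma norm_sum_hbasis_le: "cmod (\<Sum>n\<in>A. c n * hbasis n z) \<le> (\<Sum>n\<in>A. cmod (c n))"
  using norm_hbasis_le_1 by (intro sum_norm_le) (auto simp: norm_mult intro: mult_left_le)

lemma pythagoras_hbasis:
  assumes "finite A"
  shows "(LINT z|dA. (cmod (\<Sum>n\<in>A. c n * hbasis n z))\<^sup>2) = (\<Sum>n\<in>A. (cmod (c n))\<^sup>2 / hweight n)"
proof -
  have int: "integrable dA (\<lambda>z. hbasis m z * cnj (hbasis n z))" for m n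
    by (intro integrable_mult_cnj_hbasis integrable_hbasis)
  have "complex_of_real (LINT z|dA. (cmod (\<Sum>n\<in>A. c n * hbasis n z))\<^sup>2) =
     (LINT z|dA. (\<Sum>n\<in>A. c n * hbasis n z) * cnj (\<Sum>n\<in>A. c n * hbasis n z))"
    by (simp only: integral_complex_of_real[symmetric] complex_norm_square)
  also have "\<dots> = (LINT z|dA. (\<Sum>m\<in>A. \<Sum>n\<in>A. (c m * cnj (c n)) * (hbasis m z * cnj (hbasis n z))))"
    by (simp add: sum_product mult_ac)
  also have "\<dots> = (\<Sum>m\<in>A. \<Sum>n\<in>A. (c m * cnj (c n)) * (LINT z|dA. hbasis m z * cnj (hbasis n z)))"
    using int by (simp add: integral_sum)
  also have "\<dots> = (\<Sum>m\<in>A. c m * cnj (c m) / complex_of_real (hweight m))"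
    using assms by (simp add: hbasis_orthogonal if_distrib[where f = "\<lambda>x. _ * x"] sum.delta' cong: if_cong)
  also have "\<dots> = complex_of_real (\<Sum>n\<in>A. (cmod (c n))\<^sup>2 / hweight n)"
    by (simp add: complex_norm_square[symmetric])
  finally show ?thesis by (simp only: of_real_eq_iff)
qed

text \<open>The usual argument: the squared distance of \<open>f\<close> from its orthogonal projection to the span of the
  chosen basis vectors is nonnegative.\<close>

lemma bessel:
  assumes f: "f \<in> Lh2" and A: "finite A"
  shows "(\<Sum>n\<in>A. (cmod (hcoeff n f))\<^sup>2 / hweight n) \<le> (L2norm f)\<^sup>2"
proof -
  define g where "g z = (\<Sum>n\<in>A. hcoeff n f * hbasis n z)" for z
  define s where "s = (\<Sum>n\<in>A. (cmod (hcoeff n f))\<^sup>2 / hweight n)"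
  have gm: "g \<in> borel_measurable dA" unfolding g_def using measurable_hbasis by (intro borel_measurable_sum borel_measurable_times) auto
  have gb: "cmod (g z) \<le> (\<Sum>n\<in>A. cmod (hcoeff n f))" for z
    unfolding g_def by (rule norm_sum_hbasis_le)
  have g2: "integrable dA (\<lambda>z. (cmod (g z))\<^sup>2)" by (rule integrable_norm_square_bounded[OF gm gb])
  have fg: "integrable dA (\<lambda>z. f z * cnj (g z))"
    using integrable_dA_mult_bounded[OF Lh2_integrable[OF f], of "\<lambda>z. cnj (g z)" "\<Sum>n\<in>A. cmod (hcoeff n f)"] gm gb
    by (simp add: mult.commute borel_measurable_cnj)
  have "(LINT z|dA. f z * cnj (g z)) = (LINT z|dA. (\<Sum>n\<in>A. cnj (hcoeff n f) * (f z * cnj (hbasis n z))))"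
    by (simp add: g_def sum_distrib_left mult_ac)
  also have "\<dots> = (\<Sum>n\<in>A. cnj (hcoeff n f) * (LINT z|dA. f z * cnj (hbasis n z)))"
    using integrable_mult_cnj_hbasis[OF Lh2_integrable[OF f]] by (simp add: integral_sum)
  also have "\<dots> = (\<Sum>n\<in>A. hcoeff n f * cnj (hcoeff n f) / complex_of_real (hweight n))"
    by (intro sum.cong refl) (simp add: hcoeff_def)
  also have "\<dots> = complex_of_real s" by (simp add: s_def complex_norm_square[symmetric])
  finally have fgs: "Re (LINT z|dA. f z * cnj (g z)) = s" by simp
  have "0 \<le> (LINT z|dA. (cmod (f z - g z))\<^sup>2)" by (intro integral_nonneg_AE) auto
  also have "\<dots> = (LINT z|dA. (cmod (f z))\<^sup>2 + (cmod (g z))\<^sup>2 - 2 * Re (f z * cnj (g z)))"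
    by (intro Bochner_Integration.integral_cong refl) (unfold cmod_power2, simp add: power2_eq_square algebra_simps)
  also have "\<dots> = (L2norm f)\<^sup>2 + s - 2 * Re (LINT z|dA. f z * cnj (g z))"
  proof -
    define p where "p z = f z * cnj (g z)" for z
    have p: "integrable dA p" using fg by (simp add: p_def[abs_def])
    have gs: "(LINT z|dA. (cmod (g z))\<^sup>2) = s" unfolding g_def s_def by (rule pythagoras_hbasis[OF A])
    show ?thesis
      using Lh2_square_integrable[OF f] g2 p unfolding p_def[symmetric]
      by (simp add: L2norm_square integral_Re gs)
  qed
  finally show ?thesis using fgs by (simp add: s_def)
qed

text \<open>Expansions are summed symmetrically; \<open>syn d\<close> (synthesis) is the function with coefficients \<open>d\<close>.
  Since \<open>lim\<close> is total, its values are meaningful only where the partial sums converge.\<close>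

definition psum :: "(int \<Rightarrow> complex) \<Rightarrow> nat \<Rightarrow> complex \<Rightarrow> complex"
  where "psum d N z = (\<Sum>n\<in>{- int N..int N}. d n * hbasis n z)"

definition syn :: "(int \<Rightarrow> complex) \<Rightarrow> complex \<Rightarrow> complex"
  where "syn d z = lim (\<lambda>N. psum d N z)"

text \<open>Equivalently, the two power series into which the expansion splits have radius of convergence at
  least \<open>1\<close>.\<close>

definition absconv :: "(int \<Rightarrow> complex) \<Rightarrow> bool"
  where "absconv d \<longleftrightarrow> (\<forall>r. 0 \<le> r \<and> r < 1 \<longrightarrow>
     summable (\<lambda>n. cmod (d (int n)) * r ^ n) \<and> summable (\<lambda>n. cmod (d (- int n)) * r ^ n))"

lemma sum_int_Suc:
  fixes g :: "int \<Rightarrow> 'a::comm_monoid_add"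
  shows "(\<Sum>n\<in>{- int (Suc N)..int (Suc N)}. g n) = (\<Sum>n\<in>{- int N..int N}. g n) + g (int (Suc N)) + g (- int (Suc N))"
proof -
  have "{- int (Suc N)..int (Suc N)} = insert (- int (Suc N)) (insert (int (Suc N)) {- int N..int N})" by auto
  then show ?thesis by (simp add: add_ac)
qed

lemma psum_outside: "z \<notin> disk \<Longrightarrow> psum d N z = 0"
  by (simp add: psum_def hbasis_def)

lemma psum_eq:
  assumes "z \<in> disk"
  shows "psum d N z = (\<Sum>n<Suc N. d (int n) * z ^ n) + (\<Sum>n<Suc N. d (- int n) * cnj z ^ n) - d 0"
proof (induction N)
  case 0 then show ?case using assms by (simp add: psum_def hbasis_def)
next
  case (Suc N)
  have "psum d (Suc N) z = psum d N z + d (int (Suc N)) * z ^ Suc N + d (- int (Suc N)) * cnj z ^ Suc N"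
    unfolding psum_def sum_int_Suc using assms by (simp add: hbasis_def nat_add_distrib)
  then show ?case unfolding Suc.IH by (simp add: algebra_simps)
qed

lemma absconv_summable:
  assumes "absconv d" "cmod z < 1"
  shows "summable (\<lambda>n. d (int n) * z ^ n)" "summable (\<lambda>n. d (- int n) * z ^ n)"
  using assms unfolding absconv_def
  by (auto intro!: summable_norm_cancel[of "\<lambda>n. _ n * z ^ n"] simp: norm_mult norm_power)

lemma psum_tendsto_series:
  assumes "absconv d" "z \<in> disk"
  shows "(\<lambda>N. psum d N z) \<longlonglongrightarrow> (\<Sum>n. d (int n) * z ^ n) + (\<Sum>n. d (- int n) * cnj z ^ n) - d 0"
  unfolding psum_eq[OF assms(2)]
  using absconv_summable[OF assms(1), of z] absconv_summable[OF assms(1), of "cnj z"] assms(2)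
  by (intro tendsto_intros LIMSEQ_Suc summable_LIMSEQ) auto

lemma psum_tendsto:
  assumes "absconv d"
  shows "(\<lambda>N. psum d N z) \<longlonglongrightarrow> syn d z"
proof -
  have "convergent (\<lambda>N. psum d N z)"
    using psum_tendsto_series[OF assms, of z] psum_outside[of z d]
    by (cases "z \<in> disk") (auto simp: convergent_def)
  then show ?thesis by (simp add: syn_def convergent_LIMSEQ_iff)
qed

lemma syn_eqI: "(\<lambda>N. psum d N z) \<longlonglongrightarrow> l \<Longrightarrow> syn d z = l"
  by (simp add: syn_def limI)

lemma syn_outside: "z \<notin> disk \<Longrightarrow> syn d z = 0"
  by (simp add: syn_def psum_outside)

lemma syn_harmonic:
  assumes d: "absconv d" shows "syn d harmonic_on disk"
proof -
  define F where "F z = (\<Sum>n. d (int n) * z ^ n)" for z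
  define G where "G z = (\<Sum>n. cnj (d (- int n)) * z ^ n)" for z
  have "F holomorphic_on disk"
    unfolding F_def using absconv_summable(1)[OF d]
    by (intro power_series_holomorphic[where a = "\<lambda>n. d (int n)"]) (auto intro: summable_sums)
  moreover have sG: "summable (\<lambda>n. cnj (d (- int n)) * z ^ n)" if "cmod z < 1" for z
    using summable_sums[OF absconv_summable(2)[OF d, of "cnj z"], THEN sums_cnj[THEN iffD2]] that
    by (auto simp: sums_iff)
  then have "G holomorphic_on disk"
    unfolding G_def
    by (intro power_series_holomorphic[where a = "\<lambda>n. cnj (d (- int n))"]) (auto intro: summable_sums)
  ultimately have "(\<lambda>z. (F z - d 0) + cnj (G z)) harmonic_on disk"
    by (intro harmonic_on_add harmonic_on_cnj holomorphic_imp_harmonic_on holomorphic_intros) auto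
  then show ?thesis
  proof (rule harmonic_on_cong)
    fix z :: complex assume z: "z \<in> disk"
    have "(\<Sum>n. d (- int n) * cnj z ^ n) = cnj (G z)"
      using summable_sums[OF sG[of z], THEN sums_cnj[THEN iffD2]] z by (simp add: G_def sums_iff)
    then show "F z - d 0 + cnj (G z) = syn d z"
      using syn_eqI[OF psum_tendsto_series[OF d z]] by (simp add: F_def)
  qed
qed

lemma psum_bounded:
  assumes d: "absconv d" and r: "0 \<le> r" "r < 1"
  obtains K where "\<And>N z. cmod z \<le> r \<Longrightarrow> cmod (psum d N z) \<le> K"
proof
  fix N z assume z: "cmod z \<le> r"
  have s: "summable (\<lambda>n. cmod (d (int n)) * r ^ n)" "summable (\<lambda>n. cmod (d (- int n)) * r ^ n)"
    using d r by (auto simp: absconv_def)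
  have part: "cmod (\<Sum>n<Suc N. a n * v ^ n) \<le> (\<Sum>n. cmod (a n) * r ^ n)"
    if "summable (\<lambda>n. cmod (a n) * r ^ n)" "cmod v = cmod z" for a v
  proof -
    have "cmod (\<Sum>n<Suc N. a n * v ^ n) \<le> (\<Sum>n<Suc N. cmod (a n) * r ^ n)"
      using z that(2) by (intro sum_norm_le) (auto simp: norm_mult norm_power intro!: mult_left_mono power_mono)
    also have "\<dots> \<le> (\<Sum>n. cmod (a n) * r ^ n)" using that(1) r by (intro sum_le_suminf) auto
    finally show ?thesis .
  qed
  have 1: "cmod (\<Sum>n<Suc N. d (int n) * z ^ n) \<le> (\<Sum>n. cmod (d (int n)) * r ^ n)"
    by (rule part[OF s(1) refl])
  have 2: "cmod (\<Sum>n<Suc N. d (- int n) * cnj z ^ n) \<le> (\<Sum>n. cmod (d (- int n)) * r ^ n)"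
    by (rule part[OF s(2)]) simp
  have zd: "z \<in> disk" using z r by auto
  show "cmod (psum d N z) \<le> (\<Sum>n. cmod (d (int n)) * r ^ n) + (\<Sum>n. cmod (d (- int n)) * r ^ n) + cmod (d 0)"
    unfolding psum_eq[OF zd] using norm_triangle_ineq4 norm_triangle_ineq 1 2
    by (meson add_mono_thms_linordered_semiring(1) add_mono_thms_linordered_semiring(3) order_trans)
qed

lemma measurable_psum: "psum d N \<in> borel_measurable dA"
  unfolding psum_def[abs_def] using measurable_hbasis by (intro borel_measurable_sum borel_measurable_times) auto

text \<open>On a disk of radius \<open>r < 1\<close> the expansion converges uniformly, so that it may be integrated
  termwise, and rotation invariance keeps the basis orthogonal there. Dominated convergence for
  \<open>r \<rightarrow> 1\<close> then gives the coefficient on the full disk.\<close>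

lemma hcoeff_syn_absconv:
  assumes d: "absconv d" and int: "integrable dA (syn d)"
  shows "hcoeff n (syn d) = d n"
proof -
  define \<nu> where "\<nu> r = (LINT z|dA. indicator (ball 0 r) z * (hbasis n z * cnj (hbasis n z)))" for r
  have im: "(indicator (ball 0 r) :: complex \<Rightarrow> complex) \<in> borel_measurable dA" for r :: real
    by (intro measurable_dA_borelI borel_measurable_indicator) simp
  have hm: "(\<lambda>z. cnj (hbasis n z)) \<in> borel_measurable dA" for n
    by (intro borel_measurable_cnj measurable_hbasis)
  have part: "(LINT z|dA. indicator (ball 0 r) z * (syn d z * cnj (hbasis n z))) = d n * \<nu> r" if r: "0 \<le> r" "r < 1" for r
  proof -
    obtain K where K: "\<And>N z. cmod z \<le> r \<Longrightarrow> cmod (psum d N z) \<le> K" using psum_bounded[OF d r] by blast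
    have K0: "K \<ge> 0" using order_trans[OF norm_ge_zero K[of 0 0]] r by simp
    have "(\<lambda>N. LINT z|dA. indicator (ball 0 r) z * (psum d N z * cnj (hbasis n z)))
        \<longlonglongrightarrow> (LINT z|dA. indicator (ball 0 r) z * (syn d z * cnj (hbasis n z)))"
    proof (rule integral_dominated_convergence[where w = "\<lambda>_. K"])
      show "AE z in dA. (\<lambda>N. indicator (ball 0 r) z * (psum d N z * cnj (hbasis n z)))
          \<longlonglongrightarrow> indicator (ball 0 r) z * (syn d z * cnj (hbasis n z))"
        by (intro AE_I2 tendsto_intros psum_tendsto d)
      show "integrable dA (\<lambda>_. K)" by (rule finite_measure.integrable_const[OF finite_measure_dA])
      show "AE z in dA. cmod (indicator (ball 0 r) z * (psum d N z * cnj (hbasis n z))) \<le> K" for N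
      proof (rule AE_I2)
        fix z
        have "cmod (psum d N z) * cmod (hbasis n z) \<le> K * 1" if "cmod z < r"
          using K[of z N] that norm_hbasis_le_1 K0 by (intro mult_mono) auto
        then show "cmod (indicator (ball 0 r) z * (psum d N z * cnj (hbasis n z))) \<le> K"
          using K0 by (auto simp: indicator_def norm_mult)
      qed
    qed (use im hm measurable_psum int in auto)
    moreover have "(LINT z|dA. indicator (ball 0 r) z * (psum d N z * cnj (hbasis n z))) = d n * \<nu> r" if "N \<ge> nat \<bar>n\<bar>" for N
    proof -
      have i: "integrable dA (\<lambda>z. indicator (ball 0 r) z * (hbasis m z * cnj (hbasis n z)))" for m
        by (rule integrable_dA_mult_bounded[OF integrable_mult_cnj_hbasis[OF integrable_hbasis] im, of _ 1])
           (simp add: indicator_def)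
      have zero: "(LINT z|dA. indicator (ball 0 r) z * (hbasis m z * cnj (hbasis n z))) = 0" if "m \<noteq> n" for m
      proof -
        have "(LINT z|dA. indicator (ball 0 r) z * (hbasis m z * cnj (hbasis n z)))
           = (LINT z|dA. polar m (\<lambda>s. indicator {..<r} s * of_real (s ^ nat \<bar>m\<bar>)) z * cnj (hbasis n z))"
          by (intro Bochner_Integration.integral_cong) (auto simp: hbasis_polar polar_def indicator_def)
        then show ?thesis using that by (simp add: integral_polar_mult_cnj_hbasis)
      qed
      have "(LINT z|dA. indicator (ball 0 r) z * (psum d N z * cnj (hbasis n z)))
         = (LINT z|dA. (\<Sum>m\<in>{-int N..int N}. d m * (indicator (ball 0 r) z * (hbasis m z * cnj (hbasis n z)))))"
        by (simp add: psum_def sum_distrib_left sum_distrib_right mult_ac)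
      also have "\<dots> = (\<Sum>m\<in>{-int N..int N}. d m * (LINT z|dA. indicator (ball 0 r) z * (hbasis m z * cnj (hbasis n z))))"
        using i by (simp add: integral_sum)
      also have "\<dots> = (\<Sum>m\<in>{n}. d m * (LINT z|dA. indicator (ball 0 r) z * (hbasis m z * cnj (hbasis n z))))"
        using that zero by (intro sum.mono_neutral_right) auto
      finally show ?thesis by (simp add: \<nu>_def)
    qed
    then have "(\<lambda>N. LINT z|dA. indicator (ball 0 r) z * (psum d N z * cnj (hbasis n z))) \<longlonglongrightarrow> d n * \<nu> r"
      by (intro tendsto_eventually eventually_sequentiallyI[of "nat \<bar>n\<bar>"]) auto
    ultimately show ?thesis by (rule LIMSEQ_unique)
  qed
  have exh: "(\<lambda>k. LINT z|dA. indicator (ball 0 (1 - inverse (real (Suc k)))) z * g z) \<longlonglongrightarrow> (LINT z|dA. g z)"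
    if g: "integrable dA g" for g :: "complex \<Rightarrow> complex"
  proof (rule integral_dominated_convergence[where w = "\<lambda>z. cmod (g z)"])
    show "AE z in dA. (\<lambda>k. indicator (ball 0 (1 - inverse (real (Suc k)))) z * g z) \<longlonglongrightarrow> g z"
    proof (rule AE_I2)
      fix z assume "z \<in> space dA"
      then have "1 - cmod z > 0" by simp
      have "\<forall>\<^sub>F k in sequentially. inverse (real (Suc k)) < 1 - cmod z"
        using LIMSEQ_inverse_real_of_nat \<open>1 - cmod z > 0\<close> by (rule order_tendstoD(2))
      then have "\<forall>\<^sub>F k in sequentially. indicator (ball 0 (1 - inverse (real (Suc k)))) z * g z = g z"
        by eventually_elim (auto simp: indicator_def)
      then show "(\<lambda>k. indicator (ball 0 (1 - inverse (real (Suc k)))) z * g z) \<longlonglongrightarrow> g z"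
        by (rule tendsto_eventually)
    qed
    show "(\<lambda>z. indicator (ball 0 (1 - inverse (real (Suc k)))) z * g z) \<in> borel_measurable dA" for k
      using im g by (intro borel_measurable_times) auto
  qed (use g in \<open>auto simp: indicator_def intro!: AE_I2\<close>)
  have "(\<lambda>k. d n * \<nu> (1 - inverse (real (Suc k)))) \<longlonglongrightarrow> (LINT z|dA. syn d z * cnj (hbasis n z))"
    using exh[OF integrable_mult_cnj_hbasis[OF int, of n]] part by (simp add: field_simps)
  moreover have "(\<lambda>k. d n * \<nu> (1 - inverse (real (Suc k)))) \<longlonglongrightarrow> d n * (LINT z|dA. hbasis n z * cnj (hbasis n z))"
    using exh[OF integrable_mult_cnj_hbasis[OF integrable_hbasis, of n n]] unfolding \<nu>_def by (intro tendsto_intros)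
  ultimately have "(LINT z|dA. syn d z * cnj (hbasis n z)) = d n * (LINT z|dA. hbasis n z * cnj (hbasis n z))"
    by (rule LIMSEQ_unique)
  then show ?thesis unfolding hcoeff_def hbasis_orthogonal by simp
qed

lemma hweight_ge_1: "hweight n \<ge> 1"
  by (simp add: hweight_def)

text \<open>\<open>K\<close> bounds the squared norm that Parseval's identity predicts for the function with coefficients \<open>d\<close>.\<close>

definition sq_bounded :: "(int \<Rightarrow> complex) \<Rightarrow> real \<Rightarrow> bool"
  where "sq_bounded d K \<longleftrightarrow> (\<forall>N. (\<Sum>n\<in>{- int N..int N}. (cmod (d n))\<^sup>2 / hweight n) \<le> K)"

lemma sq_bounded_term:
  assumes "sq_bounded d K" shows "(cmod (d n))\<^sup>2 \<le> K * hweight n"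
proof -
  have "(cmod (d n))\<^sup>2 / hweight n \<le> (\<Sum>n\<in>{- int (nat \<bar>n\<bar>)..int (nat \<bar>n\<bar>)}. (cmod (d n))\<^sup>2 / hweight n)"
    by (intro member_le_sum) (auto simp: less_imp_le[OF hweight_pos])
  also have "\<dots> \<le> K" using assms unfolding sq_bounded_def by blast
  finally show ?thesis using hweight_pos[of n] by (simp add: field_simps)
qed

lemma sq_bounded_nonneg: "sq_bounded d K \<Longrightarrow> K \<ge> 0"
  using sq_bounded_term[of d K 0] by (simp add: hweight_def order_trans[OF zero_le_power2])

lemma sq_bounded_absconv:
  assumes "sq_bounded d K" shows "absconv d"
  unfolding absconv_def
proof (intro allI impI)
  fix r :: real assume r: "0 \<le> r \<and> r < 1"
  have K: "K \<ge> 0" by (rule sq_bounded_nonneg[OF assms])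
  have b: "cmod (d n) \<le> (K + 1) * hweight n" for n
  proof (rule power2_le_imp_le)
    have "(cmod (d n))\<^sup>2 \<le> K * hweight n" by (rule sq_bounded_term[OF assms])
    also have "\<dots> \<le> (K + 1) * (K + 1) * (hweight n * hweight n)"
    proof (intro mult_mono)
      show "K \<le> (K + 1) * (K + 1)" using K by (simp add: algebra_simps)
      show "hweight n \<le> hweight n * hweight n" using hweight_ge_1[of n] by simp
    qed (use K hweight_pos[of n] in auto)
    finally show "(cmod (d n))\<^sup>2 \<le> ((K + 1) * hweight n)\<^sup>2" by (simp add: power2_eq_square mult_ac)
  qed (use K hweight_pos[of n] in \<open>auto intro!: mult_nonneg_nonneg\<close>)
  have "summable (\<lambda>n. of_nat (Suc n) * r ^ n)"
    using geometric_deriv_sums[of r] r by (auto simp: sums_iff)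
  then have s: "summable (\<lambda>n. (K + 1) * (of_nat (Suc n) * r ^ n))" by (rule summable_mult)
  have "summable (\<lambda>n. cmod (d (g n)) * r ^ n)" if g: "\<And>n. hweight (g n) = of_nat (Suc n)" for g
  proof (rule summable_comparison_test'[OF s])
    fix n :: nat
    have "cmod (d (g n)) * r ^ n \<le> (K + 1) * hweight (g n) * r ^ n"
      using b[of "g n"] r by (intro mult_right_mono) auto
    then show "norm (cmod (d (g n)) * r ^ n) \<le> (K + 1) * (of_nat (Suc n) * r ^ n)"
      using r by (simp add: g mult.assoc)
  qed
  from this[of int] this[of "\<lambda>n. - int n"]
  show "summable (\<lambda>n. cmod (d (int n)) * r ^ n) \<and> summable (\<lambda>n. cmod (d (- int n)) * r ^ n)"
    by (simp add: hweight_def add.commute)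
qed

lemma syn_measurable: "absconv d \<Longrightarrow> syn d \<in> borel_measurable dA"
  by (intro borel_measurable_dA_continuous harmonic_on_imp_continuous_on syn_harmonic)

text \<open>The partial sums have squared norm at most \<open>K\<close> by orthogonality, and Fatou's lemma passes this bound
  to their pointwise limit. Together with Bessel's inequality this replaces the completeness of the
  harmonic Bergman space throughout.\<close>

theorem
  assumes d: "sq_bounded d K"
  shows syn_in_Lh2: "syn d \<in> Lh2"
    and L2norm_syn_le: "(L2norm (syn d))\<^sup>2 \<le> K"
    and hcoeff_syn: "hcoeff n (syn d) = d n"
proof -
  have ac: "absconv d" by (rule sq_bounded_absconv[OF d])
  have K: "K \<ge> 0" by (rule sq_bounded_nonneg[OF d])
  have mp: "(\<lambda>z. ennreal ((cmod (psum d N z))\<^sup>2)) \<in> borel_measurable dA" for N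
    using measurable_psum[of d N] by measurable
  have le: "(\<integral>\<^sup>+z. ennreal ((cmod (psum d N z))\<^sup>2) \<partial>dA) \<le> ennreal K" for N
  proof -
    have "integrable dA (\<lambda>z. (cmod (psum d N z))\<^sup>2)"
      by (rule integrable_norm_square_bounded[OF measurable_psum]) (unfold psum_def, rule norm_sum_hbasis_le)
    then have "(\<integral>\<^sup>+z. ennreal ((cmod (psum d N z))\<^sup>2) \<partial>dA) = ennreal (LINT z|dA. (cmod (psum d N z))\<^sup>2)"
      by (intro nn_integral_eq_integral) auto
    also have "(LINT z|dA. (cmod (psum d N z))\<^sup>2) \<le> K"
      unfolding psum_def using d by (subst pythagoras_hbasis) (auto simp: sq_bounded_def)
    finally show ?thesis by (simp add: ennreal_leI)
  qed
  have "(\<integral>\<^sup>+z. ennreal ((cmod (syn d z))\<^sup>2) \<partial>dA) = (\<integral>\<^sup>+z. liminf (\<lambda>N. ennreal ((cmod (psum d N z))\<^sup>2)) \<partial>dA)"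
  proof (rule nn_integral_cong)
    fix z
    have "(\<lambda>N. ennreal ((cmod (psum d N z))\<^sup>2)) \<longlonglongrightarrow> ennreal ((cmod (syn d z))\<^sup>2)"
      by (intro tendsto_intros psum_tendsto ac)
    then show "ennreal ((cmod (syn d z))\<^sup>2) = liminf (\<lambda>N. ennreal ((cmod (psum d N z))\<^sup>2))"
      by (intro lim_imp_Liminf[symmetric]) auto
  qed
  also have "\<dots> \<le> liminf (\<lambda>N. \<integral>\<^sup>+z. ennreal ((cmod (psum d N z))\<^sup>2) \<partial>dA)"
    by (rule nn_integral_liminf) (rule mp)
  also have "\<dots> \<le> liminf (\<lambda>N. ennreal K)" by (intro Liminf_mono always_eventually allI le)
  also have "\<dots> = ennreal K" by (simp add: Liminf_const)
  finally have nn: "(\<integral>\<^sup>+z. ennreal ((cmod (syn d z))\<^sup>2) \<partial>dA) \<le> ennreal K" .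
  have ms: "(\<lambda>z. (cmod (syn d z))\<^sup>2) \<in> borel_measurable dA" using syn_measurable[OF ac] by measurable
  have int: "integrable dA (\<lambda>z. (cmod (syn d z))\<^sup>2)"
    using ms nn by (intro integrableI_bounded) (auto simp: le_less_trans)
  show mem: "syn d \<in> Lh2" using int syn_harmonic[OF ac] by (auto simp: Lh2_def syn_outside)
  have "ennreal (LINT z|dA. (cmod (syn d z))\<^sup>2) \<le> ennreal K"
    using nn int by (subst nn_integral_eq_integral[symmetric]) auto
  then show "(L2norm (syn d))\<^sup>2 \<le> K" using K by (simp add: L2norm_square)
  show "hcoeff n (syn d) = d n" by (rule hcoeff_syn_absconv[OF ac Lh2_integrable[OF mem]])
qed

lemma sq_bounded_hcoeff: "f \<in> Lh2 \<Longrightarrow> sq_bounded (\<lambda>n. hcoeff n f) ((L2norm f)\<^sup>2)"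
  unfolding sq_bounded_def by (auto intro: bessel)

text \<open>A harmonic function is \<open>F + cnj G\<close> with \<open>F\<close> and \<open>G\<close> holomorphic, so that their power series add up
  to an expansion in the basis; its coefficients are the integrals in the definition of \<open>hcoeff\<close>.\<close>

theorem Lh2_expansion:
  assumes f: "f \<in> Lh2" shows "syn (\<lambda>n. hcoeff n f) = f"
proof -
  have "f harmonic_on disk" using f by (simp add: Lh2_def)
  then obtain F G where FG: "F holomorphic_on disk" "G holomorphic_on disk" "\<And>z. z \<in> disk \<Longrightarrow> f z = F z + cnj (G z)"
    using harmonic_on_convex_decompose[of f disk] by (metis convex_ball)
  define a where "a n = (deriv ^^ n) F 0 / fact n" for n
  define b where "b n = cnj ((deriv ^^ n) G 0 / fact n)" for n
  have a: "(\<lambda>n. a n * z ^ n) sums F z" if "z \<in> disk" for z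
    using holomorphic_power_series[OF FG(1) that] by (simp add: a_def)
  have b: "(\<lambda>n. b n * cnj z ^ n) sums cnj (G z)" if "z \<in> disk" for z
    using holomorphic_power_series[OF FG(2) that, THEN sums_cnj[THEN iffD2]] by (simp add: b_def)
  define d where "d n = (if n > 0 then a (nat n) else if n < 0 then b (nat (- n)) else a 0 + b 0)" for n
  have ac: "absconv d"
    unfolding absconv_def
  proof (intro allI impI conjI)
    fix r :: real assume r: "0 \<le> r \<and> r < 1"
    define x where "x = complex_of_real ((1 + r) / 2)"
    have xd: "x \<in> disk" "cnj x = x" "norm (complex_of_real r) < norm x" using r
      by (auto simp: x_def norm_divide simp del: of_real_divide)
    have 1: "summable (\<lambda>n. cmod (a n * complex_of_real r ^ n))"
      using a[OF xd(1)] xd by (intro powser_insidea[of a x]) (auto simp: sums_iff)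
    have 2: "summable (\<lambda>n. cmod (b n * complex_of_real r ^ n))"
      using b[OF xd(1)] xd by (intro powser_insidea[of b x]) (auto simp: sums_iff)
    have e: "eventually (\<lambda>n. cmod (d (int n)) * r ^ n = cmod (a n * complex_of_real r ^ n)) sequentially"
      "eventually (\<lambda>n. cmod (d (- int n)) * r ^ n = cmod (b n * complex_of_real r ^ n)) sequentially"
      by (rule eventually_sequentiallyI[of 1], use r in \<open>simp add: d_def norm_mult norm_power\<close>)+
    show "summable (\<lambda>n. cmod (d (int n)) * r ^ n)" using 1 summable_cong[OF e(1)] by simp
    show "summable (\<lambda>n. cmod (d (- int n)) * r ^ n)" using 2 summable_cong[OF e(2)] by simp
  qed
  have fd: "syn d = f"
  proof
    fix z show "syn d z = f z"
    proof (cases "z \<in> disk")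
      case True
      have "psum d N z = (\<Sum>n<Suc N. a n * z ^ n) + (\<Sum>n<Suc N. b n * cnj z ^ n)" for N
        unfolding psum_eq[OF True] sum.lessThan_Suc_shift by (simp add: d_def nat_add_distrib)
      then have "(\<lambda>N. psum d N z) \<longlonglongrightarrow> F z + cnj (G z)"
        using a[OF True] b[OF True] unfolding sums_def by (simp only:) (intro tendsto_intros LIMSEQ_Suc)
      then show ?thesis using FG(3)[OF True] by (simp add: syn_eqI)
    qed (use f in \<open>auto simp: syn_outside Lh2_outside\<close>)
  qed
  have "hcoeff n f = d n" for n
    using hcoeff_syn_absconv[OF ac, of n] Lh2_integrable[OF f] by (simp add: fd)
  then show ?thesis using fd by simp
qed

lemma Lh2_eqI:
  assumes "f \<in> Lh2" "g \<in> Lh2" "\<And>n. hcoeff n f = hcoeff n g" shows "f = g"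
proof -
  have "f = syn (\<lambda>n. hcoeff n f)" by (rule Lh2_expansion[OF assms(1), symmetric])
  also have "\<dots> = syn (\<lambda>n. hcoeff n g)" by (simp only: assms(3))
  also have "\<dots> = g" by (rule Lh2_expansion[OF assms(2)])
  finally show ?thesis .
qed

lemma psum_hcoeff_tendsto:
  assumes "f \<in> Lh2" shows "(\<lambda>N. psum (\<lambda>n. hcoeff n f) N z) \<longlonglongrightarrow> f z"
  using psum_tendsto[OF sq_bounded_absconv[OF sq_bounded_hcoeff[OF assms]], of z]
  by (simp only: Lh2_expansion[OF assms])

lemma sq_bounded_cmult: "sq_bounded d K \<Longrightarrow> sq_bounded (\<lambda>n. c * d n) ((cmod c)\<^sup>2 * K)"
  unfolding sq_bounded_def
proof
  fix N
  assume d: "\<forall>N. (\<Sum>n\<in>{- int N..int N}. (cmod (d n))\<^sup>2 / hweight n) \<le> K"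
  have "(\<Sum>n\<in>{- int N..int N}. (cmod (c * d n))\<^sup>2 / hweight n)
      = (cmod c)\<^sup>2 * (\<Sum>n\<in>{- int N..int N}. (cmod (d n))\<^sup>2 / hweight n)"
    by (simp add: norm_mult power_mult_distrib sum_distrib_left)
  also have "\<dots> \<le> (cmod c)\<^sup>2 * K" using d by (intro mult_left_mono) auto
  finally show "(\<Sum>n\<in>{- int N..int N}. (cmod (c * d n))\<^sup>2 / hweight n) \<le> (cmod c)\<^sup>2 * K" .
qed

lemma norm_add_square_le: "(cmod (x + y))\<^sup>2 \<le> 2 * (cmod x)\<^sup>2 + 2 * (cmod y)\<^sup>2"
proof -
  have "(cmod (x + y))\<^sup>2 + (cmod (x - y))\<^sup>2 = 2 * (cmod x)\<^sup>2 + 2 * (cmod y)\<^sup>2"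
    unfolding cmod_power2 by (simp add: power2_eq_square algebra_simps)
  then show ?thesis using zero_le_power2[of "cmod (x - y)"] by linarith
qed

lemma sq_bounded_add:
  assumes "sq_bounded d K" "sq_bounded e L" shows "sq_bounded (\<lambda>n. d n + e n) (2 * K + 2 * L)"
  unfolding sq_bounded_def
proof
  fix N
  have "(\<Sum>n\<in>{- int N..int N}. (cmod (d n + e n))\<^sup>2 / hweight n)
      \<le> (\<Sum>n\<in>{- int N..int N}. (2 * (cmod (d n))\<^sup>2 + 2 * (cmod (e n))\<^sup>2) / hweight n)"
    by (intro sum_mono divide_right_mono norm_add_square_le less_imp_le[OF hweight_pos])
  also have "\<dots> = 2 * (\<Sum>n\<in>{- int N..int N}. (cmod (d n))\<^sup>2 / hweight n) + 2 * (\<Sum>n\<in>{- int N..int N}. (cmod (e n))\<^sup>2 / hweight n)"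
    by (simp add: add_divide_distrib sum.distrib sum_distrib_left)
  also have "\<dots> \<le> 2 * K + 2 * L" using assms unfolding sq_bounded_def by (intro add_mono mult_left_mono) auto
  finally show "(\<Sum>n\<in>{- int N..int N}. (cmod (d n + e n))\<^sup>2 / hweight n) \<le> 2 * K + 2 * L" .
qed

lemma hcoeff_add: "f \<in> Lh2 \<Longrightarrow> g \<in> Lh2 \<Longrightarrow> hcoeff n (\<lambda>z. f z + g z) = hcoeff n f + hcoeff n g"
  by (simp add: hcoeff_def distrib_left distrib_right integrable_mult_cnj_hbasis Lh2_integrable)

lemma hcoeff_cmult: "hcoeff n (\<lambda>z. c * f z) = c * hcoeff n f"
  by (simp add: hcoeff_def mult.assoc mult.left_commute)

lemma Lh2_cmult: 
  assumes f: "f \<in> Lh2" shows "(\<lambda>z. c * f z) \<in> Lh2"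
proof -
  have b: "sq_bounded (\<lambda>n. c * hcoeff n f) ((cmod c)\<^sup>2 * (L2norm f)\<^sup>2)"
    by (rule sq_bounded_cmult[OF sq_bounded_hcoeff[OF f]])
  have "syn (\<lambda>n. c * hcoeff n f) = (\<lambda>z. c * f z)"
  proof
    fix z
    have "psum (\<lambda>n. c * hcoeff n f) N z = c * psum (\<lambda>n. hcoeff n f) N z" for N
      by (simp add: psum_def sum_distrib_left mult.assoc)
    then show "syn (\<lambda>n. c * hcoeff n f) z = c * f z"
      using tendsto_mult_left[OF psum_hcoeff_tendsto[OF f, of z], of c] by (intro syn_eqI) simp
  qed
  then show ?thesis using syn_in_Lh2[OF b] by simp
qed

lemma Lh2_add:
  assumes f: "f \<in> Lh2" and g: "g \<in> Lh2" shows "(\<lambda>z. f z + g z) \<in> Lh2"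
proof -
  have b: "sq_bounded (\<lambda>n. hcoeff n f + hcoeff n g) (2 * (L2norm f)\<^sup>2 + 2 * (L2norm g)\<^sup>2)"
    by (rule sq_bounded_add[OF sq_bounded_hcoeff[OF f] sq_bounded_hcoeff[OF g]])
  have "syn (\<lambda>n. hcoeff n f + hcoeff n g) = (\<lambda>z. f z + g z)"
  proof
    fix z
    have "psum (\<lambda>n. hcoeff n f + hcoeff n g) N z = psum (\<lambda>n. hcoeff n f) N z + psum (\<lambda>n. hcoeff n g) N z" for N
      by (simp add: psum_def distrib_right sum.distrib)
    then show "syn (\<lambda>n. hcoeff n f + hcoeff n g) z = f z + g z"
      using tendsto_add[OF psum_hcoeff_tendsto[OF f, of z] psum_hcoeff_tendsto[OF g, of z]] by (intro syn_eqI) simp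
  qed
  then show ?thesis using syn_in_Lh2[OF b] by simp
qed

lemma Lh2_diff: "f \<in> Lh2 \<Longrightarrow> g \<in> Lh2 \<Longrightarrow> (\<lambda>z. f z - g z) \<in> Lh2"
  using Lh2_add[of f "\<lambda>z. (-1) * g z"] Lh2_cmult[of g "-1"] by simp

lemma hcoeff_diff: "f \<in> Lh2 \<Longrightarrow> g \<in> Lh2 \<Longrightarrow> hcoeff n (\<lambda>z. f z - g z) = hcoeff n f - hcoeff n g"
  using hcoeff_add[of f "\<lambda>z. (-1) * g z"] Lh2_cmult[of g "-1"] hcoeff_cmult[of n "-1" g] by simp

lemma L2norm_add_square_le:
  assumes f: "f \<in> Lh2" and g: "g \<in> Lh2"
  shows "(L2norm (\<lambda>z. f z + g z))\<^sup>2 \<le> 2 * (L2norm f)\<^sup>2 + 2 * (L2norm g)\<^sup>2"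
  unfolding L2norm_square
proof -
  have "(LINT z|dA. (cmod (f z + g z))\<^sup>2) \<le> (LINT z|dA. 2 * (cmod (f z))\<^sup>2 + 2 * (cmod (g z))\<^sup>2)"
    using Lh2_square_integrable[OF Lh2_add[OF f g]] Lh2_square_integrable[OF f] Lh2_square_integrable[OF g]
    by (intro integral_mono) (auto intro: norm_add_square_le)
  then show "(LINT z|dA. (cmod (f z + g z))\<^sup>2) \<le> 2 * (LINT z|dA. (cmod (f z))\<^sup>2) + 2 * (LINT z|dA. (cmod (g z))\<^sup>2)"
    using Lh2_square_integrable[OF f] Lh2_square_integrable[OF g] by simp
qed

lemma L2norm_cmult: "L2norm (\<lambda>z. c * f z) = cmod c * L2norm f"
  by (simp add: L2norm_def norm_mult power_mult_distrib real_sqrt_mult)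

lemma Lh2_0: "(\<lambda>z. 0) \<in> Lh2"
proof -
  have "syn (\<lambda>n. 0) = (\<lambda>z. 0)" by (rule ext, rule syn_eqI) (simp add: psum_def)
  then show ?thesis using syn_in_Lh2[of "\<lambda>n. 0" 0] by (simp add: sq_bounded_def)
qed

lemma syn_single: "syn (\<lambda>m. if m = n then c else 0) = (\<lambda>z. c * hbasis n z)"
proof
  fix z
  have "psum (\<lambda>m. if m = n then c else 0) N z = c * hbasis n z" if "N \<ge> nat \<bar>n\<bar>" for N
  proof -
    have "(\<Sum>m\<in>{- int N..int N}. (if m = n then c else 0) * hbasis m z)
        = (\<Sum>m\<in>{n}. (if m = n then c else 0) * hbasis m z)"
      using that by (intro sum.mono_neutral_right) auto
    then show ?thesis by (simp add: psum_def)
  qed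
  then have "(\<lambda>N. psum (\<lambda>m. if m = n then c else 0) N z) \<longlonglongrightarrow> c * hbasis n z"
    by (intro tendsto_eventually eventually_sequentiallyI[of "nat \<bar>n\<bar>"])
  then show "syn (\<lambda>m. if m = n then c else 0) z = c * hbasis n z" by (rule syn_eqI)
qed

lemma sq_bounded_single: "sq_bounded (\<lambda>m. if m = n then 1 else 0) 1"
  unfolding sq_bounded_def
proof
  fix N
  have "(\<Sum>m\<in>{- int N..int N}. (cmod (if m = n then 1 else 0))\<^sup>2 / hweight m)
      = (\<Sum>m\<in>{- int N..int N}. if m = n then 1 / hweight m else 0)"
    by (intro sum.cong) auto
  also have "\<dots> \<le> 1" using hweight_ge_1[of n] by (simp add: divide_le_eq)
  finally show "(\<Sum>m\<in>{- int N..int N}. (cmod (if m = n then 1 else 0))\<^sup>2 / hweight m) \<le> 1" .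
qed

lemma hbasis_Lh2: "hbasis n \<in> Lh2"
  using syn_in_Lh2[OF sq_bounded_single[of n]] by (simp add: syn_single)

lemma hcoeff_hbasis: "hcoeff m (hbasis n) = (if m = n then 1 else 0)"
  using hcoeff_syn[OF sq_bounded_single[of n], of m] by (simp add: syn_single)

lemma inj_hbasis: "inj hbasis"
proof (rule injI)
  fix m n assume "hbasis m = hbasis n"
  then have "hcoeff n (hbasis m) = hcoeff n (hbasis n)" by simp
  then show "m = n" by (simp add: hcoeff_hbasis split: if_splits)
qed

lemma L2norm_hbasis: "(L2norm (hbasis n))\<^sup>2 = 1 / hweight n"
  using pythagoras_hbasis[of "{n}" "\<lambda>_. 1"] by (simp add: L2norm_square)

lemma Lh2_sum_hbasis: "finite A \<Longrightarrow> (\<lambda>z. \<Sum>n\<in>A. c n * hbasis n z) \<in> Lh2"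
proof (induction A rule: finite_induct)
  case (insert x A)
  then show ?case using Lh2_add[OF Lh2_cmult[OF hbasis_Lh2, of "c x" x] insert(3)] by simp
qed (simp add: Lh2_0)

lemma hcoeff_sum_hbasis: 
  "finite A \<Longrightarrow> hcoeff m (\<lambda>z. \<Sum>n\<in>A. c n * hbasis n z) = (if m \<in> A then c m else 0)"
proof (induction A rule: finite_induct)
  case (insert x A)
  then show ?case
    using hcoeff_add[OF Lh2_cmult[OF hbasis_Lh2, of "c x" x] Lh2_sum_hbasis[OF insert(1), of c], of m]
    by (auto simp: hcoeff_cmult hcoeff_hbasis)
qed (simp add: hcoeff_def)

lemma psum_Lh2: "psum d N \<in> Lh2"
  unfolding psum_def[abs_def] by (rule Lh2_sum_hbasis) simp

lemma hcoeff_bound: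
  assumes "f \<in> Lh2" shows "cmod (hcoeff n f) \<le> sqrt (hweight n) * L2norm f"
proof (rule power2_le_imp_le)
  have "(sqrt (hweight n) * L2norm f)\<^sup>2 = (L2norm f)\<^sup>2 * hweight n"
    using hweight_pos[of n] by (simp add: power_mult_distrib)
  then show "(cmod (hcoeff n f))\<^sup>2 \<le> (sqrt (hweight n) * L2norm f)\<^sup>2"
    using sq_bounded_term[OF sq_bounded_hcoeff[OF assms], of n] by simp
  show "0 \<le> sqrt (hweight n) * L2norm f"
    using L2norm_nonneg[of f] less_imp_le[OF hweight_pos[of n]] by simp
qed

text \<open>The remainder \<open>f - psum N\<close> is itself synthesised from the tail of the coefficients, and its norm is
  controlled by the tail of a convergent series.\<close>

theorem psum_tendsto_L2:
  assumes f: "f \<in> Lh2"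
  shows "(\<lambda>N. L2norm (\<lambda>z. f z - psum (\<lambda>n. hcoeff n f) N z)) \<longlonglongrightarrow> 0"
proof -
  define c where "c n = hcoeff n f" for n
  define s where "s N = (\<Sum>n\<in>{- int N..int N}. (cmod (c n))\<^sup>2 / hweight n)" for N
  have "incseq s"
  proof (rule monoI)
    fix M N :: nat assume "M \<le> N"
    then show "s M \<le> s N" unfolding s_def
      by (intro sum_mono2) (auto simp: less_imp_le[OF hweight_pos])
  qed
  have "\<forall>N. s N \<le> (L2norm f)\<^sup>2"
    using sq_bounded_hcoeff[OF f] by (simp add: s_def c_def sq_bounded_def)
  then have bdd: "bdd_above (range s)" by (intro bdd_aboveI2) blast
  define S where "S = (SUP N. s N)"
  have S: "s \<longlonglongrightarrow> S" "s N \<le> S" for N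
    unfolding S_def by (rule LIMSEQ_incseq_SUP[OF bdd \<open>incseq s\<close>], rule cSUP_upper[OF UNIV_I bdd])
  have le: "(L2norm (\<lambda>z. f z - psum c N z))\<^sup>2 \<le> S - s N" for N
  proof -
    define t where "t n = (if \<bar>n\<bar> \<le> int N then 0 else c n)" for n
    have "sq_bounded t (S - s N)"
      unfolding sq_bounded_def
    proof
      fix M
      have "(\<Sum>n\<in>{- int M..int M}. (cmod (t n))\<^sup>2 / hweight n) \<le> (\<Sum>n\<in>{- int (max M N)..int (max M N)}. (cmod (t n))\<^sup>2 / hweight n)"
        by (intro sum_mono2) (auto simp: less_imp_le[OF hweight_pos])
      also have "\<dots> = (\<Sum>n\<in>{- int (max M N)..int (max M N)} - {-int N..int N}. (cmod (c n))\<^sup>2 / hweight n)"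
        by (intro sum.mono_neutral_cong_right) (auto simp: t_def)
      also have "\<dots> = s (max M N) - s N"
        unfolding s_def by (intro sum_diff) auto
      finally show "(\<Sum>n\<in>{- int M..int M}. (cmod (t n))\<^sup>2 / hweight n) \<le> S - s N"
        using S(2)[of "max M N"] by linarith
    qed
    moreover have "syn t = (\<lambda>z. f z - psum c N z)"
    proof
      fix z
      have "psum t M z = psum c M z - psum c N z" if "M \<ge> N" for M
      proof -
        have "psum t M z = (\<Sum>n\<in>{- int M..int M} - {-int N..int N}. c n * hbasis n z)"
          unfolding psum_def by (intro sum.mono_neutral_cong_right) (auto simp: t_def)
        also have "\<dots> = psum c M z - psum c N z"
          unfolding psum_def using that by (intro sum_diff) auto
        finally show ?thesis .
      qed
      then have "\<forall>\<^sub>F M in sequentially. psum c M z - psum c N z = psum t M z"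
        by (intro eventually_sequentiallyI[of N]) simp
      moreover have "(\<lambda>M. psum c M z - psum c N z) \<longlonglongrightarrow> f z - psum c N z"
        using psum_hcoeff_tendsto[OF f, of z, folded c_def] by (intro tendsto_intros)
      ultimately have "(\<lambda>M. psum t M z) \<longlonglongrightarrow> f z - psum c N z"
        by (rule Lim_transform_eventually[rotated])
      then show "syn t z = f z - psum c N z" by (rule syn_eqI)
    qed
    ultimately show ?thesis using L2norm_syn_le[of t "S - s N"] by simp
  qed
  have "(\<lambda>N. (L2norm (\<lambda>z. f z - psum c N z))\<^sup>2) \<longlonglongrightarrow> 0"
  proof (rule tendsto_sandwich[where f = "\<lambda>_. 0" and h = "\<lambda>N. S - s N"])
    show "(\<lambda>N. S - s N) \<longlonglongrightarrow> 0" using tendsto_diff[OF tendsto_const[of S] S(1)] by simp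
  qed (use le in auto)
  then have "(\<lambda>N. sqrt ((L2norm (\<lambda>z. f z - psum c N z))\<^sup>2)) \<longlonglongrightarrow> sqrt 0"
    by (rule tendsto_real_sqrt)
  moreover have "sqrt ((L2norm h)\<^sup>2) = L2norm h" for h
    using L2norm_nonneg by (rule real_sqrt_unique[OF refl])
  moreover have "c = (\<lambda>n. hcoeff n f)" by (rule ext) (rule c_def)
  ultimately show ?thesis by (simp only: real_sqrt_zero)
qed

section \<open>Harmonic polynomials\<close>

text \<open>Polynomials in \<open>z\<close> and \<open>cnj z\<close>. In contrast to polynomials in the real and imaginary parts, their
  monomials are quasihomogeneous, so that they can be integrated against the basis.\<close>

inductive bipoly :: "(complex \<Rightarrow> complex) \<Rightarrow> bool" where
  monomial: "bipoly (\<lambda>z. c * z ^ i * cnj z ^ j)"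
| add: "bipoly f \<Longrightarrow> bipoly g \<Longrightarrow> bipoly (\<lambda>z. f z + g z)"

lemma bipoly_const: "bipoly (\<lambda>z. c)"
  using monomial[of c 0 0] by simp

lemma bipoly_monomial_mult:
  assumes "bipoly g" shows "bipoly (\<lambda>z. (c * z ^ i * cnj z ^ j) * g z)"
  using assms
proof induction
  case (monomial c' i' j')
  have "(\<lambda>z. (c * z ^ i * cnj z ^ j) * (c' * z ^ i' * cnj z ^ j')) = (\<lambda>z. (c * c') * z ^ (i + i') * cnj z ^ (j + j'))"
    by (simp add: power_add mult_ac)
  then show ?case using bipoly.monomial by simp
next
  case (add f g)
  then show ?case by (simp only: distrib_left bipoly.add)
qed

lemma bipoly_mult:
  assumes "bipoly f" "bipoly g" shows "bipoly (\<lambda>z. f z * g z)"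
  using assms(1)
proof induction
  case (monomial c i j)
  then show ?case using bipoly_monomial_mult[OF assms(2)] .
next
  case (add f1 f2)
  then show ?case by (simp only: distrib_right bipoly.add)
qed

lemma bipoly_of_real_polynomial:
  assumes "real_polynomial_function q" shows "bipoly (\<lambda>z. complex_of_real (q z))"
  using assms
proof induction
  case (linear f)
  interpret bounded_linear f by fact
  have eq: "complex_of_real (f z) = (complex_of_real (f 1) - \<i> * complex_of_real (f \<i>)) / 2 * z ^ 1 * cnj z ^ 0
      + (complex_of_real (f 1) + \<i> * complex_of_real (f \<i>)) / 2 * z ^ 0 * cnj z ^ 1" for z
  proof -
    have "f z = f (Re z *\<^sub>R 1 + Im z *\<^sub>R \<i>)" by (rule arg_cong[where f = f]) (simp add: complex_eq_iff)
    also have "\<dots> = Re z * f 1 + Im z * f \<i>" by (simp only: add scaleR real_scaleR_def)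
    finally have fz: "complex_of_real (f z) = complex_of_real (f 1) * complex_of_real (Re z) + complex_of_real (f \<i>) * complex_of_real (Im z)"
      by (simp add: mult.commute)
    have Re: "complex_of_real (Re z) = (z + cnj z) / 2" and Im: "complex_of_real (Im z) = - \<i> * (z - cnj z) / 2"
      by (simp_all add: complex_eq_iff)
    have "A * ((z + w) / 2) + B * (- \<i> * (z - w) / 2) = (A - \<i> * B) / 2 * z ^ 1 * w ^ 0 + (A + \<i> * B) / 2 * z ^ 0 * w ^ 1"
      for A B w
      by (simp only: power_0 power_one_right mult_1_right) (simp add: algebra_simps add_divide_distrib diff_divide_distrib)
    then show ?thesis unfolding fz Re Im .
  qed
  show ?case by (subst eq) (intro bipoly.add bipoly.monomial)
next
  case (const c) then show ?case by (rule bipoly_const)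
next
  case (add f g) then show ?case by (simp add: bipoly.add)
next
  case (mult f g) then show ?case by (simp add: bipoly_mult)
qed

lemma bipoly_of_polynomial:
  assumes "polynomial_function p" shows "bipoly p"
proof -
  have "real_polynomial_function (Re \<circ> p)" "real_polynomial_function (Im \<circ> p)"
    using assms bounded_linear_Re bounded_linear_Im unfolding polynomial_function_def by blast+
  then have "bipoly (\<lambda>z. complex_of_real ((Re \<circ> p) z))" "bipoly (\<lambda>z. complex_of_real ((Im \<circ> p) z))"
    by (auto dest: bipoly_of_real_polynomial)
  then have "bipoly (\<lambda>z. complex_of_real ((Re \<circ> p) z) + \<i> * complex_of_real ((Im \<circ> p) z))"
    by (intro bipoly.add bipoly_mult bipoly_const)
  then show ?thesis by (simp add: complex_eq[symmetric])
qed

lemma bipoly_measurable: "bipoly p \<Longrightarrow> p \<in> borel_measurable dA"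
proof (intro measurable_dA_borelI borel_measurable_continuous_onI)
  assume "bipoly p" then show "continuous_on UNIV p"
    by induction (auto intro!: continuous_intros)
qed

lemma bipoly_bounded: "bipoly p \<Longrightarrow> \<exists>B. \<forall>z\<in>disk. cmod (p z) \<le> B"
proof (induction rule: bipoly.induct)
  case (monomial c i j)
  have "cmod (c * z ^ i * cnj z ^ j) \<le> cmod c" if "z \<in> disk" for z
  proof -
    have "cmod z ^ i * cmod z ^ j \<le> 1 * 1" using that by (intro mult_mono power_le_one) auto
    then have "cmod c * (cmod z ^ i * cmod z ^ j) \<le> cmod c * 1" by (intro mult_left_mono) auto
    then show ?thesis by (simp add: norm_mult norm_power mult.assoc)
  qed
  then show ?case by blast
next
  case (add f g)
  then obtain A B where "\<forall>z\<in>disk. cmod (f z) \<le> A" "\<forall>z\<in>disk. cmod (g z) \<le> B" by blast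
  then have "\<forall>z\<in>disk. cmod (f z + g z) \<le> A + B" by (meson add_mono norm_triangle_ineq order_trans)
  then show ?case by blast
qed

lemma bipoly_integrable:
  assumes "bipoly p" shows "integrable dA p"
  using bipoly_bounded[OF assms] integrable_dA_bounded[OF bipoly_measurable[OF assms]] by blast

lemma integrable_mult_bipoly:
  assumes f: "integrable dA f" and p: "bipoly p" shows "integrable dA (\<lambda>z. f z * p z)"
proof -
  obtain B where "\<forall>z\<in>disk. cmod (p z) \<le> B" using bipoly_bounded[OF p] by blast
  then show ?thesis
    using integrable_dA_mult_bounded[OF f bipoly_measurable[OF p], of B] by (simp add: mult.commute)
qed

lemma hcoeff_bipoly:
  assumes "bipoly p" shows "\<exists>N. \<forall>n. \<bar>n\<bar> > int N \<longrightarrow> hcoeff n p = 0"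
  using assms
proof induction
  case (monomial c i j)
  have "hcoeff n (\<lambda>z. c * z ^ i * cnj z ^ j) = 0" if "\<bar>n\<bar> > int (i + j)" for n
  proof -
    have "hcoeff n (\<lambda>z. c * z ^ i * cnj z ^ j) = c * hcoeff n (\<lambda>z. polar (int i - int j) (\<lambda>r. complex_of_real (r ^ (i + j))) z)"
      by (simp only: mult.assoc hcoeff_cmult monomial_polar)
    also have "\<dots> = 0" using that unfolding hcoeff_def integral_polar_mult_cnj_hbasis by auto
    finally show ?thesis .
  qed
  then show ?case by blast
next
  case (add f g)
  then obtain M N where "\<forall>n. \<bar>n\<bar> > int M \<longrightarrow> hcoeff n f = 0" "\<forall>n. \<bar>n\<bar> > int N \<longrightarrow> hcoeff n g = 0" by blast
  moreover have "hcoeff n (\<lambda>z. f z + g z) = hcoeff n f + hcoeff n g" for n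
    using integrable_mult_cnj_hbasis[OF bipoly_integrable[OF add.hyps(1)], of n]
      integrable_mult_cnj_hbasis[OF bipoly_integrable[OF add.hyps(2)], of n]
    by (simp add: hcoeff_def distrib_left distrib_right)
  ultimately show ?case by (intro exI[of _ "max M N"]) auto
qed

lemma hcoeff_cong: "(\<And>z. z \<in> disk \<Longrightarrow> f z = g z) \<Longrightarrow> hcoeff n f = hcoeff n g"
  unfolding hcoeff_def by (auto intro!: Bochner_Integration.integral_cong)

text \<open>With the preceding lemma, a harmonic polynomial is a finite combination of basis functions.\<close>

lemma psum_eq_finite_support:
  assumes f: "f \<in> Lh2" and N: "\<And>n. \<bar>n\<bar> > int N \<Longrightarrow> hcoeff n f = 0"
  shows "f = psum (\<lambda>n. hcoeff n f) N"
proof (rule Lh2_eqI[OF f psum_Lh2])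
  fix m show "hcoeff m f = hcoeff m (psum (\<lambda>n. hcoeff n f) N)"
    using N[of m] unfolding psum_def[abs_def] by (subst hcoeff_sum_hbasis) auto
qed

lemma harmonic_polynomial_eq_psum:
  assumes "h \<in> harmonic_polynomials" obtains N where "h = psum (\<lambda>n. hcoeff n h) N"
proof -
  obtain p where p: "polynomial_function p" "\<And>z. z \<in> disk \<Longrightarrow> h z = p z" and h: "h \<in> Lh2"
    using assms by (auto simp: harmonic_polynomials_def)
  obtain N where "\<forall>n. \<bar>n\<bar> > int N \<longrightarrow> hcoeff n p = 0"
    using hcoeff_bipoly[OF bipoly_of_polynomial[OF p(1)]] by blast
  then have "h = psum (\<lambda>n. hcoeff n h) N"
    using hcoeff_cong[of h p] p(2) by (intro psum_eq_finite_support[OF h]) auto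
  then show ?thesis by (rule that)
qed

lemma harmonic_polynomial_Lh2: "h \<in> harmonic_polynomials \<Longrightarrow> h \<in> Lh2"
  by (simp add: harmonic_polynomials_def)

lemma real_polynomial_function_Re_Im_power:
  "real_polynomial_function (\<lambda>z. Re (z ^ n)) \<and> real_polynomial_function (\<lambda>z. Im (z ^ n))"
proof (induction n)
  case 0
  then show ?case using real_polynomial_function.intros(2)[of 0] real_polynomial_function.intros(2)[of 1] by simp
next
  case (Suc n)
  have ReIm: "real_polynomial_function Re" "real_polynomial_function Im"
    using bounded_linear_Re bounded_linear_Im by (auto intro: real_polynomial_function.intros(1))
  then show ?case using Suc by (auto intro: real_polynomial_function.intros(3,4))
qed

lemma polynomial_function_power_complex: "polynomial_function (\<lambda>z::complex. z ^ n)"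
  unfolding polynomial_function_iff_Basis_inner
  using real_polynomial_function_Re_Im_power[of n] by (auto simp: Basis_complex_def)

lemma polynomial_function_cnj_power: "polynomial_function (\<lambda>z::complex. cnj z ^ n)"
  using polynomial_function_bounded_linear[of "\<lambda>z. z ^ n"] 
  unfolding polynomial_function_iff_Basis_inner
  using real_polynomial_function_Re_Im_power[of n] real_polynomial_function_minus
  by (auto simp: Basis_complex_def complex_cnj_power[symmetric] simp del: complex_cnj_power)

lemma hbasis_harmonic_polynomial: "hbasis n \<in> harmonic_polynomials"
proof -
  have "\<exists>p. polynomial_function p \<and> (\<forall>z\<in>disk. hbasis n z = p z)"
    using polynomial_function_power_complex[of "nat n"] polynomial_function_cnj_power[of "nat (- n)"]
    by (cases "n \<ge> 0") (auto simp: hbasis_def)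
  then show ?thesis using hbasis_Lh2 by (auto simp: harmonic_polynomials_def)
qed

section \<open>Bounded operators on the harmonic Bergman space\<close>

lemma bounded_operator_add:
  assumes T: "bounded_operator T" and f: "f \<in> Lh2" and g: "g \<in> Lh2"
  shows "T (\<lambda>z. f z + g z) = (\<lambda>z. T f z + T g z)"
proof -
  have "\<forall>f\<in>Lh2. \<forall>g\<in>Lh2. T (\<lambda>z. f z + g z) = (\<lambda>z. T f z + T g z)"
    using T unfolding bounded_operator_def by (elim conjE)
  from bspec[OF bspec[OF this f] g] show ?thesis .
qed

lemma bounded_operator_cmult:
  assumes T: "bounded_operator T" and f: "f \<in> Lh2"
  shows "T (\<lambda>z. c * f z) = (\<lambda>z. c * T f z)"
proof -
  have "\<forall>c. \<forall>f\<in>Lh2. T (\<lambda>z. c * f z) = (\<lambda>z. c * T f z)"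
    using T unfolding bounded_operator_def by (elim conjE)
  from bspec[OF spec[OF this] f] show ?thesis .
qed

lemma bounded_operator_sum_hbasis:
  assumes T: "bounded_operator T" and "finite A"
  shows "T (\<lambda>z. \<Sum>n\<in>A. c n * hbasis n z) = (\<lambda>z. \<Sum>n\<in>A. c n * T (hbasis n) z)"
  using assms(2)
proof (induction A rule: finite_induct)
  case empty
  have "T (\<lambda>z. 0 * hbasis 0 z) = (\<lambda>z. 0 * T (hbasis 0) z)"
    by (rule bounded_operator_cmult[OF T hbasis_Lh2])
  then show ?case by simp
next
  case (insert x A)
  have "T (\<lambda>z. c x * hbasis x z + (\<Sum>n\<in>A. c n * hbasis n z))
      = (\<lambda>z. T (\<lambda>z. c x * hbasis x z) z + T (\<lambda>z. \<Sum>n\<in>A. c n * hbasis n z) z)"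
    by (rule bounded_operator_add[OF T Lh2_cmult[OF hbasis_Lh2] Lh2_sum_hbasis[OF insert(1)]])
  moreover have "T (\<lambda>z. c x * hbasis x z) = (\<lambda>z. c x * T (hbasis x) z)"
    by (rule bounded_operator_cmult[OF T hbasis_Lh2])
  ultimately show ?case using insert by simp
qed

lemma bounded_operator_bound:
  assumes "bounded_operator T"
  obtains B where "B \<ge> 0" "\<And>f. f \<in> Lh2 \<Longrightarrow> L2norm (T f) \<le> B * L2norm f"
proof -
  obtain B where B: "\<forall>f\<in>Lh2. L2norm (T f) \<le> B * L2norm f" using assms unfolding bounded_operator_def by blast
  have "L2norm (T f) \<le> max B 0 * L2norm f" if "f \<in> Lh2" for f
    using B that L2norm_nonneg[of f] by (meson max.cobounded1 mult_right_mono order_trans)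
  then show ?thesis by (intro that[of "max B 0"]) auto
qed

lemma bounded_operator_in_Lh2: "bounded_operator T \<Longrightarrow> f \<in> Lh2 \<Longrightarrow> T f \<in> Lh2"
  by (simp add: bounded_operator_def)

lemma bounded_operator_diff:
  assumes T: "bounded_operator T" and f: "f \<in> Lh2" and g: "g \<in> Lh2"
  shows "T (\<lambda>z. f z - g z) = (\<lambda>z. T f z - T g z)"
proof -
  have 1: "T (\<lambda>z. (-1) * g z) = (\<lambda>z. (-1) * T g z)" by (rule bounded_operator_cmult[OF T g])
  have "T (\<lambda>z. f z + (-1) * g z) = (\<lambda>z. T f z + T (\<lambda>z. (-1) * g z) z)"
    by (rule bounded_operator_add[OF T f Lh2_cmult[OF g]])
  then show ?thesis unfolding 1 by simp
qed

text \<open>A bounded operator is determined by its values on the basis, because the partial sums of \<open>f\<close>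
  converge to \<open>f\<close> in norm.\<close>

theorem bounded_operator_expansion:
  assumes T: "bounded_operator T" and f: "f \<in> Lh2"
  shows "(\<lambda>N. \<Sum>n\<in>{- int N..int N}. hcoeff n f * hcoeff m (T (hbasis n))) \<longlonglongrightarrow> hcoeff m (T f)"
proof -
  obtain B where B: "B \<ge> 0" "\<And>f. f \<in> Lh2 \<Longrightarrow> L2norm (T f) \<le> B * L2norm f"
    using bounded_operator_bound[OF T] by blast
  define p where "p N = psum (\<lambda>n. hcoeff n f) N" for N
  have p: "p N \<in> Lh2" for N by (simp add: p_def psum_Lh2)
  have Tp: "hcoeff m (T (p N)) = (\<Sum>n\<in>{- int N..int N}. hcoeff n f * hcoeff m (T (hbasis n)))" for N
  proof -
    have "integrable dA (\<lambda>z. T (hbasis n) z * cnj (hbasis m z))" for n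
      by (intro integrable_mult_cnj_hbasis Lh2_integrable bounded_operator_in_Lh2[OF T] hbasis_Lh2)
    then show ?thesis
      unfolding p_def psum_def[abs_def] bounded_operator_sum_hbasis[OF T finite_atLeastAtMost_int] hcoeff_def[of m]
      by (simp add: sum_distrib_right sum_distrib_left mult.assoc mult.left_commute integral_sum)
  qed
  have le: "cmod (hcoeff m (T f) - hcoeff m (T (p N))) \<le> sqrt (hweight m) * B * L2norm (\<lambda>z. f z - p N z)" for N
  proof -
    have "hcoeff m (T f) - hcoeff m (T (p N)) = hcoeff m (T (\<lambda>z. f z - p N z))"
      using f p bounded_operator_in_Lh2[OF T] by (simp add: bounded_operator_diff[OF T] hcoeff_diff)
    also have "cmod \<dots> \<le> sqrt (hweight m) * L2norm (T (\<lambda>z. f z - p N z))"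
      by (intro hcoeff_bound bounded_operator_in_Lh2[OF T] Lh2_diff f p)
    also have "\<dots> \<le> sqrt (hweight m) * (B * L2norm (\<lambda>z. f z - p N z))"
      using hweight_pos[of m] by (intro mult_left_mono B(2) Lh2_diff f p) auto
    finally show ?thesis by (simp add: mult.assoc)
  qed
  have lim: "(\<lambda>N. sqrt (hweight m) * B * L2norm (\<lambda>z. f z - p N z)) \<longlonglongrightarrow> 0"
    using tendsto_mult_right_zero[OF psum_tendsto_L2[OF f, folded p_def], of "sqrt (hweight m) * B"] by simp
  have "(\<lambda>N. hcoeff m (T f) - hcoeff m (T (p N))) \<longlonglongrightarrow> 0"
    by (rule Lim_null_comparison[OF _ lim]) (simp add: le)
  from tendsto_diff[OF tendsto_const this, of "hcoeff m (T f)"]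
  show ?thesis by (simp add: Tp)
qed

section \<open>The projection and Toeplitz operators with quasihomogeneous symbols\<close>

text \<open>The integral kernel of \<open>Q\<close> is the reproducing kernel
  \<open>\<Sum>n. hweight n * hbasis n z * cnj (hbasis n w)\<close>, a sum of two differentiated geometric series that
  share the term with index \<open>0\<close>.\<close>

lemma kernel_psum_tendsto:
  assumes z: "z \<in> disk" and w: "w \<in> disk"
  shows "(\<lambda>N. psum (\<lambda>n. complex_of_real (hweight n) * cnj (hbasis n w)) N z)
    \<longlonglongrightarrow> 1 / (1 - z * cnj w)\<^sup>2 + 1 / (1 - cnj z * w)\<^sup>2 - 1"
proof -
  let ?d = "\<lambda>n. complex_of_real (hweight n) * cnj (hbasis n w)"
  have lt: "cmod (z * cnj w) < 1" "cmod (cnj z * w) < 1"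
    using z w mult_strict_mono[of "cmod z" 1 "cmod w" 1] by (auto simp: norm_mult)
  have 1: "?d (int n) * z ^ n = of_nat (Suc n) * (z * cnj w) ^ n" for n
    using w by (simp add: hweight_def hbasis_def power_mult_distrib mult_ac)
  have 2: "?d (- int n) * cnj z ^ n = of_nat (Suc n) * (cnj z * w) ^ n" for n
    using w by (cases "n = 0") (auto simp: hweight_def hbasis_def power_mult_distrib mult_ac)
  have 3: "?d 0 = 1" using w by (simp add: hweight_def hbasis_def)
  show ?thesis unfolding psum_eq[OF z] 1 2 3
    using geometric_deriv_sums[OF lt(1)] geometric_deriv_sums[OF lt(2)] unfolding sums_def
    by (intro tendsto_diff tendsto_add tendsto_const LIMSEQ_Suc) 
qed

lemma kernel_psum_bounded:
  assumes z: "z \<in> disk"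
  obtains C where "\<And>N w. w \<in> disk \<Longrightarrow> cmod (psum (\<lambda>n. complex_of_real (hweight n) * cnj (hbasis n w)) N z) \<le> C"
proof
  fix N w assume w: "w \<in> disk"
  have s: "summable (\<lambda>n. of_nat (Suc n) * cmod z ^ n)"
    using geometric_deriv_sums[of "cmod z"] z by (auto simp: sums_iff)
  let ?C = "\<Sum>n. of_nat (Suc n) * cmod z ^ n"
  have part: "cmod (\<Sum>n<Suc N. a n) \<le> ?C" if "\<And>n. cmod (a n) \<le> of_nat (Suc n) * cmod z ^ n" for a
  proof -
    have "cmod (\<Sum>n<Suc N. a n) \<le> (\<Sum>n<Suc N. of_nat (Suc n) * cmod z ^ n)"
      using that by (intro sum_norm_le) auto
    also have "\<dots> \<le> ?C" using s by (intro sum_le_suminf) auto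
    finally show ?thesis .
  qed
  have le: "cmod (complex_of_real (hweight k) * cnj (hbasis k w)) \<le> hweight k" for k
    using norm_hbasis_le_1[of k w] hweight_pos[of k] by (simp add: norm_mult mult_left_le)
  have t: "cmod (complex_of_real (hweight k) * cnj (hbasis k w) * v ^ n) \<le> of_nat (Suc n) * cmod z ^ n"
    if "hweight k = of_nat (Suc n)" "cmod v = cmod z" for k n v
  proof -
    have "cmod (complex_of_real (hweight k) * cnj (hbasis k w) * v ^ n)
        = cmod (complex_of_real (hweight k) * cnj (hbasis k w)) * cmod z ^ n"
      by (simp only: norm_mult norm_power that(2))
    also have "\<dots> \<le> hweight k * cmod z ^ n" by (intro mult_right_mono le) auto
    finally show ?thesis by (simp only: that(1))
  qed
  have 1: "cmod (\<Sum>n<Suc N. complex_of_real (hweight (int n)) * cnj (hbasis (int n) w) * z ^ n) \<le> ?C"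
    by (intro part t) (auto simp: hweight_def)
  have 2: "cmod (\<Sum>n<Suc N. complex_of_real (hweight (- int n)) * cnj (hbasis (- int n) w) * cnj z ^ n) \<le> ?C"
    by (intro part t) (auto simp: hweight_def)
  have 3: "cmod (complex_of_real (hweight 0) * cnj (hbasis 0 w)) \<le> 1"
    using le[of 0] by (simp add: hweight_def)
  show "cmod (psum (\<lambda>n. complex_of_real (hweight n) * cnj (hbasis n w)) N z) \<le> ?C + ?C + 1"
    unfolding psum_eq[OF z] by (intro norm_triangle_le_diff[OF add_mono] norm_triangle_le add_mono 1 2 3)
qed

text \<open>For fixed \<open>z\<close> the kernel series converges uniformly in \<open>w\<close>, so that it may be integrated termwise
  against any integrable \<open>f\<close>. Hence \<open>Q f\<close> has the same coefficients as \<open>f\<close>.\<close>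

theorem Q_tendsto:
  assumes f: "integrable dA f" and z: "z \<in> disk"
  shows "(\<lambda>N. psum (\<lambda>n. hcoeff n f) N z) \<longlonglongrightarrow> Q f z"
proof -
  define k where "k N w = psum (\<lambda>n. complex_of_real (hweight n) * cnj (hbasis n w)) N z" for N w
  obtain C where C: "\<And>N w. w \<in> disk \<Longrightarrow> cmod (k N w) \<le> C"
    using kernel_psum_bounded[OF z] unfolding k_def by blast
  have km: "k N \<in> borel_measurable dA" for N
    unfolding k_def[abs_def] psum_def
    by (intro borel_measurable_sum borel_measurable_times borel_measurable_const borel_measurable_cnj measurable_hbasis)
  have lim: "(\<lambda>N. k N w) \<longlonglongrightarrow> 1 / (1 - z * cnj w)\<^sup>2 + 1 / (1 - cnj z * w)\<^sup>2 - 1" if "w \<in> disk" for w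
    unfolding k_def by (rule kernel_psum_tendsto[OF z that])
  have Km: "(\<lambda>w. 1 / (1 - z * cnj w)\<^sup>2 + 1 / (1 - cnj z * w)\<^sup>2 - 1) \<in> borel_measurable dA"
    by (rule borel_measurable_LIMSEQ_metric[OF km]) (use lim in auto)
  have "(\<lambda>N. LINT w|dA. k N w * f w) \<longlonglongrightarrow> (LINT w|dA. (1 / (1 - z * cnj w)\<^sup>2 + 1 / (1 - cnj z * w)\<^sup>2 - 1) * f w)"
  proof (rule integral_dominated_convergence[where w = "\<lambda>w. C * cmod (f w)"])
    show "AE w in dA. (\<lambda>N. k N w * f w) \<longlonglongrightarrow> (1 / (1 - z * cnj w)\<^sup>2 + 1 / (1 - cnj z * w)\<^sup>2 - 1) * f w"
      by (rule AE_I2) (intro tendsto_mult tendsto_const lim, simp)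
    show "AE w in dA. cmod (k N w * f w) \<le> C * cmod (f w)" for N
      by (rule AE_I2) (simp add: norm_mult mult_right_mono C)
    show "integrable dA (\<lambda>w. C * cmod (f w))" using f by simp
    show "(\<lambda>w. k N w * f w) \<in> borel_measurable dA" for N
      by (intro borel_measurable_times km borel_measurable_integrable f)
    show "(\<lambda>w. (1 / (1 - z * cnj w)\<^sup>2 + 1 / (1 - cnj z * w)\<^sup>2 - 1) * f w) \<in> borel_measurable dA"
      by (intro borel_measurable_times Km borel_measurable_integrable f)
  qed
  moreover have "(LINT w|dA. k N w * f w) = psum (\<lambda>n. hcoeff n f) N z" for N
  proof -
    have "(LINT w|dA. k N w * f w) = (LINT w|dA. (\<Sum>n\<in>{- int N..int N}. (complex_of_real (hweight n) * hbasis n z) * (f w * cnj (hbasis n w))))"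
      by (simp add: k_def psum_def sum_distrib_left sum_distrib_right mult_ac)
    also have "\<dots> = (\<Sum>n\<in>{- int N..int N}. (complex_of_real (hweight n) * hbasis n z) * (LINT w|dA. f w * cnj (hbasis n w)))"
      using integrable_mult_cnj_hbasis[OF f] by (simp add: integral_sum)
    also have "\<dots> = psum (\<lambda>n. hcoeff n f) N z"
      by (simp add: psum_def hcoeff_def mult_ac)
    finally show ?thesis .
  qed
  ultimately show ?thesis using z by (simp add: Q_def)
qed

corollary Q_eq_syn:
  assumes "integrable dA f" shows "Q f = syn (\<lambda>n. hcoeff n f)"
proof
  fix z show "Q f z = syn (\<lambda>n. hcoeff n f) z"
  proof (cases "z \<in> disk")
    case True
    from syn_eqI[OF Q_tendsto[OF assms True]] show ?thesis by simp
  next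
    case False
    then show ?thesis by (simp add: Q_def syn_outside)
  qed
qed

text \<open>The weight with which the Toeplitz operator of \<open>polar k \<psi>\<close> sends \<open>hbasis n\<close> to \<open>hbasis (n + k)\<close>.\<close>

definition tmult :: "int \<Rightarrow> (real \<Rightarrow> complex) \<Rightarrow> int \<Rightarrow> complex"
  where "tmult k \<psi> n = complex_of_real (hweight (n + k)) *
     (LINT z|dA. \<psi> (cmod z) * complex_of_real (cmod z ^ (nat \<bar>n\<bar> + nat \<bar>n + k\<bar>)))"

lemma hcoeff_polar_hbasis:
  "hcoeff m (\<lambda>z. polar k \<psi> z * hbasis n z) = (if m = n + k then tmult k \<psi> n else 0)"
proof -
  have "hcoeff m (\<lambda>z. polar k \<psi> z * hbasis n z)
      = hcoeff m (\<lambda>z. polar (k + n) (\<lambda>r. \<psi> r * complex_of_real (r ^ nat \<bar>n\<bar>)) z)"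
    by (rule hcoeff_cong) (simp add: hbasis_polar polar_mult)
  then show ?thesis
    by (simp add: hcoeff_def integral_polar_mult_cnj_hbasis tmult_def power_add mult.assoc add.commute)
qed

lemma hcoeff_polar_psum:
  assumes i: "integrable dA (polar k \<psi>)"
  shows "hcoeff m (\<lambda>z. polar k \<psi> z * psum c N z) = (if \<bar>m - k\<bar> \<le> int N then tmult k \<psi> (m - k) * c (m - k) else 0)"
proof -
  have int: "integrable dA (\<lambda>z. polar k \<psi> z * hbasis n z * cnj (hbasis m z))" for n
    by (intro integrable_mult_cnj_hbasis integrable_mult_hbasis i)
  have "hcoeff m (\<lambda>z. polar k \<psi> z * psum c N z) = (\<Sum>n\<in>{- int N..int N}. c n * hcoeff m (\<lambda>z. polar k \<psi> z * hbasis n z))"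
  proof -
    have "(LINT z|dA. polar k \<psi> z * psum c N z * cnj (hbasis m z))
       = (LINT z|dA. (\<Sum>n\<in>{- int N..int N}. c n * (polar k \<psi> z * hbasis n z * cnj (hbasis m z))))"
      by (simp add: psum_def sum_distrib_left sum_distrib_right mult_ac)
    also have "\<dots> = (\<Sum>n\<in>{- int N..int N}. c n * (LINT z|dA. polar k \<psi> z * hbasis n z * cnj (hbasis m z)))"
      using int by (simp add: integral_sum)
    finally show ?thesis by (simp add: hcoeff_def sum_distrib_left mult_ac)
  qed
  also have "\<dots> = (\<Sum>n\<in>{- int N..int N}. if n = m - k then tmult k \<psi> n * c n else 0)"
    by (intro sum.cong) (auto simp: hcoeff_polar_hbasis)
  also have "\<dots> = (if \<bar>m - k\<bar> \<le> int N then tmult k \<psi> (m - k) * c (m - k) else 0)"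
    by (auto simp: abs_le_iff)
  finally show ?thesis .
qed

definition weighted_shift :: "int \<Rightarrow> (int \<Rightarrow> complex) \<Rightarrow> (complex \<Rightarrow> complex) \<Rightarrow> complex \<Rightarrow> complex"
  where "weighted_shift k t f = syn (\<lambda>m. t (m - k) * hcoeff (m - k) f)"

lemma hweight_shift: "hweight n \<le> (\<bar>real_of_int k\<bar> + 1) * hweight (n + k)"
proof -
  have "hweight n \<le> \<bar>real_of_int k\<bar> + hweight (n + k)" by (simp add: hweight_def)
  also have "\<dots> \<le> \<bar>real_of_int k\<bar> * hweight (n + k) + hweight (n + k)"
    using hweight_ge_1[of "n + k"] by (intro add_right_mono) (simp add: mult_le_cancel_left1)
  finally show ?thesis by (simp add: distrib_right)
qed

text \<open>The norms of \<open>hbasis n\<close> and \<open>hbasis (n + k)\<close> differ by a factor that is bounded in \<open>n\<close>, so a shift by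
  \<open>k\<close> with bounded weights is bounded.\<close>

lemma sq_bounded_weighted_shift:
  assumes t: "\<And>n. cmod (t n) \<le> B" and f: "f \<in> Lh2"
  shows "sq_bounded (\<lambda>m. t (m - k) * hcoeff (m - k) f) (B\<^sup>2 * (\<bar>real_of_int k\<bar> + 1) * (L2norm f)\<^sup>2)"
  unfolding sq_bounded_def
proof
  fix N
  let ?K = "B\<^sup>2 * (\<bar>real_of_int k\<bar> + 1)"
  have "(\<Sum>m\<in>{- int N..int N}. (cmod (t (m - k) * hcoeff (m - k) f))\<^sup>2 / hweight m)
     \<le> (\<Sum>m\<in>{- int N..int N}. ?K * ((cmod (hcoeff (m - k) f))\<^sup>2 / hweight (m - k)))"
  proof (rule sum_mono)
    fix m
    let ?c = "(cmod (hcoeff (m - k) f))\<^sup>2"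
    have "(cmod (t (m - k) * hcoeff (m - k) f))\<^sup>2 \<le> B\<^sup>2 * ?c"
      using t[of "m - k"] by (simp add: norm_mult power_mult_distrib mult_right_mono power_mono)
    then have "(cmod (t (m - k) * hcoeff (m - k) f))\<^sup>2 / hweight m \<le> B\<^sup>2 * ?c / hweight m"
      by (intro divide_right_mono less_imp_le[OF hweight_pos])
    also have "\<dots> \<le> B\<^sup>2 * ?c * ((\<bar>real_of_int k\<bar> + 1) / hweight (m - k))"
    proof -
      have "1 / hweight m \<le> (\<bar>real_of_int k\<bar> + 1) / hweight (m - k)"
        using hweight_shift[of "m - k" k] hweight_pos[of m] hweight_pos[of "m - k"] by (simp add: field_simps)
      then have "B\<^sup>2 * ?c * (1 / hweight m) \<le> B\<^sup>2 * ?c * ((\<bar>real_of_int k\<bar> + 1) / hweight (m - k))"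
        by (intro mult_left_mono) auto
      then show ?thesis by simp
    qed
    finally show "(cmod (t (m - k) * hcoeff (m - k) f))\<^sup>2 / hweight m \<le> ?K * (?c / hweight (m - k))"
      by (simp add: mult_ac)
  qed
  also have "\<dots> = ?K * (\<Sum>m\<in>{- int N..int N}. (cmod (hcoeff (m - k) f))\<^sup>2 / hweight (m - k))"
    by (simp only: sum_distrib_left)
  also have "(\<Sum>m\<in>{- int N..int N}. (cmod (hcoeff (m - k) f))\<^sup>2 / hweight (m - k))
      = (\<Sum>n\<in>(\<lambda>m. m - k) ` {- int N..int N}. (cmod (hcoeff n f))\<^sup>2 / hweight n)"
    by (subst sum.reindex) (auto simp: inj_on_def)
  also have "?K * \<dots> \<le> ?K * (L2norm f)\<^sup>2"
    by (intro mult_left_mono bessel[OF f]) auto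
  finally show "(\<Sum>m\<in>{- int N..int N}. (cmod (t (m - k) * hcoeff (m - k) f))\<^sup>2 / hweight m) \<le> ?K * (L2norm f)\<^sup>2" .
qed

lemma
  assumes t: "\<And>n. cmod (t n) \<le> B" and f: "f \<in> Lh2"
  shows weighted_shift_in_Lh2: "weighted_shift k t f \<in> Lh2"
    and hcoeff_weighted_shift: "hcoeff m (weighted_shift k t f) = t (m - k) * hcoeff (m - k) f"
    and L2norm_weighted_shift: "L2norm (weighted_shift k t f) \<le> sqrt (B\<^sup>2 * (\<bar>real_of_int k\<bar> + 1)) * L2norm f"
proof -
  note b = sq_bounded_weighted_shift[of t, OF t f, of k]
  show "weighted_shift k t f \<in> Lh2" unfolding weighted_shift_def by (rule syn_in_Lh2[OF b])
  show "hcoeff m (weighted_shift k t f) = t (m - k) * hcoeff (m - k) f"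
    unfolding weighted_shift_def by (rule hcoeff_syn[OF b])
  have "(L2norm (weighted_shift k t f))\<^sup>2 \<le> B\<^sup>2 * (\<bar>real_of_int k\<bar> + 1) * (L2norm f)\<^sup>2"
    unfolding weighted_shift_def by (rule L2norm_syn_le[OF b])
  also have "\<dots> = (sqrt (B\<^sup>2 * (\<bar>real_of_int k\<bar> + 1)) * L2norm f)\<^sup>2"
    by (simp add: power_mult_distrib)
  finally show "L2norm (weighted_shift k t f) \<le> sqrt (B\<^sup>2 * (\<bar>real_of_int k\<bar> + 1)) * L2norm f"
    by (rule power2_le_imp_le) (simp add: L2norm_nonneg)
qed

lemma bounded_operator_weighted_shift:
  assumes t: "\<And>n. cmod (t n) \<le> B" shows "bounded_operator (restrict (weighted_shift k t) Lh2)"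
proof -
  note wl = weighted_shift_in_Lh2[of t, OF t, of _ k] and wc = hcoeff_weighted_shift[of t, OF t, of _ _ k]
  have "weighted_shift k t (\<lambda>z. f z + g z) = (\<lambda>z. weighted_shift k t f z + weighted_shift k t g z)"
    if "f \<in> Lh2" "g \<in> Lh2" for f g
    by (rule Lh2_eqI) (simp_all add: that Lh2_add wl wc hcoeff_add distrib_left)
  moreover have "weighted_shift k t (\<lambda>z. c * f z) = (\<lambda>z. c * weighted_shift k t f z)" if "f \<in> Lh2" for f c
    by (rule Lh2_eqI) (simp_all add: that Lh2_cmult wl wc hcoeff_cmult)
  moreover have "\<exists>B. \<forall>f\<in>Lh2. L2norm (weighted_shift k t f) \<le> B * L2norm f"
    using L2norm_weighted_shift[of t, OF t, of _ k] by blast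
  ultimately show ?thesis
    unfolding bounded_operator_def by (auto simp: Lh2_add Lh2_cmult wl)
qed

lemma weighted_shift_hbasis: "weighted_shift k t (hbasis n) = (\<lambda>z. t n * hbasis (n + k) z)"
proof -
  have "(\<lambda>m. t (m - k) * hcoeff (m - k) (hbasis n)) = (\<lambda>m. if m = n + k then t n else 0)"
    by (auto simp: fun_eq_iff hcoeff_hbasis)
  then show ?thesis by (simp add: weighted_shift_def syn_single)
qed

lemma Q_polar_harmonic_polynomial:
  assumes i: "integrable dA (polar k \<psi>)" and h: "h \<in> harmonic_polynomials"
  shows "Q (\<lambda>w. polar k \<psi> w * h w) = weighted_shift k (tmult k \<psi>) h"
proof -
  obtain N where N: "h = psum (\<lambda>n. hcoeff n h) N" using harmonic_polynomial_eq_psum[OF h] by blast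
  have b: "cmod (psum c N z) \<le> (\<Sum>n\<in>{- int N..int N}. cmod (c n))" for c z
    unfolding psum_def by (rule norm_sum_hbasis_le)
  have "integrable dA (\<lambda>w. polar k \<psi> w * psum (\<lambda>n. hcoeff n h) N w)"
    using integrable_dA_mult_bounded[OF i measurable_psum b] by (simp add: mult.commute)
  then have ih: "integrable dA (\<lambda>w. polar k \<psi> w * h w)" using N by simp
  have "hcoeff m (\<lambda>w. polar k \<psi> w * h w) = tmult k \<psi> (m - k) * hcoeff (m - k) h" for m
  proof -
    have "hcoeff m (\<lambda>w. polar k \<psi> w * h w) = hcoeff m (\<lambda>w. polar k \<psi> w * psum (\<lambda>n. hcoeff n h) N w)"
      using N by simp
    also have "\<dots> = (if \<bar>m - k\<bar> \<le> int N then tmult k \<psi> (m - k) * hcoeff (m - k) h else 0)"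
      by (rule hcoeff_polar_psum[OF i])
    also have "\<dots> = tmult k \<psi> (m - k) * hcoeff (m - k) h"
    proof -
      have "hcoeff (m - k) h = (if m - k \<in> {- int N..int N} then hcoeff (m - k) h else 0)"
        by (subst N) (simp only: psum_def[abs_def] hcoeff_sum_hbasis[OF finite_atLeastAtMost_int])
      then show ?thesis by (auto split: if_splits)
    qed
    finally show ?thesis .
  qed
  then show ?thesis unfolding Q_eq_syn[OF ih] weighted_shift_def by simp
qed

text \<open>Testing the operator on the basis functions shows that its weights are bounded; conversely bounded
  weights give a bounded weighted shift which agrees with \<open>h \<mapsto> Q (u h)\<close> on harmonic polynomials.\<close>

theorem T_function_polar_iff:
  "T_function (polar k \<psi>) \<longleftrightarrow> integrable dA (polar k \<psi>) \<and> (\<exists>B. \<forall>n. cmod (tmult k \<psi> n) \<le> B)"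
proof
  assume T: "T_function (polar k \<psi>)"
  then have i: "integrable dA (polar k \<psi>)" by (simp add: T_function_def)
  obtain B where B: "\<And>h. h \<in> harmonic_polynomials \<Longrightarrow> Q (\<lambda>w. polar k \<psi> w * h w) \<in> Lh2"
     "\<And>h. h \<in> harmonic_polynomials \<Longrightarrow> L2norm (Q (\<lambda>w. polar k \<psi> w * h w)) \<le> B * L2norm h"
    using T unfolding T_function_def by blast
  have "cmod (tmult k \<psi> n) \<le> sqrt (B\<^sup>2 * (\<bar>real_of_int k\<bar> + 1))" for n
  proof -
    let ?g = "Q (\<lambda>w. polar k \<psi> w * hbasis n w)"
    have g: "?g \<in> Lh2" "L2norm ?g \<le> B * L2norm (hbasis n)" using B[OF hbasis_harmonic_polynomial] by auto
    have "?g = (\<lambda>z. tmult k \<psi> n * hbasis (n + k) z)"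
      unfolding Q_polar_harmonic_polynomial[OF i hbasis_harmonic_polynomial] by (rule weighted_shift_hbasis)
    then have "cmod (tmult k \<psi> n) * L2norm (hbasis (n + k)) \<le> B * L2norm (hbasis n)"
      using g(2) by (simp add: L2norm_cmult)
    then have "(cmod (tmult k \<psi> n) * L2norm (hbasis (n + k)))\<^sup>2 \<le> (B * L2norm (hbasis n))\<^sup>2"
      by (intro power_mono) (auto simp: L2norm_nonneg)
    then have le: "(cmod (tmult k \<psi> n))\<^sup>2 / hweight (n + k) \<le> B\<^sup>2 / hweight n"
      by (simp add: power_mult_distrib L2norm_hbasis)
    have "(cmod (tmult k \<psi> n))\<^sup>2 \<le> B\<^sup>2 / hweight n * hweight (n + k)"
      using le hweight_pos[of "n + k"] by (simp add: pos_divide_le_eq)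
    also have "\<dots> = B\<^sup>2 * (hweight (n + k) / hweight n)" by simp
    also have "\<dots> \<le> B\<^sup>2 * (\<bar>real_of_int k\<bar> + 1)"
      using hweight_shift[of "n + k" "- k"] hweight_pos[of n] by (intro mult_left_mono) (auto simp: pos_divide_le_eq)
    finally show ?thesis by (rule real_le_rsqrt)
  qed
  then show "integrable dA (polar k \<psi>) \<and> (\<exists>B. \<forall>n. cmod (tmult k \<psi> n) \<le> B)" using i by blast
next
  assume a: "integrable dA (polar k \<psi>) \<and> (\<exists>B. \<forall>n. cmod (tmult k \<psi> n) \<le> B)"
  then obtain B where B: "\<And>n. cmod (tmult k \<psi> n) \<le> B" by blast
  show "T_function (polar k \<psi>)"
    unfolding T_function_def
  proof (intro conjI exI ballI)
    show "integrable dA (polar k \<psi>)" using a by blast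
    fix h assume h: "h \<in> harmonic_polynomials"
    have h': "h \<in> Lh2" by (rule harmonic_polynomial_Lh2[OF h])
    have eq: "Q (\<lambda>w. polar k \<psi> w * h w) = weighted_shift k (tmult k \<psi>) h"
      by (rule Q_polar_harmonic_polynomial[OF _ h]) (use a in blast)
    show "Q (\<lambda>w. polar k \<psi> w * h w) \<in> Lh2"
      unfolding eq by (rule weighted_shift_in_Lh2[of "tmult k \<psi>", OF B h'])
    show "L2norm (Q (\<lambda>w. polar k \<psi> w * h w)) \<le> sqrt (B\<^sup>2 * (\<bar>real_of_int k\<bar> + 1)) * L2norm h"
      unfolding eq by (rule L2norm_weighted_shift[of "tmult k \<psi>", OF B h'])
  qed
qed

lemma bounded_operator_eqI:
  assumes S: "bounded_operator S" and T: "bounded_operator T"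
    and eq: "\<And>n. S (hbasis n) = T (hbasis n)" and f: "f \<in> Lh2"
  shows "S f = T f"
proof (rule Lh2_eqI[OF bounded_operator_in_Lh2[OF S f] bounded_operator_in_Lh2[OF T f]])
  fix m
  show "hcoeff m (S f) = hcoeff m (T f)"
    by (rule LIMSEQ_unique[OF bounded_operator_expansion[OF S f, unfolded eq] bounded_operator_expansion[OF T f]])
qed

text \<open>The weighted shift has the properties that characterise the Toeplitz operator, and two bounded
  operators that agree on the basis are equal.\<close>

theorem Toeplitz_polar:
  assumes T: "T_function (polar k \<psi>)"
  shows "Toeplitz (polar k \<psi>) = restrict (weighted_shift k (tmult k \<psi>)) Lh2"
proof -
  have i: "integrable dA (polar k \<psi>)" and "\<exists>B. \<forall>n. cmod (tmult k \<psi> n) \<le> B"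
    using T by (simp_all add: T_function_polar_iff)
  then obtain B where B: "\<And>n. cmod (tmult k \<psi> n) \<le> B" by blast
  let ?W = "restrict (weighted_shift k (tmult k \<psi>)) Lh2"
  have W: "bounded_operator ?W" by (rule bounded_operator_weighted_shift[of "tmult k \<psi>", OF B])
  have Wh: "?W h = Q (\<lambda>w. polar k \<psi> w * h w)" if "h \<in> harmonic_polynomials" for h
    using Q_polar_harmonic_polynomial[OF i that] harmonic_polynomial_Lh2[OF that] by simp
  show ?thesis
    unfolding Toeplitz_def
  proof (rule the_equality)
    show "bounded_operator ?W \<and> ?W \<in> extensional Lh2 \<and> (\<forall>h\<in>harmonic_polynomials. ?W h = Q (\<lambda>w. polar k \<psi> w * h w))"
      using W Wh by auto
    fix S assume S: "bounded_operator S \<and> S \<in> extensional Lh2 \<and> (\<forall>h\<in>harmonic_polynomials. S h = Q (\<lambda>w. polar k \<psi> w * h w))"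
    have "S f = ?W f" if "f \<in> Lh2" for f
      by (rule bounded_operator_eqI[OF _ W _ that]) (use S Wh hbasis_harmonic_polynomial in auto)
    then show "S = ?W" using S by (intro extensionalityI[of _ Lh2]) auto
  qed
qed

section \<open>Finite rank of weighted shifts\<close>

text \<open>The basis functions are linearly independent, as their coefficients show.\<close>

lemma finite_if_hbasis_in_finite_span:
  assumes B: "finite B"
    and J: "\<And>j. j \<in> J \<Longrightarrow> \<exists>c :: (complex \<Rightarrow> complex) \<Rightarrow> complex. hbasis j = (\<lambda>z. \<Sum>b\<in>B. c b * b z)"
  shows "finite J"
proof -
  interpret F: vector_space "\<lambda>c (f :: complex \<Rightarrow> complex) z. c * f z"
    by standard (auto simp: fun_eq_iff algebra_simps)
  have sum_fun: "(\<Sum>b\<in>A. (\<lambda>z. c b * g b z)) = (\<lambda>z. \<Sum>b\<in>A. c b * g b z)" for A and c :: "'i \<Rightarrow> complex" and g :: "'i \<Rightarrow> complex \<Rightarrow> complex"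
    by (induction A rule: infinite_finite_induct) (auto simp: fun_eq_iff)
  have "F.independent (hbasis ` J)"
    unfolding F.independent_explicit_finite_subsets
  proof (intro allI impI ballI)
    fix A u v
    assume A: "A \<subseteq> hbasis ` J" "finite A" and z: "(\<Sum>v\<in>A. (\<lambda>z. u v * v z)) = 0" and v: "v \<in> A"
    obtain I where I: "A = hbasis ` I" using A(1) by (auto simp: subset_image_iff)
    have fI: "finite I" using A(2) inj_hbasis unfolding I by (meson finite_imageD inj_on_subset subset_UNIV)
    have "(\<lambda>z. \<Sum>n\<in>I. u (hbasis n) * hbasis n z) = (\<lambda>z. 0)"
    proof -
      have "(\<Sum>v\<in>A. (\<lambda>z. u v * v z)) = (\<Sum>n\<in>I. (\<lambda>z. u (hbasis n) * hbasis n z))"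
        unfolding I by (rule sum.reindex_cong[of hbasis]) (auto intro: inj_on_subset[OF inj_hbasis])
      then show ?thesis using z unfolding sum_fun by (simp add: zero_fun_def)
    qed
    then have c0: "hcoeff m (\<lambda>z. \<Sum>n\<in>I. u (hbasis n) * hbasis n z) = 0" for m by (simp add: hcoeff_def)
    obtain m where m: "m \<in> I" "v = hbasis m" using v unfolding I by blast
    show "u v = 0" using c0[of m] m unfolding hcoeff_sum_hbasis[OF fI] by simp
  qed
  moreover have "hbasis ` J \<subseteq> F.span B"
  proof (rule image_subsetI)
    fix j assume "j \<in> J"
    then obtain c where c: "hbasis j = (\<lambda>z. \<Sum>b\<in>B. c b * b z)" using J by blast
    have "(\<Sum>b\<in>B. (\<lambda>z. c b * b z)) \<in> F.span B"
      by (intro F.span_sum F.span_scale F.span_base)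
    then show "hbasis j \<in> F.span B" unfolding c sum_fun .
  qed
  ultimately have "finite (hbasis ` J)" using F.independent_span_bound[OF B] by blast
  then show ?thesis using inj_hbasis by (meson finite_imageD inj_on_subset subset_UNIV)
qed

text \<open>If the range has finite-dimensional closure, the finitely many functions spanning it span every
  \<open>hbasis (n + k)\<close> with \<open>\<mu> n \<noteq> 0\<close>, so there are finitely many of these. Conversely, if \<open>\<mu>\<close> has finite
  support, all coefficients of \<open>S f\<close> outside a fixed finite set vanish; coefficients are continuous in
  the norm, so this remains true on the closure of the range.\<close>

theorem finite_rank_shift_iff:
  assumes S: "bounded_operator S" and sh: "\<And>n. S (hbasis n) = (\<lambda>z. \<mu> n * hbasis (n + k) z)"
  shows "finite_rank S \<longleftrightarrow> finite {n. \<mu> n \<noteq> 0}"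
proof
  assume "finite_rank S"
  then obtain B where B: "finite B" "\<And>g. g \<in> Lh2_closure (S ` Lh2) \<Longrightarrow> \<exists>c :: (complex \<Rightarrow> complex) \<Rightarrow> complex. g = (\<lambda>z. \<Sum>b\<in>B. c b * b z)"
    unfolding finite_rank_def finite_dimensional_def by blast
  have "\<exists>c :: (complex \<Rightarrow> complex) \<Rightarrow> complex. hbasis (n + k) = (\<lambda>z. \<Sum>b\<in>B. c b * b z)" if "\<mu> n \<noteq> 0" for n
  proof -
    have "S (hbasis n) \<in> Lh2_closure (S ` Lh2)"
      unfolding Lh2_closure_def
    proof (intro CollectI conjI allI impI)
      show "S (hbasis n) \<in> Lh2" by (rule bounded_operator_in_Lh2[OF S hbasis_Lh2])
      fix e :: real assume "e > 0"
      then show "\<exists>f\<in>S ` Lh2. L2norm (\<lambda>z. f z - S (hbasis n) z) < e"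
        using hbasis_Lh2 by (intro bexI[of _ "S (hbasis n)"]) (auto simp: L2norm_def)
    qed
    then obtain c :: "(complex \<Rightarrow> complex) \<Rightarrow> complex" where "S (hbasis n) = (\<lambda>z. \<Sum>b\<in>B. c b * b z)" using B(2) by blast
    then have c: "\<mu> n * hbasis (n + k) z = (\<Sum>b\<in>B. c b * b z)" for z
      unfolding sh by (rule fun_cong)
    have "hbasis (n + k) z = (\<Sum>b\<in>B. c b / \<mu> n * b z)" for z
    proof -
      have "hbasis (n + k) z = (\<mu> n * hbasis (n + k) z) / \<mu> n" using that by simp
      also have "\<dots> = (\<Sum>b\<in>B. c b / \<mu> n * b z)" unfolding c by (simp add: sum_divide_distrib)
      finally show ?thesis .
    qed
    then show ?thesis by (intro exI[of _ "\<lambda>b. c b / \<mu> n"] ext)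
  qed
  then have "finite ((\<lambda>n. n + k) ` {n. \<mu> n \<noteq> 0})"
    by (intro finite_if_hbasis_in_finite_span[OF B(1)]) auto
  then show "finite {n. \<mu> n \<noteq> 0}" by (rule finite_imageD) (simp add: inj_on_def)
next
  assume fin: "finite {n. \<mu> n \<noteq> 0}"
  define J where "J = (\<lambda>n. n + k) ` {n. \<mu> n \<noteq> 0}"
  have fJ: "finite J" using fin by (simp add: J_def)
  have zero: "hcoeff m (S f) = 0" if m: "m \<notin> J" and f: "f \<in> Lh2" for m f
  proof -
    have mu: "\<mu> (m - k) = 0" using m by (force simp: J_def image_iff)
    have z: "hcoeff n f * hcoeff m (S (hbasis n)) = 0" for n
      unfolding sh hcoeff_cmult hcoeff_hbasis using mu by auto
    then have "(\<lambda>N. 0) \<longlonglongrightarrow> hcoeff m (S f)" using bounded_operator_expansion[OF S f, of m] unfolding z by simp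
    then show ?thesis by (simp add: LIMSEQ_const_iff)
  qed
  have cl: "g = (\<lambda>z. \<Sum>j\<in>J. hcoeff j g * hbasis j z)" if g: "g \<in> Lh2_closure (S ` Lh2)" for g
  proof (rule Lh2_eqI)
    show gL: "g \<in> Lh2" using g by (simp add: Lh2_closure_def)
    show "(\<lambda>z. \<Sum>j\<in>J. hcoeff j g * hbasis j z) \<in> Lh2" by (rule Lh2_sum_hbasis[OF fJ])
    fix m
    have "hcoeff m g = 0" if m: "m \<notin> J"
    proof (rule ccontr)
      assume ne: "hcoeff m g \<noteq> 0"
      define e where "e = cmod (hcoeff m g) / sqrt (hweight m)"
      have sq: "sqrt (hweight m) > 0" using hweight_pos[of m] by simp
      have "e > 0" unfolding e_def using ne sq by (intro divide_pos_pos) auto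
      then obtain f where f: "f \<in> Lh2" "L2norm (\<lambda>z. S f z - g z) < e"
        using g by (auto simp: Lh2_closure_def)
      have SL: "S f \<in> Lh2" by (rule bounded_operator_in_Lh2[OF S f(1)])
      have "cmod (hcoeff m g) = cmod (hcoeff m (\<lambda>z. S f z - g z))"
        by (simp add: hcoeff_diff[OF SL gL] zero[OF m f(1)])
      also have "\<dots> \<le> sqrt (hweight m) * L2norm (\<lambda>z. S f z - g z)" by (rule hcoeff_bound[OF Lh2_diff[OF SL gL]])
      also have "\<dots> < sqrt (hweight m) * e" using f(2) sq by (rule mult_strict_left_mono)
      also have "\<dots> = cmod (hcoeff m g)" using sq by (simp add: e_def)
      finally show False by simp
    qed
    then show "hcoeff m g = hcoeff m (\<lambda>z. \<Sum>j\<in>J. hcoeff j g * hbasis j z)"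
      by (simp add: hcoeff_sum_hbasis[OF fJ])
  qed
  have inj: "inj_on hbasis J" by (rule inj_on_subset[OF inj_hbasis]) simp
  show "finite_rank S"
    unfolding finite_rank_def finite_dimensional_def
  proof (intro conjI S exI[of _ "hbasis ` J"] ballI)
    show "finite (hbasis ` J)" using fJ by simp
    fix g assume g: "g \<in> Lh2_closure (S ` Lh2)"
    have "(\<lambda>z. \<Sum>b\<in>hbasis ` J. hcoeff (inv_into J hbasis b) g * b z) = (\<lambda>z. \<Sum>j\<in>J. hcoeff j g * hbasis j z)"
      by (rule ext, subst sum.reindex[OF inj]) (simp add: inv_into_f_f[OF inj])
    then show "\<exists>c :: (complex \<Rightarrow> complex) \<Rightarrow> complex. g = (\<lambda>z. \<Sum>b\<in>hbasis ` J. c b * b z)"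
      using cl[OF g] by (intro exI[of _ "\<lambda>b. hcoeff (inv_into J hbasis b) g"]) simp
  qed
qed

lemma bounded_operator_compose:
  assumes S: "bounded_operator S" and T: "bounded_operator T" shows "bounded_operator (\<lambda>f. S (T f))"
proof -
  obtain A where A: "A \<ge> 0" "\<And>f. f \<in> Lh2 \<Longrightarrow> L2norm (S f) \<le> A * L2norm f" using bounded_operator_bound[OF S] by blast
  obtain B where B: "B \<ge> 0" "\<And>f. f \<in> Lh2 \<Longrightarrow> L2norm (T f) \<le> B * L2norm f" using bounded_operator_bound[OF T] by blast
  have "L2norm (S (T f)) \<le> A * B * L2norm f" if f: "f \<in> Lh2" for f
    using order_trans[OF A(2)[OF bounded_operator_in_Lh2[OF T f]] mult_left_mono[OF B(2)[OF f] A(1)]] by (simp add: mult.assoc)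
  then have "\<exists>C. \<forall>f\<in>Lh2. L2norm (S (T f)) \<le> C * L2norm f" by blast
  then show ?thesis
    unfolding bounded_operator_def
    by (simp add: bounded_operator_in_Lh2[OF S] bounded_operator_in_Lh2[OF T] bounded_operator_add[OF T]
        bounded_operator_add[OF S] bounded_operator_cmult[OF T] bounded_operator_cmult[OF S])
qed

lemma bounded_operator_minus:
  assumes S: "bounded_operator S" and T: "bounded_operator T" shows "bounded_operator (\<lambda>f z. S f z - T f z)"
proof -
  obtain A where A: "A \<ge> 0" "\<And>f. f \<in> Lh2 \<Longrightarrow> L2norm (S f) \<le> A * L2norm f" using bounded_operator_bound[OF S] by blast
  obtain B where B: "B \<ge> 0" "\<And>f. f \<in> Lh2 \<Longrightarrow> L2norm (T f) \<le> B * L2norm f" using bounded_operator_bound[OF T] by blast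
  have "L2norm (\<lambda>z. S f z - T f z) \<le> sqrt (2 * A\<^sup>2 + 2 * B\<^sup>2) * L2norm f" if f: "f \<in> Lh2" for f
  proof (rule power2_le_imp_le)
    have sf: "S f \<in> Lh2" and tf: "T f \<in> Lh2" using bounded_operator_in_Lh2[OF S f] bounded_operator_in_Lh2[OF T f] .
    have "(L2norm (\<lambda>z. S f z + (-1) * T f z))\<^sup>2 \<le> 2 * (L2norm (S f))\<^sup>2 + 2 * (L2norm (\<lambda>z. (-1) * T f z))\<^sup>2"
      by (rule L2norm_add_square_le[OF sf Lh2_cmult[OF tf]])
    also have "\<dots> = 2 * (L2norm (S f))\<^sup>2 + 2 * (L2norm (T f))\<^sup>2" by (simp only: L2norm_cmult) simp
    also have "\<dots> \<le> 2 * (A * L2norm f)\<^sup>2 + 2 * (B * L2norm f)\<^sup>2"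
      by (intro add_mono mult_left_mono power_mono A(2) B(2) f) (auto simp: L2norm_nonneg)
    also have "\<dots> = (sqrt (2 * A\<^sup>2 + 2 * B\<^sup>2) * L2norm f)\<^sup>2"
      by (simp add: power_mult_distrib algebra_simps)
    finally show "(L2norm (\<lambda>z. S f z - T f z))\<^sup>2 \<le> (sqrt (2 * A\<^sup>2 + 2 * B\<^sup>2) * L2norm f)\<^sup>2" by simp
  qed (simp add: L2norm_nonneg)
  then have "\<exists>C. \<forall>f\<in>Lh2. L2norm (\<lambda>z. S f z - T f z) \<le> C * L2norm f" by blast
  then show ?thesis
    unfolding bounded_operator_def
    by (simp add: Lh2_diff bounded_operator_in_Lh2[OF S] bounded_operator_in_Lh2[OF T] bounded_operator_add[OF T]
        bounded_operator_add[OF S] bounded_operator_cmult[OF T] bounded_operator_cmult[OF S] algebra_simps)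
qed

theorem semicommutator_finite_rank_iff:
  assumes u: "T_function (polar k1 \<psi>1)" and v: "T_function (polar k2 \<psi>2)" and w: "T_function (polar (k1 + k2) \<psi>3)"
  shows "finite_rank (\<lambda>h z. Toeplitz (polar k1 \<psi>1) (Toeplitz (polar k2 \<psi>2) h) z - Toeplitz (polar (k1 + k2) \<psi>3) h z) \<longleftrightarrow>
    finite {n. tmult k1 \<psi>1 (n + k2) * tmult k2 \<psi>2 n - tmult (k1 + k2) \<psi>3 n \<noteq> 0}"
proof (rule finite_rank_shift_iff)
  have bd: "bounded_operator (Toeplitz (polar k \<psi>))" "Toeplitz (polar k \<psi>) (hbasis n) = (\<lambda>z. tmult k \<psi> n * hbasis (n + k) z)"
    if T: "T_function (polar k \<psi>)" for k \<psi> n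
  proof -
    obtain B where B: "\<And>n. cmod (tmult k \<psi> n) \<le> B" using T unfolding T_function_polar_iff by blast
    show "bounded_operator (Toeplitz (polar k \<psi>))"
      unfolding Toeplitz_polar[OF T] by (rule bounded_operator_weighted_shift[of "tmult k \<psi>", OF B])
    show "Toeplitz (polar k \<psi>) (hbasis n) = (\<lambda>z. tmult k \<psi> n * hbasis (n + k) z)"
      unfolding Toeplitz_polar[OF T] by (simp add: weighted_shift_hbasis hbasis_Lh2)
  qed
  show "bounded_operator (\<lambda>h z. Toeplitz (polar k1 \<psi>1) (Toeplitz (polar k2 \<psi>2) h) z - Toeplitz (polar (k1 + k2) \<psi>3) h z)"
    by (rule bounded_operator_minus[OF bounded_operator_compose[OF bd(1)[OF u] bd(1)[OF v]] bd(1)[OF w]])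
  fix n
  have "Toeplitz (polar k1 \<psi>1) (Toeplitz (polar k2 \<psi>2) (hbasis n))
      = (\<lambda>z. tmult k2 \<psi>2 n * (tmult k1 \<psi>1 (n + k2) * hbasis (n + k2 + k1) z))"
    unfolding bd(2)[OF v] bounded_operator_cmult[OF bd(1)[OF u] hbasis_Lh2] bd(2)[OF u] by (rule refl)
  then show "(\<lambda>z. Toeplitz (polar k1 \<psi>1) (Toeplitz (polar k2 \<psi>2) (hbasis n)) z - Toeplitz (polar (k1 + k2) \<psi>3) (hbasis n) z)
      = (\<lambda>z. (tmult k1 \<psi>1 (n + k2) * tmult k2 \<psi>2 n - tmult (k1 + k2) \<psi>3 n) * hbasis (n + (k1 + k2)) z)"
    unfolding bd(2)[OF w] by (simp add: algebra_simps)
qed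

section \<open>Radial functions with vanishing moments\<close>

text \<open>Monomials \<open>z ^ i * cnj z ^ j\<close> with \<open>i \<noteq> j\<close> are orthogonal to radial functions by rotation invariance,
  those with \<open>i = j\<close> by the hypothesis on the moments.\<close>

lemma bipoly_orthogonal_radial:
  fixes g :: "real \<Rightarrow> complex"
  assumes f: "integrable dA (\<lambda>z. g (cmod z))"
    and mom: "\<And>j :: nat. (LINT z|dA. g (cmod z) * complex_of_real (cmod z ^ (2 * j))) = 0"
    and p: "bipoly p"
  shows "(LINT z|dA. g (cmod z) * p z) = 0"
  using p
proof induction
  case (monomial c i j)
  have "(LINT z|dA. g (cmod z) * (c * z ^ i * cnj z ^ j)) = c * (LINT z|dA. polar (int i - int j) (\<lambda>r. g r * complex_of_real (r ^ (i + j))) z)"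
    by (simp only: mult.assoc monomial_polar) (simp add: polar_def mult_ac)
  also have "\<dots> = 0"
  proof (cases "i = j")
    case True
    then show ?thesis using mom[of j] by (simp add: polar_zero_index mult_2)
  qed (simp add: integral_polar_nonzero)
  finally show ?case .
next
  case (add p q)
  show ?case using add integrable_mult_bipoly[OF f add.hyps(1)] integrable_mult_bipoly[OF f add.hyps(2)]
    by (simp add: distrib_left)
qed

text \<open>The function \<open>cnj (sgn f)\<close> is an almost everywhere limit of continuous functions, which can be chosen
  to be bounded by \<open>1\<close>; in the limit the integral of \<open>cmod f\<close> vanishes.\<close>

lemma null_if_orthogonal_to_continuous:
  fixes f :: "complex \<Rightarrow> complex"
  assumes f: "integrable dA f"
    and orth: "\<And>q. continuous_on UNIV q \<Longrightarrow> (LINT z|dA. f z * q z) = 0"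
  shows "AE z in dA. f z = 0"
proof -
  define h where "h z = cnj (sgn (f z))" for z
  have "h \<in> borel_measurable dA"
    unfolding h_def[abs_def] using f by (intro borel_measurable_cnj) (auto intro: borel_measurable_sgn)
  then have "h \<in> borel_measurable (lebesgue_on disk)" by (simp add: measurable_cong_sets[OF sets_dA refl])
  then have "h measurable_on disk" by (subst measurable_on_iff_borel_measurable) auto
  then obtain N q where N: "negligible N" and q: "\<And>n. continuous_on UNIV (q n)"
    and lim: "\<And>x. x \<notin> N \<Longrightarrow> (\<lambda>n. q n x) \<longlonglongrightarrow> (if x \<in> disk then h x else 0)"
    unfolding measurable_on_def by blast
  have AEN: "AE z in dA. z \<notin> N"
  proof (rule AE_I)
    have Ns: "N \<inter> disk \<in> sets dA"
      using negligible_imp_sets[OF N] by (auto simp: sets_dA sets_restrict_space)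
    show "{z \<in> space dA. \<not> z \<notin> N} \<subseteq> N \<inter> disk" "N \<inter> disk \<in> sets dA" using Ns by auto
    have "emeasure lebesgue (N \<inter> disk) = 0"
      using N by (meson emeasure_eq_0 inf_le1 negligible_iff_null_sets null_setsD1 null_setsD2)
    then show "emeasure dA (N \<inter> disk) = 0" using Ns by (simp add: emeasure_dA)
  qed
  \<comment> \<open>Radial retraction onto the closed unit disk, which fixes the limit \<open>h\<close>.\<close>
  define c where "c n z = q n z / complex_of_real (max 1 (cmod (q n z)))" for n z
  have c_cont: "continuous_on UNIV (c n)" for n
    unfolding c_def[abs_def] by (intro continuous_intros q) (auto simp: max_def)
  have c_le: "cmod (c n z) \<le> 1" for n z
    by (simp add: c_def norm_divide divide_le_eq)
  have c_lim: "(\<lambda>n. c n z) \<longlonglongrightarrow> h z" if "z \<notin> N" "z \<in> disk" for z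
  proof -
    have "(\<lambda>n. q n z) \<longlonglongrightarrow> h z" using lim[OF that(1)] that(2) by simp
    then have "(\<lambda>n. c n z) \<longlonglongrightarrow> h z / complex_of_real (max 1 (cmod (h z)))"
      unfolding c_def by (intro tendsto_intros) (auto simp: max_def)
    moreover have "cmod (h z) \<le> 1" by (simp add: h_def norm_sgn)
    ultimately show ?thesis by (simp add: max_def split: if_splits)
  qed
  have "(\<lambda>n. LINT z|dA. f z * c n z) \<longlonglongrightarrow> (LINT z|dA. f z * h z)"
  proof (rule integral_dominated_convergence[where w = "\<lambda>z. cmod (f z)"])
    show "(\<lambda>z. f z * h z) \<in> borel_measurable dA" using f \<open>h \<in> borel_measurable dA\<close> by auto
    show "(\<lambda>z. f z * c n z) \<in> borel_measurable dA" for n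
      using f measurable_dA_borelI[OF borel_measurable_continuous_onI[OF c_cont]] by (intro borel_measurable_times) auto
    show "integrable dA (\<lambda>z. cmod (f z))" using f by simp
    show "AE z in dA. (\<lambda>n. f z * c n z) \<longlonglongrightarrow> f z * h z"
      using AEN AE_dA_disk by eventually_elim (intro tendsto_mult tendsto_const c_lim)
    show "AE z in dA. cmod (f z * c n z) \<le> cmod (f z)" for n
      by (rule AE_I2) (simp add: norm_mult mult_left_le c_le)
  qed
  then have "(LINT z|dA. f z * h z) = 0"
    using orth[OF c_cont] by (simp add: LIMSEQ_const_iff)
  moreover have "f z * h z = complex_of_real (cmod (f z))" for z
  proof (cases "f z = 0")
    case False
    have "f z * cnj (f z) = complex_of_real (cmod (f z) * cmod (f z))"
      using complex_norm_square[of "f z"] by (simp add: power2_eq_square)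
    then show ?thesis using False by (simp add: h_def sgn_eq)
  qed (simp add: h_def)
  ultimately have "(LINT z|dA. complex_of_real (cmod (f z))) = 0" by simp
  then have "(LINT z|dA. cmod (f z)) = 0" by (simp only: integral_complex_of_real of_real_eq_0_iff)
  then have "AE z in dA. cmod (f z) = 0"
    using f by (subst (asm) integral_nonneg_eq_0_iff_AE) auto
  then show ?thesis by simp
qed

text \<open>The Weierstrass approximation theorem on the closed disk reduces continuous test functions to
  polynomials. The argument stays on the disk because \<open>g\<close> is known to be measurable only after
  composition with \<open>cmod\<close>.\<close>

theorem radial_null_if_even_moments_vanish:
  fixes g :: "real \<Rightarrow> complex"
  assumes f: "integrable dA (\<lambda>z. g (cmod z))"
    and mom: "\<And>j :: nat. (LINT z|dA. g (cmod z) * complex_of_real (cmod z ^ (2 * j))) = 0"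
  shows "AE z in dA. g (cmod z) = 0"
proof (rule null_if_orthogonal_to_continuous[OF f])
  fix q :: "complex \<Rightarrow> complex" assume q: "continuous_on UNIV q"
  let ?f = "\<lambda>z. g (cmod z)"
  have "cmod (LINT z|dA. ?f z * q z) \<le> 0"
  proof (rule field_le_epsilon)
    fix e :: real assume e: "e > 0"
    define A where "A = (LINT z|dA. cmod (?f z))"
    have A: "A \<ge> 0" unfolding A_def by (intro integral_nonneg_AE) auto
    have "\<exists>p. polynomial_function p \<and> (\<forall>z\<in>cball (0::complex) 1. norm (q z - p z) < e / (A + 1))"
      using q e A by (intro Stone_Weierstrass_polynomial_function) (auto intro: continuous_on_subset)
    then obtain p where p: "polynomial_function p" "\<And>z. z \<in> cball 0 1 \<Longrightarrow> cmod (q z - p z) < e / (A + 1)" by blast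
    have bp: "bipoly p" by (rule bipoly_of_polynomial[OF p(1)])
    have qm: "q \<in> borel_measurable dA" by (rule measurable_dA_borelI[OF borel_measurable_continuous_onI[OF q]])
    have dle: "cmod (q z - p z) \<le> e / (A + 1)" if "z \<in> disk" for z using p(2)[of z] that by simp
    have id: "integrable dA (\<lambda>z. ?f z * (q z - p z))"
      using integrable_dA_mult_bounded[OF f, of "\<lambda>z. q z - p z" "e / (A + 1)"] qm bipoly_measurable[OF bp] dle
      by (simp add: mult.commute)
    have ip: "integrable dA (\<lambda>z. ?f z * p z)" by (rule integrable_mult_bipoly[OF f bp])
    have "(LINT z|dA. ?f z * q z) = (LINT z|dA. ?f z * (q z - p z) + ?f z * p z)"
      by (simp add: algebra_simps)
    also have "\<dots> = (LINT z|dA. ?f z * (q z - p z))"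
      using id ip bipoly_orthogonal_radial[OF f mom bp] by simp
    finally have "cmod (LINT z|dA. ?f z * q z) = cmod (LINT z|dA. ?f z * (q z - p z))" by simp
    also have "\<dots> \<le> (LINT z|dA. cmod (?f z * (q z - p z)))" by (rule integral_norm_bound)
    also have "\<dots> \<le> (LINT z|dA. cmod (?f z) * (e / (A + 1)))"
    proof (rule integral_mono)
      show "integrable dA (\<lambda>z. cmod (?f z * (q z - p z)))" using id by (rule integrable_norm)
      show "integrable dA (\<lambda>z. cmod (?f z) * (e / (A + 1)))" using f by (intro integrable_mult_left integrable_norm)
      show "cmod (?f z * (q z - p z)) \<le> cmod (?f z) * (e / (A + 1))" if "z \<in> space dA" for z
        unfolding norm_mult using dle that by (intro mult_left_mono) auto
    qed
    also have "\<dots> = A * (e / (A + 1))" unfolding A_def by (rule integral_mult_left_zero)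
    also have "\<dots> \<le> 0 + e" using A e by (simp add: field_simps)
    finally show "cmod (LINT z|dA. ?f z * q z) \<le> 0 + e" .
  qed
  then show "(LINT z|dA. ?f z * q z) = 0" by simp
qed

section \<open>Functions of the exponent that are dominated by powers\<close>

text \<open>The map \<open>x powr \<sigma> \<mapsto> E \<sigma>\<close>, extended linearly, is bounded for the supremum norm on the open unit
  interval. Only differences between a multiple of one power and a polynomial are needed, which keeps
  the definition within finite sums; the coefficient \<open>b\<close> makes it stable under division by an affine
  function of \<open>\<sigma>\<close>.\<close>

definition power_dominated :: "(real \<Rightarrow> complex) \<Rightarrow> bool"
  where "power_dominated E \<longleftrightarrow> (\<exists>K. \<forall>b \<sigma> a n e. \<sigma> \<ge> 0 \<longrightarrow>
     (\<forall>x. 0 < x \<longrightarrow> x < 1 \<longrightarrow> \<bar>b * x powr \<sigma> - (\<Sum>i\<le>n. a i * x ^ i)\<bar> \<le> e) \<longrightarrow>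
     cmod (complex_of_real b * E \<sigma> - (\<Sum>i\<le>n. complex_of_real (a i) * E (real i))) \<le> K * e)"

text \<open>By Weierstrass, \<open>x powr \<sigma>\<close> is a uniform limit of polynomials on the unit interval. This takes the place
  of the uniqueness theorems for holomorphic functions on a half plane that vanish along an arithmetic
  progression.\<close>

lemma power_dominated_eq_0:
  assumes E: "power_dominated E" and nat: "\<And>i :: nat. E (real i) = 0" and s: "\<sigma> \<ge> 0"
  shows "E \<sigma> = 0"
proof (cases "\<sigma> = 0")
  case True then show ?thesis using nat[of 0] by simp
next
  case False
  then have s: "\<sigma> > 0" using s by simp
  obtain K where K: "\<And>b \<sigma> a n e. \<sigma> \<ge> 0 \<Longrightarrow> (\<And>x. 0 < x \<Longrightarrow> x < 1 \<Longrightarrow> \<bar>b * x powr \<sigma> - (\<Sum>i\<le>n. a i * x ^ i)\<bar> \<le> e)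
      \<Longrightarrow> cmod (complex_of_real b * E \<sigma> - (\<Sum>i\<le>n. complex_of_real (a i) * E (real i))) \<le> K * e"
    using E unfolding power_dominated_def by blast
  have "cmod (E \<sigma>) \<le> 0"
  proof (rule field_le_epsilon)
    fix e :: real assume e: "e > 0"
    define e' where "e' = e / (\<bar>K\<bar> + 1)"
    have e': "e' > 0" using e by (simp add: e'_def)
    have "continuous_on {0..1} (\<lambda>x::real. x powr \<sigma>)"
      using s by (intro continuous_on_powr' continuous_intros) auto
    then obtain g where g: "real_polynomial_function g" "\<And>x. x \<in> {0..1} \<Longrightarrow> \<bar>x powr \<sigma> - g x\<bar> < e'"
      using Stone_Weierstrass_real_polynomial_function[of "{0..1::real}" "\<lambda>x. x powr \<sigma>" e'] e' by auto
    obtain a n where ga: "g = (\<lambda>x. \<Sum>i\<le>n. a i * x ^ i)" using g(1) unfolding real_polynomial_function_iff_sum by blast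
    have "cmod (complex_of_real 1 * E \<sigma> - (\<Sum>i\<le>n. complex_of_real (a i) * E (real i))) \<le> K * e'"
    proof (rule K)
      fix x :: real assume "0 < x" "x < 1"
      then show "\<bar>1 * x powr \<sigma> - (\<Sum>i\<le>n. a i * x ^ i)\<bar> \<le> e'" using g(2)[of x] by (simp add: ga)
    qed (use s in simp)
    then have "cmod (E \<sigma>) \<le> K * e'" by (simp add: nat)
    also have "\<dots> \<le> \<bar>K\<bar> * e'" using e' by (intro mult_right_mono) auto
    also have "\<dots> \<le> e" using e by (simp add: e'_def field_simps)
    finally show "cmod (E \<sigma>) \<le> 0 + e" by simp
  qed
  then show ?thesis by simp
qed

lemma power_dominated_diff:
  assumes "power_dominated E" "power_dominated F" shows "power_dominated (\<lambda>\<sigma>. E \<sigma> - F \<sigma>)"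
proof -
  obtain K where K: "\<And>b \<sigma> a n e. \<sigma> \<ge> 0 \<Longrightarrow> (\<And>x. 0 < x \<Longrightarrow> x < 1 \<Longrightarrow> \<bar>b * x powr \<sigma> - (\<Sum>i\<le>n. a i * x ^ i)\<bar> \<le> e)
      \<Longrightarrow> cmod (complex_of_real b * E \<sigma> - (\<Sum>i\<le>n. complex_of_real (a i) * E (real i))) \<le> K * e"
    using assms(1) unfolding power_dominated_def by blast
  obtain L where L: "\<And>b \<sigma> a n e. \<sigma> \<ge> 0 \<Longrightarrow> (\<And>x. 0 < x \<Longrightarrow> x < 1 \<Longrightarrow> \<bar>b * x powr \<sigma> - (\<Sum>i\<le>n. a i * x ^ i)\<bar> \<le> e)
      \<Longrightarrow> cmod (complex_of_real b * F \<sigma> - (\<Sum>i\<le>n. complex_of_real (a i) * F (real i))) \<le> L * e"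
    using assms(2) unfolding power_dominated_def by blast
  show ?thesis
    unfolding power_dominated_def
  proof (intro exI[of _ "K + L"] allI impI)
    fix b \<sigma> :: real and a :: "nat \<Rightarrow> real" and n :: nat and e :: real
    assume s: "0 \<le> \<sigma>" and h: "\<forall>x. 0 < x \<longrightarrow> x < 1 \<longrightarrow> \<bar>b * x powr \<sigma> - (\<Sum>i\<le>n. a i * x ^ i)\<bar> \<le> e"
    let ?P = "\<lambda>E. complex_of_real b * E \<sigma> - (\<Sum>i\<le>n. complex_of_real (a i) * E (real i))"
    have "?P (\<lambda>\<sigma>. E \<sigma> - F \<sigma>) = ?P E - ?P F" by (simp add: algebra_simps sum_subtractf)
    also have "cmod \<dots> \<le> cmod (?P E) + cmod (?P F)" by (rule norm_triangle_ineq4)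
    also have "\<dots> \<le> K * e + L * e" using h by (intro add_mono K L s) auto
    finally show "cmod (?P (\<lambda>\<sigma>. E \<sigma> - F \<sigma>)) \<le> (K + L) * e" by (simp add: distrib_right)
  qed
qed

lemma integrable_mult_cmod_powr:
  fixes f :: "complex \<Rightarrow> complex"
  assumes f: "integrable dA f" and s: "s \<ge> 0"
  shows "integrable dA (\<lambda>z. f z * complex_of_real (cmod z powr s))"
proof -
  have "cmod (complex_of_real (cmod z powr s)) \<le> 1" if "z \<in> disk" for z
    using that s powr_mono2[of s "cmod z" 1] by simp
  then show ?thesis
    using integrable_dA_mult_bounded[OF f, of "\<lambda>z. complex_of_real (cmod z powr s)" 1]
    by (simp add: mult.commute measurable_dA_borelI)
qed

lemma power_dominated_moments:
  fixes f :: "complex \<Rightarrow> complex"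
  assumes f: "integrable dA f" and c: "c > 0"
  shows "power_dominated (\<lambda>\<sigma>. LINT z|dA. f z * complex_of_real (cmod z powr (c * \<sigma>)))"
  unfolding power_dominated_def
proof (intro exI[of _ "LINT z|dA. cmod (f z)"] allI impI)
  fix b \<sigma> :: real and a :: "nat \<Rightarrow> real" and n :: nat and e :: real
    assume s: "0 \<le> \<sigma>" and h: "\<forall>x. 0 < x \<longrightarrow> x < 1 \<longrightarrow> \<bar>b * x powr \<sigma> - (\<Sum>i\<le>n. a i * x ^ i)\<bar> \<le> e"
  define r where "r z = b * cmod z powr (c * \<sigma>) - (\<Sum>i\<le>n. a i * cmod z powr (c * real i))" for z
  have r: "\<bar>r z\<bar> \<le> e" if "z \<in> disk" "z \<noteq> 0" for z
  proof -
    define x where "x = cmod z powr c"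
    have x: "0 < x" "x < 1" using that c powr_less_mono2[of c "cmod z" 1] by (auto simp: x_def)
    have "r z = b * x powr \<sigma> - (\<Sum>i\<le>n. a i * x ^ i)"
      using x(1) by (simp add: r_def x_def powr_powr powr_realpow[symmetric])
    then show ?thesis using h x by simp
  qed
  have int: "integrable dA (\<lambda>z. f z * complex_of_real (cmod z powr (c * s)))" if "s \<ge> 0" for s
    using that c by (intro integrable_mult_cmod_powr[OF f]) auto
  let ?E = "\<lambda>\<sigma>. LINT z|dA. f z * complex_of_real (cmod z powr (c * \<sigma>))"
  have eqf: "f z * complex_of_real (r z) = complex_of_real b * (f z * complex_of_real (cmod z powr (c * \<sigma>)))
       - (\<Sum>i\<le>n. complex_of_real (a i) * (f z * complex_of_real (cmod z powr (c * real i))))" for z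
    by (simp add: r_def right_diff_distrib sum_distrib_left mult_ac)
  have "complex_of_real b * ?E \<sigma> - (\<Sum>i\<le>n. complex_of_real (a i) * ?E (real i)) = (LINT z|dA. f z * complex_of_real (r z))"
    unfolding eqf using int s by (simp add: integral_sum)
  moreover have ir: "integrable dA (\<lambda>z. f z * complex_of_real (r z))"
    unfolding eqf using int s by (intro Bochner_Integration.integrable_diff Bochner_Integration.integrable_sum integrable_mult_right) auto
  ultimately have "cmod (complex_of_real b * ?E \<sigma> - (\<Sum>i\<le>n. complex_of_real (a i) * ?E (real i)))
      \<le> (LINT z|dA. cmod (f z * complex_of_real (r z)))"
    using integral_norm_bound by simp
  also have "\<dots> \<le> (LINT z|dA. cmod (f z) * e)"
  proof (rule integral_mono_AE)
    show "integrable dA (\<lambda>z. cmod (f z * complex_of_real (r z)))" using ir by (rule integrable_norm)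
    show "integrable dA (\<lambda>z. cmod (f z) * e)" using f by (intro integrable_mult_left integrable_norm)
    show "AE z in dA. cmod (f z * complex_of_real (r z)) \<le> cmod (f z) * e"
      using AE_dA_disk AE_dA_nonzero
    proof eventually_elim
      case (elim z)
      then show ?case using r[of z] by (simp add: norm_mult mult_left_mono)
    qed
  qed
  also have "\<dots> = (LINT z|dA. cmod (f z)) * e" by (rule integral_mult_left_zero)
  finally show "cmod (complex_of_real b * ?E \<sigma> - (\<Sum>i\<le>n. complex_of_real (a i) * ?E (real i))) \<le> (LINT z|dA. cmod (f z)) * e" .
qed

text \<open>Since \<open>2 / (2 \<sigma> + c)\<close> is the integral of \<open>cmod w powr (2 \<sigma> + c - 2)\<close>, division by \<open>2 \<sigma> + c\<close> averages
  the approximation error over the scaled arguments \<open>x * (cmod w)\<^sup>2\<close>.\<close>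

lemma power_dominated_divide:
  assumes E: "power_dominated E" and c: "c > 0"
  shows "power_dominated (\<lambda>\<sigma>. E \<sigma> / complex_of_real (2 * \<sigma> + c))"
proof -
  obtain K where K: "\<And>b \<sigma> a n e. \<sigma> \<ge> 0 \<Longrightarrow> (\<And>x. 0 < x \<Longrightarrow> x < 1 \<Longrightarrow> \<bar>b * x powr \<sigma> - (\<Sum>i\<le>n. a i * x ^ i)\<bar> \<le> e)
      \<Longrightarrow> cmod (complex_of_real b * E \<sigma> - (\<Sum>i\<le>n. complex_of_real (a i) * E (real i))) \<le> K * e"
    using E unfolding power_dominated_def by blast
  show ?thesis
    unfolding power_dominated_def
  proof (intro exI[of _ "K / c"] allI impI)
    fix b \<sigma> :: real and a :: "nat \<Rightarrow> real" and n :: nat and e :: real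
    assume s: "0 \<le> \<sigma>" and h: "\<forall>x. 0 < x \<longrightarrow> x < 1 \<longrightarrow> \<bar>b * x powr \<sigma> - (\<Sum>i\<le>n. a i * x ^ i)\<bar> \<le> e"
    have hb: "has_bochner_integral dA (\<lambda>w. cmod w powr (2 * \<tau> + c - 2)) (2 / (2 * \<tau> + c))" if "\<tau> \<ge> 0" for \<tau>
      using has_bochner_integral_cmod_powr[of "2 * \<tau> + c - 2"] that c by simp
    have bound: "\<bar>(b / (2 * \<sigma> + c)) * x powr \<sigma> - (\<Sum>i\<le>n. (a i / (2 * real i + c)) * x ^ i)\<bar> \<le> e / c"
      if x: "0 < x" "x < 1" for x
    proof -
      define q where "q w = b * (x * (cmod w)\<^sup>2) powr \<sigma> - (\<Sum>i\<le>n. a i * (x * (cmod w)\<^sup>2) ^ i)" for w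
      have "has_bochner_integral dA (\<lambda>w. (b * x powr \<sigma>) * cmod w powr (2 * \<sigma> + c - 2)
          - (\<Sum>i\<le>n. (a i * x ^ i) * cmod w powr (2 * real i + c - 2)))
          ((b * x powr \<sigma>) * (2 / (2 * \<sigma> + c)) - (\<Sum>i\<le>n. (a i * x ^ i) * (2 / (2 * real i + c))))"
        using s by (intro has_bochner_integral_diff has_bochner_integral_sum has_bochner_integral_mult_right hb) auto
      then have I: "integrable dA (\<lambda>w. (b * x powr \<sigma>) * cmod w powr (2 * \<sigma> + c - 2)
          - (\<Sum>i\<le>n. (a i * x ^ i) * cmod w powr (2 * real i + c - 2)))"
        "(LINT w|dA. (b * x powr \<sigma>) * cmod w powr (2 * \<sigma> + c - 2)
          - (\<Sum>i\<le>n. (a i * x ^ i) * cmod w powr (2 * real i + c - 2)))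
         = 2 * ((b / (2 * \<sigma> + c)) * x powr \<sigma> - (\<Sum>i\<le>n. (a i / (2 * real i + c)) * x ^ i))"
        by (auto simp: has_bochner_integral_iff right_diff_distrib sum_distrib_left mult_ac)
      have "\<bar>LINT w|dA. (b * x powr \<sigma>) * cmod w powr (2 * \<sigma> + c - 2)
          - (\<Sum>i\<le>n. (a i * x ^ i) * cmod w powr (2 * real i + c - 2))\<bar>
          \<le> (LINT w|dA. \<bar>(b * x powr \<sigma>) * cmod w powr (2 * \<sigma> + c - 2)
          - (\<Sum>i\<le>n. (a i * x ^ i) * cmod w powr (2 * real i + c - 2))\<bar>)"
        by (rule integral_abs_bound)
      also have "\<dots> \<le> (LINT w|dA. e * cmod w powr (c - 2))"
      proof (rule integral_mono_AE)
        show "integrable dA (\<lambda>w. \<bar>(b * x powr \<sigma>) * cmod w powr (2 * \<sigma> + c - 2)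
          - (\<Sum>i\<le>n. (a i * x ^ i) * cmod w powr (2 * real i + c - 2))\<bar>)"
          by (rule integrable_abs[OF I(1)])
        show "integrable dA (\<lambda>w. e * cmod w powr (c - 2))"
          using hb[of 0] by (intro integrable_mult_right) (auto simp: has_bochner_integral_iff)
        show "AE w in dA. \<bar>(b * x powr \<sigma>) * cmod w powr (2 * \<sigma> + c - 2)
          - (\<Sum>i\<le>n. (a i * x ^ i) * cmod w powr (2 * real i + c - 2))\<bar> \<le> e * cmod w powr (c - 2)"
          using AE_dA_disk AE_dA_nonzero
        proof eventually_elim
          case (elim w)
          define r where "r = cmod w"
          have r: "0 < r" "r < 1" using elim by (auto simp: r_def)
          have pw: "r powr (2 * \<tau> + c - 2) = r powr (c - 2) * (r\<^sup>2) powr \<tau>" for \<tau>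
          proof -
            have "(r\<^sup>2) powr \<tau> = r powr (2 * \<tau>)" using r by (simp add: powr_powr powr_numeral[symmetric] del: powr_numeral)
            then show ?thesis by (simp add: powr_add[symmetric] algebra_simps)
          qed
          have pn: "r powr (2 * real i + c - 2) = r powr (c - 2) * (r\<^sup>2) ^ i" for i
            unfolding pw using r by (simp add: powr_realpow)
          have "x * r\<^sup>2 < 1 * 1" using x r by (intro mult_strict_mono) (auto simp: power_less_one_iff)
          then have y: "0 < x * r\<^sup>2" "x * r\<^sup>2 < 1" using x r by auto
          have "(b * x powr \<sigma>) * r powr (2 * \<sigma> + c - 2) - (\<Sum>i\<le>n. (a i * x ^ i) * r powr (2 * real i + c - 2))
              = r powr (c - 2) * (b * (x * r\<^sup>2) powr \<sigma> - (\<Sum>i\<le>n. a i * (x * r\<^sup>2) ^ i))"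
            unfolding pn unfolding pw using x
            by (simp add: powr_mult power_mult_distrib right_diff_distrib sum_distrib_left mult_ac)
          also have "\<bar>\<dots>\<bar> = r powr (c - 2) * \<bar>b * (x * r\<^sup>2) powr \<sigma> - (\<Sum>i\<le>n. a i * (x * r\<^sup>2) ^ i)\<bar>"
            by (simp add: abs_mult)
          also have "\<dots> \<le> r powr (c - 2) * e" using h y by (intro mult_left_mono) auto
          finally show ?case by (simp add: r_def mult.commute)
        qed
      qed
      also have "\<dots> = e * (2 / c)" using hb[of 0] by (simp add: has_bochner_integral_iff)
      finally have "\<bar>2 * (b / (2 * \<sigma> + c) * x powr \<sigma> - (\<Sum>i\<le>n. a i / (2 * real i + c) * x ^ i))\<bar> \<le> e * (2 / c)"
        unfolding I(2) .
      then have "2 * \<bar>b / (2 * \<sigma> + c) * x powr \<sigma> - (\<Sum>i\<le>n. a i / (2 * real i + c) * x ^ i)\<bar> \<le> 2 * (e / c)"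
        by (simp only: abs_mult) (simp add: mult.commute)
      then show ?thesis by (rule mult_left_le_imp_le) simp
    qed
    have "cmod (complex_of_real (b / (2 * \<sigma> + c)) * E \<sigma> - (\<Sum>i\<le>n. complex_of_real (a i / (2 * real i + c)) * E (real i))) \<le> K * (e / c)"
      by (rule K[OF s bound])
    then show "cmod (complex_of_real b * (E \<sigma> / complex_of_real (2 * \<sigma> + c))
        - (\<Sum>i\<le>n. complex_of_real (a i) * (E (real i) / complex_of_real (2 * real i + c)))) \<le> K / c * e"
      by simp
  qed
qed

section \<open>Recurrences for moments\<close>

text \<open>Up to a factor \<open>2\<close> and a shift of the argument, the Mellin transform of \<open>\<phi>\<close> on the unit interval.\<close>

definition moment :: "(real \<Rightarrow> complex) \<Rightarrow> real \<Rightarrow> complex"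
  where "moment \<phi> s = (LINT z|dA. \<phi> (cmod z) * complex_of_real (cmod z powr s))"

text \<open>Dividing the recurrence by both linear factors turns it into the vanishing of a difference of two
  functions that are dominated by powers; from an arithmetic progression of arguments this extends to
  all real arguments.\<close>

lemma moment_recurrence_extends:
  assumes \<phi>: "integrable dA (\<lambda>z. \<phi> (cmod z))"
    and s: "s \<ge> 0" "s + a > 0" and d: "d > 0"
    and rec: "\<And>n :: nat. complex_of_real (s + 2 * real n + a) * moment \<phi> (s + 2 * real n) =
      complex_of_real (s + 2 * real n + a + d) * moment \<phi> (s + 2 * real n + d)"
    and t: "t \<ge> s"
  shows "complex_of_real (t + a) * moment \<phi> t = complex_of_real (t + a + d) * moment \<phi> (t + d)"
proof -
  have pd: "power_dominated (\<lambda>\<tau>. moment \<phi> (s + h + 2 * \<tau>))" if h: "h \<ge> 0" for h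
  proof -
    have "power_dominated (\<lambda>\<tau>. LINT z|dA. (\<phi> (cmod z) * complex_of_real (cmod z powr (s + h))) * complex_of_real (cmod z powr (2 * \<tau>)))"
      using s h by (intro power_dominated_moments integrable_mult_cmod_powr[OF \<phi>]) auto
    then show ?thesis by (simp add: moment_def powr_add mult.assoc)
  qed
  define E where "E \<tau> = moment \<phi> (s + 0 + 2 * \<tau>) / complex_of_real (2 * \<tau> + (s + a + d))
      - moment \<phi> (s + d + 2 * \<tau>) / complex_of_real (2 * \<tau> + (s + a))" for \<tau>
  have pdE: "power_dominated E"
    unfolding E_def using s d by (intro power_dominated_diff power_dominated_divide pd) auto
  have Eiff: "E \<tau> = 0 \<longleftrightarrow> complex_of_real (s + 2 * \<tau> + a) * moment \<phi> (s + 2 * \<tau>)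
      = complex_of_real (s + 2 * \<tau> + a + d) * moment \<phi> (s + 2 * \<tau> + d)" if "\<tau> \<ge> 0" for \<tau>
  proof -
    have nz: "complex_of_real (2 * \<tau> + (s + a + d)) \<noteq> 0" "complex_of_real (2 * \<tau> + (s + a)) \<noteq> 0"
      using that s d by (simp_all only: of_real_eq_0_iff)
    have "E \<tau> = 0 \<longleftrightarrow> moment \<phi> (s + 2 * \<tau>) / complex_of_real (2 * \<tau> + (s + a + d))
        = moment \<phi> (s + 2 * \<tau> + d) / complex_of_real (2 * \<tau> + (s + a))"
      by (simp add: E_def add_ac)
    also have "\<dots> \<longleftrightarrow> moment \<phi> (s + 2 * \<tau>) * complex_of_real (2 * \<tau> + (s + a))
        = moment \<phi> (s + 2 * \<tau> + d) * complex_of_real (2 * \<tau> + (s + a + d))"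
      using nz by (rule frac_eq_eq)
    finally show ?thesis by (simp add: add_ac mult.commute)
  qed
  have "E (real n) = 0" for n :: nat
    using Eiff[of "real n"] rec[of n] by simp
  then have "E ((t - s) / 2) = 0"
    by (rule power_dominated_eq_0[OF pdE]) (use t in simp)
  moreover have "s + 2 * ((t - s) / 2) = t" "(t - s) / 2 \<ge> 0" using t by (auto simp: field_simps)
  ultimately show ?thesis using Eiff[of "(t - s) / 2"] by (simp only: simp_thms)
qed

lemma moment_power:
  "b + s > -2 \<Longrightarrow> moment (\<lambda>r. complex_of_real (r powr b)) s = 2 / complex_of_real (b + s + 2)"
proof -
  assume b: "b + s > -2"
  have "moment (\<lambda>r. complex_of_real (r powr b)) s = (LINT z|dA. complex_of_real (cmod z powr (b + s)))"
    by (simp add: moment_def powr_add)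
  also have "\<dots> = complex_of_real (2 / (b + s + 2))"
    using has_bochner_integral_cmod_powr[OF b] by (simp add: has_bochner_integral_iff)
  finally show ?thesis by simp
qed

text \<open>The right-hand side has the same moments as \<open>\<phi>\<close> along an arithmetic progression of step \<open>d\<close>. The factor
  \<open>r powr s\<close> makes both sides integrable; the difference then has vanishing moments of every order.\<close>

lemma radial_eq_power_if_moments:
  assumes \<phi>: "integrable dA (\<lambda>z. \<phi> (cmod z))"
    and s: "s \<ge> 0" "s + a > 0" and d: "d > 0"
    and mom: "\<And>n :: nat. complex_of_real (s + real n * d + a) * moment \<phi> (s + real n * d) = L"
  shows "AE z in dA. \<phi> (cmod z) = L / 2 * complex_of_real (cmod z powr (a - 2))"
proof -
  define g where "g r = \<phi> r * complex_of_real (r powr s) - L / 2 * complex_of_real (r powr (a - 2 + s))" for r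
  have ip: "integrable dA (\<lambda>z. complex_of_real (cmod z powr b))" if "b > -2" for b
    using has_bochner_integral_cmod_powr[OF that] by (simp add: has_bochner_integral_iff)
  have ig: "integrable dA (\<lambda>z. g (cmod z))"
    unfolding g_def using integrable_mult_cmod_powr[OF \<phi> s(1)] ip[of "a - 2 + s"] s(2) by simp
  define E where "E \<tau> = (LINT z|dA. g (cmod z) * complex_of_real (cmod z powr (d * \<tau>)))" for \<tau>
  have "power_dominated E" unfolding E_def by (rule power_dominated_moments[OF ig d])
  moreover have "E (real n) = 0" for n :: nat
  proof -
    have nd: "0 \<le> d * real n" using d by simp
    have i1: "integrable dA (\<lambda>z. \<phi> (cmod z) * complex_of_real (cmod z powr (s + real n * d)))"
      using s nd by (intro integrable_mult_cmod_powr[OF \<phi>]) (simp add: mult.commute)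
    have pos: "a - 2 + (s + real n * d) > -2" using s nd by (simp add: mult.commute)
    have i2: "integrable dA (\<lambda>z. L / 2 * complex_of_real (cmod z powr (a - 2 + (s + real n * d))))"
      by (intro integrable_mult_right ip pos)
    have "E (real n) = (LINT z|dA. \<phi> (cmod z) * complex_of_real (cmod z powr (s + real n * d))
        - L / 2 * complex_of_real (cmod z powr (a - 2 + (s + real n * d))))"
      unfolding E_def g_def
      by (intro Bochner_Integration.integral_cong refl)
         (simp only: powr_add of_real_mult left_diff_distrib mult.commute[of d] mult.assoc)
    also have "\<dots> = moment \<phi> (s + real n * d) - L / 2 * (LINT z|dA. complex_of_real (cmod z powr (a - 2 + (s + real n * d))))"
      using i1 i2 by (simp add: moment_def)
    also have "(LINT z|dA. complex_of_real (cmod z powr (a - 2 + (s + real n * d)))) = 2 / complex_of_real (s + real n * d + a)"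
      using has_bochner_integral_cmod_powr[OF pos] by (simp add: has_bochner_integral_iff add_ac)
    also have "moment \<phi> (s + real n * d) - L / 2 * (2 / complex_of_real (s + real n * d + a)) = 0"
    proof -
      have "complex_of_real (s + real n * d + a) \<noteq> 0" using pos by (simp only: of_real_eq_0_iff)
      then show ?thesis using mom[of n] by (simp add: eq_divide_eq mult.commute)
    qed
    finally show ?thesis .
  qed
  ultimately have E0: "E \<tau> = 0" if "\<tau> \<ge> 0" for \<tau> using power_dominated_eq_0 that by blast
  have "AE z in dA. g (cmod z) = 0"
  proof (rule radial_null_if_even_moments_vanish[OF ig])
    fix j :: nat
    have "(LINT z|dA. g (cmod z) * complex_of_real (cmod z ^ (2 * j))) = E (real (2 * j) / d)"
      unfolding E_def
    proof (rule integral_cong_AE)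
      have "g \<circ> cmod \<in> borel_measurable dA" using ig by (simp add: o_def borel_measurable_integrable)
      then have m: "(\<lambda>z. g (cmod z)) \<in> borel_measurable dA" by (simp add: o_def)
      show "(\<lambda>z. g (cmod z) * complex_of_real (cmod z ^ (2 * j))) \<in> borel_measurable dA"
        by (intro borel_measurable_times m measurable_dA_borelI) simp
      show "(\<lambda>z. g (cmod z) * complex_of_real (cmod z powr (d * (real (2 * j) / d)))) \<in> borel_measurable dA"
        by (intro borel_measurable_times m measurable_dA_borelI) simp
      show "AE z in dA. g (cmod z) * complex_of_real (cmod z ^ (2 * j)) = g (cmod z) * complex_of_real (cmod z powr (d * (real (2 * j) / d)))"
        using AE_dA_nonzero
      proof eventually_elim
        case (elim z)
        have e: "d * (real (2 * j) / d) = real (2 * j)" using d by simp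
        have "cmod z powr real (2 * j) = cmod z ^ (2 * j)" using elim by (intro powr_realpow) simp
        then show ?case unfolding e by simp
      qed
    qed
    also have "\<dots> = 0" using d by (intro E0) simp
    finally show "(LINT z|dA. g (cmod z) * complex_of_real (cmod z ^ (2 * j))) = 0" .
  qed
  then show ?thesis using AE_dA_nonzero
  proof eventually_elim
    case (elim z)
    have "complex_of_real (cmod z powr s) \<noteq> 0" using elim(2) by simp
    moreover have "(\<phi> (cmod z) - L / 2 * complex_of_real (cmod z powr (a - 2))) * complex_of_real (cmod z powr s) = 0"
      using elim(1) by (simp add: g_def powr_add left_diff_distrib mult.assoc)
    ultimately show ?case by simp
  qed
qed

text \<open>The sequence \<open>s = b + 2 n\<close> runs through the arguments that occur in the weights of Toeplitz
  operators; the relation says that \<open>(s + b + 2) * moment \<phi> s\<close> does not change when \<open>s\<close> is replaced by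
  \<open>s + d\<close>. For \<open>\<phi> r = r powr b\<close> this quantity is constant.\<close>

definition moment_recurrence :: "(real \<Rightarrow> complex) \<Rightarrow> real \<Rightarrow> real \<Rightarrow> bool"
  where "moment_recurrence \<phi> b d \<longleftrightarrow> (\<forall>\<^sub>F n in sequentially.
    complex_of_real (b + 2 * real n + (b + 2)) * moment \<phi> (b + 2 * real n) =
    complex_of_real (b + 2 * real n + (b + 2) + d) * moment \<phi> (b + 2 * real n + d))"

text \<open>Once the recurrence holds for all large real arguments, iterating it with step \<open>d\<close> shows that
  \<open>(s + b + 2) * moment \<phi> s\<close> is constant along a progression, as it is for a multiple of \<open>r powr b\<close>.\<close>

theorem radial_eq_power_if_recurrence:
  assumes \<phi>: "integrable dA (\<lambda>z. \<phi> (cmod z))" and d: "d \<noteq> 0" and "moment_recurrence \<phi> b d"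
  shows "\<exists>C. AE z in dA. \<phi> (cmod z) = C * complex_of_real (cmod z powr b)"
proof -
  \<comment> \<open>The base point \<open>\<kappa>\<close> is separated from the exponent because the case \<open>d < 0\<close> shifts it.\<close>
  define a \<kappa> where "a = b + 2" and "\<kappa> = b"
  have rec: "\<forall>\<^sub>F n in sequentially. complex_of_real (\<kappa> + 2 * real n + a) * moment \<phi> (\<kappa> + 2 * real n) =
      complex_of_real (\<kappa> + 2 * real n + a + d) * moment \<phi> (\<kappa> + 2 * real n + d)"
    using assms(3) by (simp only: moment_recurrence_def a_def \<kappa>_def)
  have pos: ?thesis if d: "d > 0" and rec: "\<forall>\<^sub>F n in sequentially. complex_of_real (\<kappa> + 2 * real n + a) * moment \<phi> (\<kappa> + 2 * real n) =
      complex_of_real (\<kappa> + 2 * real n + a + d) * moment \<phi> (\<kappa> + 2 * real n + d)" for \<kappa> d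
  proof -
    obtain N where N: "\<And>n. n \<ge> N \<Longrightarrow> complex_of_real (\<kappa> + 2 * real n + a) * moment \<phi> (\<kappa> + 2 * real n) =
      complex_of_real (\<kappa> + 2 * real n + a + d) * moment \<phi> (\<kappa> + 2 * real n + d)"
      using rec unfolding eventually_sequentially by blast
    define M where "M = max N (nat \<lceil>\<bar>\<kappa>\<bar> + \<bar>a\<bar> + 1\<rceil>)"
    have M: "M \<ge> N" "real M \<ge> \<bar>\<kappa>\<bar> + \<bar>a\<bar> + 1" unfolding M_def by linarith+
    \<comment> \<open>The start is moved so far to the right that all arguments and linear factors are positive.\<close>
    define s where "s = \<kappa> + 2 * real M"
    have s: "s \<ge> 0" "s + a > 0" using M(2) unfolding s_def by linarith+
    have recs: "complex_of_real (s + 2 * real n + a) * moment \<phi> (s + 2 * real n) =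
      complex_of_real (s + 2 * real n + a + d) * moment \<phi> (s + 2 * real n + d)" for n :: nat
    proof -
      have e: "s + 2 * real n = \<kappa> + 2 * real (M + n)" by (simp add: s_def)
      show ?thesis unfolding e by (rule N) (use M(1) in simp)
    qed
    define L where "L = complex_of_real (s + a) * moment \<phi> s"
    have "complex_of_real (s + real n * d + a) * moment \<phi> (s + real n * d) = L" for n :: nat
    proof (induction n)
      case 0 then show ?case by (simp add: L_def)
    next
      case (Suc n)
      have "s + real n * d \<ge> s" using d by simp
      from moment_recurrence_extends[OF \<phi> s d recs this] Suc.IH
      show ?case by (simp add: algebra_simps)
    qed
    from radial_eq_power_if_moments[OF \<phi> s d this]
    have "AE z in dA. \<phi> (cmod z) = L / 2 * complex_of_real (cmod z powr b)" unfolding a_def by (simp only: add_diff_cancel_right')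
    then show ?thesis by (rule exI)
  qed
  show ?thesis
  proof (cases "d > 0")
    case True then show ?thesis by (rule pos[OF _ rec])
  next
    case False
    then have "- d > 0" using d by simp
    \<comment> \<open>For a negative step the recurrence is read backwards from the shifted starting point.\<close>
    then show ?thesis
    proof (rule pos[where \<kappa> = "\<kappa> + d"])
      show "\<forall>\<^sub>F n in sequentially. complex_of_real (\<kappa> + d + 2 * real n + a) * moment \<phi> (\<kappa> + d + 2 * real n) =
        complex_of_real (\<kappa> + d + 2 * real n + a + - d) * moment \<phi> (\<kappa> + d + 2 * real n + - d)"
        using rec
      proof eventually_elim
        case (elim n)
        have e: "\<kappa> + d + 2 * real n + a + - d = \<kappa> + 2 * real n + a" "\<kappa> + d + 2 * real n + - d = \<kappa> + 2 * real n" by auto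
        show ?case unfolding e using elim[symmetric] by (simp only: add_ac)
      qed
    qed
  qed
qed

lemma tmult_eq_moment:
  assumes m: "integrable dA (\<lambda>z. \<psi> (cmod z))"
  shows "tmult k \<psi> n = complex_of_real (hweight (n + k)) * moment \<psi> (real_of_int (\<bar>n\<bar> + \<bar>n + k\<bar>))"
proof -
  have "(LINT z|dA. \<psi> (cmod z) * complex_of_real (cmod z ^ (nat \<bar>n\<bar> + nat \<bar>n + k\<bar>))) = moment \<psi> (real_of_int (\<bar>n\<bar> + \<bar>n + k\<bar>))"
    unfolding moment_def
  proof (rule integral_cong_AE)
    show "(\<lambda>z. \<psi> (cmod z) * complex_of_real (cmod z ^ (nat \<bar>n\<bar> + nat \<bar>n + k\<bar>))) \<in> borel_measurable dA"
      by (intro borel_measurable_times borel_measurable_integrable[OF m] measurable_dA_borelI) simp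
    show "(\<lambda>z. \<psi> (cmod z) * complex_of_real (cmod z powr (real_of_int (\<bar>n\<bar> + \<bar>n + k\<bar>)))) \<in> borel_measurable dA"
      by (intro borel_measurable_times borel_measurable_integrable[OF m] measurable_dA_borelI) simp
    show "AE z in dA. \<psi> (cmod z) * complex_of_real (cmod z ^ (nat \<bar>n\<bar> + nat \<bar>n + k\<bar>))
        = \<psi> (cmod z) * complex_of_real (cmod z powr (real_of_int (\<bar>n\<bar> + \<bar>n + k\<bar>)))"
      using AE_dA_nonzero
    proof eventually_elim
      case (elim z)
      have e: "real_of_int (\<bar>n\<bar> + \<bar>n + k\<bar>) = real (nat \<bar>n\<bar> + nat \<bar>n + k\<bar>)" by simp
      have "cmod z powr real (nat \<bar>n\<bar> + nat \<bar>n + k\<bar>) = cmod z ^ (nat \<bar>n\<bar> + nat \<bar>n + k\<bar>)"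
        using elim by (intro powr_realpow) simp
      then show ?case unfolding e by simp
    qed
  qed
  then show ?thesis by (simp add: tmult_def)
qed

lemma moment_mult_powr: "moment (\<lambda>r. complex_of_real (r powr m) * \<phi> r) s = moment \<phi> (m + s)"
  by (simp add: moment_def powr_add mult_ac)

lemma moment_cong_AE:
  assumes "integrable dA (\<lambda>z. \<phi> (cmod z))" "integrable dA (\<lambda>z. \<psi> (cmod z))" 
    and "AE z in dA. \<phi> (cmod z) = \<psi> (cmod z)"
  shows "moment \<phi> s = moment \<psi> s"
  unfolding moment_def
proof (rule integral_cong_AE)
  show "(\<lambda>z. \<phi> (cmod z) * complex_of_real (cmod z powr s)) \<in> borel_measurable dA"
    by (intro borel_measurable_times borel_measurable_integrable[OF assms(1)] measurable_dA_borelI) simp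
  show "(\<lambda>z. \<psi> (cmod z) * complex_of_real (cmod z powr s)) \<in> borel_measurable dA"
    by (intro borel_measurable_times borel_measurable_integrable[OF assms(2)] measurable_dA_borelI) simp
  show "AE z in dA. \<phi> (cmod z) * complex_of_real (cmod z powr s) = \<psi> (cmod z) * complex_of_real (cmod z powr s)"
    using assms(3) by eventually_elim simp
qed

text \<open>If the function were integrable for some \<open>b \<le> -2\<close>, its integral would bound \<open>2 / e\<close>, the integral of
  \<open>cmod z powr (e - 2)\<close>, for all positive \<open>e\<close>.\<close>

lemma integrable_cmod_powr_iff:
  "integrable dA (\<lambda>z. complex_of_real (cmod z powr b)) \<longleftrightarrow> b > -2"
proof
  assume "b > -2"
  from has_bochner_integral_cmod_powr[OF this]
  show "integrable dA (\<lambda>z. complex_of_real (cmod z powr b))" by (simp add: has_bochner_integral_iff)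
next
  assume int: "integrable dA (\<lambda>z. complex_of_real (cmod z powr b))"
  then have int': "integrable dA (\<lambda>z. cmod z powr b)" by (simp only: complex_of_real_integrable_eq)
  show "b > -2"
  proof (rule ccontr)
    assume b: "\<not> b > -2"
    define I where "I = (LINT z|dA. cmod z powr b)"
    have le: "2 / e \<le> I" if e: "e > 0" for e :: real
    proof -
      have hb: "has_bochner_integral dA (\<lambda>z. cmod z powr (e - 2)) (2 / e)"
        using has_bochner_integral_cmod_powr[of "e - 2"] e by simp
      have "2 / e = (LINT z|dA. cmod z powr (e - 2))" using hb by (simp add: has_bochner_integral_iff)
      also have "\<dots> \<le> I" unfolding I_def
      proof (rule integral_mono_AE)
        show "integrable dA (\<lambda>z. cmod z powr (e - 2))" using hb by (simp add: has_bochner_integral_iff)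
        show "AE z in dA. cmod z powr (e - 2) \<le> cmod z powr b"
          using AE_dA_disk AE_dA_nonzero by eventually_elim (use b e in \<open>auto intro!: powr_mono'\<close>)
      qed (rule int')
      finally show ?thesis .
    qed
    have "I > 0" using le[of 1] by simp
    then show False using le[of "1 / I"] by simp
  qed
qed

section \<open>Semicommutators of finite rank\<close>

lemma finite_int_iff_eventually:
  fixes A :: "int set"
  shows "finite A \<longleftrightarrow> (\<forall>\<^sub>F n in sequentially. int n \<notin> A) \<and> (\<forall>\<^sub>F n in sequentially. - int n \<notin> A)"
proof -
  have ev: "(\<forall>\<^sub>F n in sequentially. f n \<notin> A) \<longleftrightarrow> finite {n. f n \<in> A}" for f :: "nat \<Rightarrow> int"
    by (simp add: cofinite_eq_sequentially[symmetric] eventually_cofinite)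
  have A: "A = int ` {n. int n \<in> A} \<union> (\<lambda>n. - int n) ` {n. - int n \<in> A}"
  proof (intro equalityI subsetI)
    fix x assume "x \<in> A"
    then show "x \<in> int ` {n. int n \<in> A} \<union> (\<lambda>n. - int n) ` {n. - int n \<in> A}"
      by (cases x rule: int_cases2) auto
  qed auto
  show ?thesis unfolding ev
  proof
    assume "finite A"
    then show "finite {n. int n \<in> A} \<and> finite {n. - int n \<in> A}"
      using finite_vimageI[of A int] finite_vimageI[of A "\<lambda>n. - int n"] by (auto simp: vimage_def inj_on_def)
  next
    assume "finite {n. int n \<in> A} \<and> finite {n. - int n \<in> A}"
    then show "finite A" by (subst A) simp
  qed
qed

lemma semicommutator_coefficient_eq_0_iff:
  fixes k1 k2 n :: int
  assumes \<phi>: "integrable dA (\<lambda>z. \<phi> (cmod z))"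
    and w: "integrable dA (\<lambda>z. complex_of_real (cmod z powr m) * \<phi> (cmod z))" and m: "m > -2"
  defines "A \<equiv> real_of_int \<bar>n + k2\<bar>" and "B \<equiv> real_of_int \<bar>n + k1 + k2\<bar>"
  shows "tmult k1 (\<lambda>r. complex_of_real (r powr m)) (n + k2) * tmult k2 \<phi> n
      - tmult (k1 + k2) (\<lambda>r. complex_of_real (r powr m) * \<phi> r) n = 0 \<longleftrightarrow>
    complex_of_real (2 * (A + 1)) * moment \<phi> (real_of_int \<bar>n\<bar> + A)
      = complex_of_real (A + B + m + 2) * moment \<phi> (real_of_int \<bar>n\<bar> + B + m)"
proof -
  have AB: "A \<ge> 0" "B \<ge> 0" by (auto simp: A_def B_def)
  have b: "\<bar>n + k2 + k1\<bar> = \<bar>n + k1 + k2\<bar>" "\<bar>n + (k1 + k2)\<bar> = \<bar>n + k1 + k2\<bar>" by (simp_all add: add_ac)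
  have hw: "hweight (n + k2 + k1) = B + 1" "hweight (n + k2) = A + 1" "hweight (n + (k1 + k2)) = B + 1"
    unfolding hweight_def b A_def B_def by simp_all
  have t1: "tmult k1 (\<lambda>r. complex_of_real (r powr m)) (n + k2) = complex_of_real (B + 1) * (2 / complex_of_real (A + B + m + 2))"
  proof -
    have e: "real_of_int (\<bar>n + k2\<bar> + \<bar>n + k2 + k1\<bar>) = A + B" unfolding b by (simp add: A_def B_def)
    have "tmult k1 (\<lambda>r. complex_of_real (r powr m)) (n + k2) = complex_of_real (B + 1) * moment (\<lambda>r. complex_of_real (r powr m)) (A + B)"
      using m by (subst tmult_eq_moment) (simp_all only: integrable_cmod_powr_iff hw e)
    also have "moment (\<lambda>r. complex_of_real (r powr m)) (A + B) = 2 / complex_of_real (A + B + m + 2)"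
      using m AB by (subst moment_power) (simp_all add: add_ac)
    finally show ?thesis .
  qed
  have t2: "tmult k2 \<phi> n = complex_of_real (A + 1) * moment \<phi> (real_of_int \<bar>n\<bar> + A)"
    unfolding tmult_eq_moment[OF \<phi>] hw by (simp add: A_def)
  have t3: "tmult (k1 + k2) (\<lambda>r. complex_of_real (r powr m) * \<phi> r) n = complex_of_real (B + 1) * moment \<phi> (real_of_int \<bar>n\<bar> + B + m)"
  proof -
    have e: "m + real_of_int (\<bar>n\<bar> + \<bar>n + (k1 + k2)\<bar>) = real_of_int \<bar>n\<bar> + B + m" unfolding b by (simp add: B_def)
    show ?thesis
      unfolding tmult_eq_moment[of "\<lambda>r. complex_of_real (r powr m) * \<phi> r", OF w] hw moment_mult_powr e by (rule refl)
  qed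
  have nz: "complex_of_real (B + 1) \<noteq> 0" "complex_of_real (A + B + m + 2) \<noteq> 0"
    using AB m by (simp_all only: of_real_eq_0_iff)
  define X where "X = moment \<phi> (real_of_int \<bar>n\<bar> + A)"
  define Y where "Y = moment \<phi> (real_of_int \<bar>n\<bar> + B + m)"
  define p where "p = complex_of_real (A + B + m + 2)"
  have "complex_of_real (B + 1) * (2 / p) * (complex_of_real (A + 1) * X) - complex_of_real (B + 1) * Y
     = complex_of_real (B + 1) / p * (complex_of_real (2 * (A + 1)) * X - p * Y)"
    using nz(2) unfolding p_def[symmetric] by (simp add: field_simps)
  also have "\<dots> = 0 \<longleftrightarrow> complex_of_real (2 * (A + 1)) * X = p * Y"
    using nz unfolding p_def[symmetric] by (simp only: mult_eq_0_iff divide_eq_0_iff) simp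
  finally show ?thesis unfolding t1 t2 t3 X_def Y_def p_def .
qed

text \<open>For large \<open>\<bar>n\<bar>\<close> the absolute values resolve according to the sign of \<open>n\<close>, and the vanishing of the
  weight becomes a recurrence for the moments of \<open>\<phi>\<close>. The two signs give recurrences with exponents
  \<open>k2\<close> and \<open>- k2\<close> and with steps \<open>m + k1\<close> and \<open>m - k1\<close>.\<close>

lemma semicommutator_finitely_supported_iff:
  fixes k1 k2 :: int
  assumes \<phi>: "integrable dA (\<lambda>z. \<phi> (cmod z))"
    and w: "integrable dA (\<lambda>z. complex_of_real (cmod z powr m) * \<phi> (cmod z))" and m: "m > -2"
  shows "finite {n. tmult k1 (\<lambda>r. complex_of_real (r powr m)) (n + k2) * tmult k2 \<phi> n
      - tmult (k1 + k2) (\<lambda>r. complex_of_real (r powr m) * \<phi> r) n \<noteq> 0} \<longleftrightarrow>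
    moment_recurrence \<phi> (of_int k2) (of_int k1 + m) \<and> moment_recurrence \<phi> (- of_int k2) (m - of_int k1)"
proof -
  note iff = semicommutator_coefficient_eq_0_iff[OF \<phi> w m, of k1 _ k2]
  have large: "\<forall>\<^sub>F n in sequentially. int n \<ge> \<bar>k1\<bar> + \<bar>k2\<bar>"
    using eventually_ge_at_top[of "nat (\<bar>k1\<bar> + \<bar>k2\<bar>)"] by eventually_elim linarith
  show ?thesis
    unfolding finite_int_iff_eventually mem_Collect_eq not_not iff moment_recurrence_def
  proof (intro arg_cong2[where f = "(\<and>)"] eventually_cong)
    show "\<forall>\<^sub>F n in sequentially. int n \<ge> \<bar>k1\<bar> + \<bar>k2\<bar>" "\<forall>\<^sub>F n in sequentially. int n \<ge> \<bar>k1\<bar> + \<bar>k2\<bar>"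
      by (rule large)+
    fix n assume n: "\<bar>k1\<bar> + \<bar>k2\<bar> \<le> int n"
    have "\<bar>int n + k2\<bar> = int n + k2" "\<bar>int n + k1 + k2\<bar> = int n + k1 + k2" using n by auto
    then have e: "real_of_int \<bar>int n + k2\<bar> = real n + of_int k2" "real_of_int \<bar>int n + k1 + k2\<bar> = real n + of_int k1 + of_int k2"
      "real_of_int \<bar>int n\<bar> = real n" by simp_all
    have f: "2 * (real n + of_int k2 + 1) = of_int k2 + 2 * real n + (of_int k2 + 2)"
      "real n + (real n + of_int k2) = of_int k2 + 2 * real n"
      "real n + of_int k2 + (real n + of_int k1 + of_int k2) + m + 2 = of_int k2 + 2 * real n + (of_int k2 + 2) + (of_int k1 + m)"
      "real n + (real n + of_int k1 + of_int k2) + m = of_int k2 + 2 * real n + (of_int k1 + m)" by simp_all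
    show "(complex_of_real (2 * (real_of_int \<bar>int n + k2\<bar> + 1)) * moment \<phi> (real_of_int \<bar>int n\<bar> + real_of_int \<bar>int n + k2\<bar>) =
      complex_of_real (real_of_int \<bar>int n + k2\<bar> + real_of_int \<bar>int n + k1 + k2\<bar> + m + 2) *
        moment \<phi> (real_of_int \<bar>int n\<bar> + real_of_int \<bar>int n + k1 + k2\<bar> + m)) =
      (complex_of_real (of_int k2 + 2 * real n + (of_int k2 + 2)) * moment \<phi> (of_int k2 + 2 * real n) =
      complex_of_real (of_int k2 + 2 * real n + (of_int k2 + 2) + (of_int k1 + m)) * moment \<phi> (of_int k2 + 2 * real n + (of_int k1 + m)))"
      unfolding e f by (rule refl)
  next
    fix n assume n: "\<bar>k1\<bar> + \<bar>k2\<bar> \<le> int n"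
    have "\<bar>- int n + k2\<bar> = int n - k2" "\<bar>- int n + k1 + k2\<bar> = int n - k1 - k2" using n by auto
    then have e: "real_of_int \<bar>- int n + k2\<bar> = real n - of_int k2" "real_of_int \<bar>- int n + k1 + k2\<bar> = real n - of_int k1 - of_int k2"
      "real_of_int \<bar>- int n\<bar> = real n" by simp_all
    have f: "2 * (real n - of_int k2 + 1) = - of_int k2 + 2 * real n + (- of_int k2 + 2)"
      "real n + (real n - of_int k2) = - of_int k2 + 2 * real n"
      "real n - of_int k2 + (real n - of_int k1 - of_int k2) + m + 2 = - of_int k2 + 2 * real n + (- of_int k2 + 2) + (m - of_int k1)"
      "real n + (real n - of_int k1 - of_int k2) + m = - of_int k2 + 2 * real n + (m - of_int k1)" by simp_all
    show "(complex_of_real (2 * (real_of_int \<bar>- int n + k2\<bar> + 1)) * moment \<phi> (real_of_int \<bar>- int n\<bar> + real_of_int \<bar>- int n + k2\<bar>) =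
      complex_of_real (real_of_int \<bar>- int n + k2\<bar> + real_of_int \<bar>- int n + k1 + k2\<bar> + m + 2) *
        moment \<phi> (real_of_int \<bar>- int n\<bar> + real_of_int \<bar>- int n + k1 + k2\<bar> + m)) =
      (complex_of_real (- of_int k2 + 2 * real n + (- of_int k2 + 2)) * moment \<phi> (- of_int k2 + 2 * real n) =
      complex_of_real (- of_int k2 + 2 * real n + (- of_int k2 + 2) + (m - of_int k1)) * moment \<phi> (- of_int k2 + 2 * real n + (m - of_int k1)))"
      unfolding e f by (rule refl)
  qed
qed

lemma integrable_if_AE_power:
  assumes meas: "(\<lambda>z. \<phi> (cmod z)) \<in> borel_measurable dA"
    and eq: "AE z in dA. \<phi> (cmod z) = C * complex_of_real (cmod z powr b)" and b: "b > -2"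
  shows "integrable dA (\<lambda>z. \<phi> (cmod z))"
proof -
  have "integrable dA (\<lambda>z. C * complex_of_real (cmod z powr b))"
    using b by (intro integrable_mult_right) (simp only: integrable_cmod_powr_iff)
  then show ?thesis
    using integrable_cong_AE[OF meas _ eq] by (simp add: borel_measurable_integrable)
qed

lemma exponent_gt_if_AE_power:
  assumes int: "integrable dA (\<lambda>z. \<phi> (cmod z))"
    and eq: "AE z in dA. \<phi> (cmod z) = C * complex_of_real (cmod z powr b)" and C: "C \<noteq> 0"
  shows "b > -2"
proof -
  have m: "(\<lambda>z. C * complex_of_real (cmod z powr b)) \<in> borel_measurable dA"
    by (intro measurable_dA_borelI) simp
  have "integrable dA (\<lambda>z. C * complex_of_real (cmod z powr b))"
    using int integrable_cong_AE[OF borel_measurable_integrable[OF int] m eq] by simp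
  then have "integrable dA (\<lambda>z. inverse C * (C * complex_of_real (cmod z powr b)))" by (rule integrable_mult_right)
  then show ?thesis using C by (simp add: mult.assoc[symmetric] integrable_cmod_powr_iff)
qed

lemma moment_AE_power:
  assumes int: "integrable dA (\<lambda>z. \<phi> (cmod z))"
    and eq: "AE z in dA. \<phi> (cmod z) = C * complex_of_real (cmod z powr b)" and b: "b > -2" and s: "b + s > -2"
  shows "moment \<phi> s = 2 * C / complex_of_real (b + s + 2)"
proof -
  have "moment \<phi> s = moment (\<lambda>r. C * complex_of_real (r powr b)) s"
    using b by (intro moment_cong_AE int eq integrable_mult_right) (simp only: integrable_cmod_powr_iff)
  also have "\<dots> = C * moment (\<lambda>r. complex_of_real (r powr b)) s"
    by (simp add: moment_def mult.assoc)
  also have "\<dots> = 2 * C / complex_of_real (b + s + 2)" by (simp add: moment_power[OF s])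
  finally show ?thesis .
qed

text \<open>The weight at \<open>n\<close> is a constant times \<open>(x + 1) / (x + y + b + 2)\<close> with \<open>x = \<bar>n + k\<bar>\<close> and \<open>y = \<bar>n\<bar>\<close>,
  which is bounded because \<open>b + 2\<close> is positive.\<close>

lemma T_function_polar_power:
  assumes int: "integrable dA (\<lambda>z. \<phi> (cmod z))"
    and eq: "AE z in dA. \<phi> (cmod z) = C * complex_of_real (cmod z powr b)" and b: "b > -2"
  shows "T_function (polar k \<phi>)"
  unfolding T_function_polar_iff
proof (intro conjI exI allI)
  show "integrable dA (polar k \<phi>)" using int by (simp add: integrable_polar_iff)
  fix n :: int
  define D where "D = max 1 (1 / (b + 2))"
  define x where "x = real_of_int \<bar>n + k\<bar>"
  define y where "y = real_of_int \<bar>n\<bar>"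
  have xy: "x \<ge> 0" "y \<ge> 0" by (auto simp: x_def y_def)
  have pos: "b + (y + x) + 2 > 0" using xy b by linarith
  have D1: "D \<ge> 1" by (simp add: D_def)
  have "1 / (b + 2) * (b + 2) \<le> D * (b + 2)" using b unfolding D_def by (intro mult_right_mono) auto
  then have D: "D \<ge> 1" "D * (b + 2) \<ge> 1" using b D1 by auto
  have "x + 1 \<le> D * x + D * (b + 2)" using D xy by (intro add_mono) (auto simp: mult_le_cancel_right1)
  also have "\<dots> \<le> D * (b + (y + x) + 2)" using D(1) xy by (simp add: algebra_simps)
  finally have le: "(x + 1) / (b + (y + x) + 2) \<le> D" using pos by (simp add: pos_divide_le_eq)
  have "tmult k \<phi> n = complex_of_real (x + 1) * (2 * C / complex_of_real (b + (y + x) + 2))"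
    using b xy by (subst tmult_eq_moment[OF int], subst moment_AE_power[OF int eq b]) (auto simp: hweight_def x_def y_def)
  also have "\<dots> = complex_of_real ((x + 1) / (b + (y + x) + 2)) * (2 * C)" by simp
  finally have "cmod (tmult k \<phi> n) = \<bar>(x + 1) / (b + (y + x) + 2)\<bar> * cmod (2 * C)"
    by (simp only: norm_mult norm_of_real)
  also have "\<dots> = (x + 1) / (b + (y + x) + 2) * cmod (2 * C)"
    using xy pos by (subst abs_of_nonneg) (auto intro!: divide_nonneg_nonneg)
  also have "\<dots> \<le> D * cmod (2 * C)" using le by (rule mult_right_mono) simp
  finally show "cmod (tmult k \<phi> n) \<le> max 1 (1 / (b + 2)) * cmod (2 * C)" by (simp add: D_def)
qed

lemma recurrence_if_AE_power:
  assumes int: "integrable dA (\<lambda>z. \<phi> (cmod z))"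
    and eq: "AE z in dA. \<phi> (cmod z) = C * complex_of_real (cmod z powr b)" and b: "b > -2"
  shows "moment_recurrence \<phi> b d"
proof -
  have val: "complex_of_real (s + (b + 2)) * moment \<phi> s = 2 * C" if s: "b + s > -2" for s
  proof -
    have nz: "complex_of_real (b + s + 2) \<noteq> 0" using s by (simp only: of_real_eq_0_iff)
    have e: "s + (b + 2) = b + s + 2" by simp
    show ?thesis unfolding moment_AE_power[OF int eq b s] e times_divide_eq_right
      by (rule nonzero_mult_div_cancel_left[OF nz])
  qed
  have "\<forall>\<^sub>F n in sequentially. real n \<ge> \<bar>b\<bar> + \<bar>d\<bar>"
    using eventually_ge_at_top[of "nat \<lceil>\<bar>b\<bar> + \<bar>d\<bar>\<rceil>"] by eventually_elim linarith
  then show ?thesis unfolding moment_recurrence_def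
  proof eventually_elim
    case (elim n)
    have "b + 2 * real n + (b + 2) + d = (b + 2 * real n + d) + (b + 2)" by simp
    moreover have "b + (b + 2 * real n) > -2" "b + (b + 2 * real n + d) > -2" using elim b by linarith+
    ultimately show ?case by (simp only: val)
  qed
qed

lemma AE_powi_iff_powr:
  "(AE z in dA. \<phi> (cmod z) = C * complex_of_real (cmod z powi k)) \<longleftrightarrow>
   (AE z in dA. \<phi> (cmod z) = C * complex_of_real (cmod z powr real_of_int k))"
proof -
  have "AE z in dA. cmod z powi k = cmod z powr real_of_int k"
    using AE_dA_nonzero by eventually_elim (simp add: powr_real_of_int')
  then have "AE z in dA. (\<phi> (cmod z) = C * complex_of_real (cmod z powi k)) \<longleftrightarrow> (\<phi> (cmod z) = C * complex_of_real (cmod z powr real_of_int k))"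
    by eventually_elim simp
  then show ?thesis by (rule eventually_subst)
qed

text \<open>The moments at \<open>0\<close> and \<open>1\<close> already force equal coefficients and equal exponents.\<close>

lemma power_exponent_unique:
  assumes int: "integrable dA (\<lambda>z. \<phi> (cmod z))" and nz: "\<not> (AE z in dA. \<phi> (cmod z) = 0)"
    and b: "AE z in dA. \<phi> (cmod z) = B * complex_of_real (cmod z powr b)"
    and c: "AE z in dA. \<phi> (cmod z) = C * complex_of_real (cmod z powr c)"
  shows "b = c"
proof -
  have "B \<noteq> 0" using nz b by (cases "B = 0") auto
  have "C \<noteq> 0" using nz c by (cases "C = 0") auto
  have b2: "b > -2" and c2: "c > -2"
    using exponent_gt_if_AE_power[OF int b \<open>B \<noteq> 0\<close>] exponent_gt_if_AE_power[OF int c \<open>C \<noteq> 0\<close>] by auto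
  have eq: "B * complex_of_real (c + s + 2) = C * complex_of_real (b + s + 2)" if "s \<ge> 0" for s
  proof -
    have nz: "complex_of_real (b + s + 2) \<noteq> 0" "complex_of_real (c + s + 2) \<noteq> 0"
      using b2 c2 that by (simp_all only: of_real_eq_0_iff)
    have "2 * B / complex_of_real (b + s + 2) = 2 * C / complex_of_real (c + s + 2)"
      using moment_AE_power[OF int b b2, of s] moment_AE_power[OF int c c2, of s] b2 c2 that by simp
    then have "2 * B * complex_of_real (c + s + 2) = 2 * C * complex_of_real (b + s + 2)"
      by (rule iffD1[OF frac_eq_eq[OF nz]])
    then show ?thesis by (simp only: mult.assoc mult_cancel_left) simp
  qed
  have e1: "B * complex_of_real (c + 2) = C * complex_of_real (b + 2)" using eq[of 0] by simp
  have e2: "B * complex_of_real (c + 2) + B = C * complex_of_real (b + 2) + C" using eq[of 1] by (simp add: algebra_simps)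
  have "B = C" using e1 e2 by simp
  then have "complex_of_real (c + 2) = complex_of_real (b + 2)" using e1 \<open>C \<noteq> 0\<close> by simp
  then show ?thesis by (simp only: of_real_eq_iff)
qed

theorem corollary5p8:
  fixes k1 k2 :: int and m :: real and \<phi> :: "real \<Rightarrow> complex"
  defines "u \<equiv> polar k1 (\<lambda>r. complex_of_real (r powr m))"
    and "v \<equiv> polar k2 \<phi>"
    and "w \<equiv> polar (k1 + k2) (\<lambda>r. complex_of_real (r powr m) * \<phi> r)"
  assumes "k1 * k2 \<noteq> 0"
    and "m \<ge> -1"
    and "T_function (\<lambda>z. \<phi> (cmod z))"
    and "\<not> (AE z in dA. \<phi> (cmod z) = 0)"
  shows "(T_function u \<and> T_function v \<and> T_function w \<and>
          finite_rank (\<lambda>h z. Toeplitz u (Toeplitz v h) z - Toeplitz w h z)) \<longleftrightarrow>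
         (m = of_int k1 \<and> k2 > max (-2) (- k1 - 2) \<and>
            (\<exists>C. AE z in dA. \<phi> (cmod z) = C * complex_of_real (cmod z powi k2))) \<or>
         (m = - of_int k1 \<and> k2 < min 2 (- k1 + 2) \<and>
            (\<exists>C. AE z in dA. \<phi> (cmod z) = C * complex_of_real (cmod z powi (- k2))))"
proof -
  have k: "k1 \<noteq> 0" "k2 \<noteq> 0" using assms(4) by auto
  have \<phi>: "integrable dA (\<lambda>z. \<phi> (cmod z))" using assms(6) by (simp add: T_function_def)
  have nz: "\<not> (AE z in dA. \<phi> (cmod z) = 0)" by (rule assms(7))
  have m: "m > -2" using assms(5) by simp
  have w_power: "AE z in dA. complex_of_real (cmod z powr m) * \<phi> (cmod z) = C * complex_of_real (cmod z powr (m + b))"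
    if "AE z in dA. \<phi> (cmod z) = C * complex_of_real (cmod z powr b)" for C b
    using that by eventually_elim (simp add: powr_add mult_ac)
  have rec_iff: "finite_rank (\<lambda>h z. Toeplitz u (Toeplitz v h) z - Toeplitz w h z) \<longleftrightarrow>
      moment_recurrence \<phi> (of_int k2) (of_int k1 + m) \<and> moment_recurrence \<phi> (- of_int k2) (m - of_int k1)"
    if T: "T_function u" "T_function v" "T_function w"
  proof -
    have w: "integrable dA (\<lambda>z. complex_of_real (cmod z powr m) * \<phi> (cmod z))"
      using T(3) by (simp add: w_def T_function_polar_iff integrable_polar_iff)
    show ?thesis
      unfolding u_def v_def w_def
        semicommutator_finite_rank_iff[OF T[unfolded u_def v_def w_def]]
        semicommutator_finitely_supported_iff[OF \<phi> w m] by (rule refl)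
  qed
  show ?thesis
  proof
    assume L: "T_function u \<and> T_function v \<and> T_function w \<and>
          finite_rank (\<lambda>h z. Toeplitz u (Toeplitz v h) z - Toeplitz w h z)"
    then have rec: "moment_recurrence \<phi> (of_int k2) (of_int k1 + m)" "moment_recurrence \<phi> (- of_int k2) (m - of_int k1)"
      using rec_iff by blast+
    have w: "integrable dA (\<lambda>z. complex_of_real (cmod z powr m) * \<phi> (cmod z))"
      using L by (simp add: w_def T_function_polar_iff integrable_polar_iff)
    have power: "\<exists>C. AE z in dA. \<phi> (cmod z) = C * complex_of_real (cmod z powr b)" if "moment_recurrence \<phi> b d" "d \<noteq> 0" for b d
      by (rule radial_eq_power_if_recurrence[OF \<phi> that(2,1)])
    have exponents: "b > -2 \<and> m + b > -2" if "AE z in dA. \<phi> (cmod z) = C * complex_of_real (cmod z powr b)" for C b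
    proof -
      have C: "C \<noteq> 0" using nz that by (cases "C = 0") auto
      show ?thesis
        using exponent_gt_if_AE_power[OF \<phi> that C]
          exponent_gt_if_AE_power[where \<phi> = "\<lambda>r. complex_of_real (r powr m) * \<phi> r", OF w w_power[OF that] C] by blast
    qed
    \<comment> \<open>If both steps were nonzero, \<open>\<phi>\<close> would be a multiple of \<open>r ^ k2\<close> and of \<open>r ^ (- k2)\<close>.\<close>
    have "m = of_int k1 \<or> m = - of_int k1"
    proof (rule ccontr)
      assume "\<not> (m = of_int k1 \<or> m = - of_int k1)"
      then have "of_int k1 + m \<noteq> 0" "m - of_int k1 \<noteq> 0" by auto
      then obtain B C where "AE z in dA. \<phi> (cmod z) = B * complex_of_real (cmod z powr of_int k2)"
        "AE z in dA. \<phi> (cmod z) = C * complex_of_real (cmod z powr (- of_int k2))"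
        using power rec by meson
      then have "real_of_int k2 = - of_int k2" by (rule power_exponent_unique[OF \<phi> nz])
      then show False using k by simp
    qed
    then show "(m = of_int k1 \<and> k2 > max (-2) (- k1 - 2) \<and>
            (\<exists>C. AE z in dA. \<phi> (cmod z) = C * complex_of_real (cmod z powi k2))) \<or>
         (m = - of_int k1 \<and> k2 < min 2 (- k1 + 2) \<and>
            (\<exists>C. AE z in dA. \<phi> (cmod z) = C * complex_of_real (cmod z powi (- k2))))"
    proof
      assume m1: "m = of_int k1"
      then have "of_int k1 + m \<noteq> 0" using k by simp
      then obtain C where C: "AE z in dA. \<phi> (cmod z) = C * complex_of_real (cmod z powr of_int k2)"
        using power[OF rec(1)] by blast
      have "real_of_int k2 > -2" "real_of_int k1 + real_of_int k2 > -2" using exponents[OF C] m1 by auto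
      then have "k2 > max (-2) (- k1 - 2)" by linarith
      then show ?thesis using m1 C unfolding AE_powi_iff_powr by blast
    next
      assume m2: "m = - of_int k1"
      then have "m - of_int k1 \<noteq> 0" using k by simp
      then obtain C where C: "AE z in dA. \<phi> (cmod z) = C * complex_of_real (cmod z powr (- of_int k2))"
        using power[OF rec(2)] by blast
      have "- real_of_int k2 > -2" "- real_of_int k1 - real_of_int k2 > -2" using exponents[OF C] m2 by auto
      then have "k2 < min 2 (- k1 + 2)" by linarith
      then show ?thesis using m2 C unfolding AE_powi_iff_powr of_int_minus by blast
    qed
  next
    assume R: "(m = of_int k1 \<and> k2 > max (-2) (- k1 - 2) \<and>
            (\<exists>C. AE z in dA. \<phi> (cmod z) = C * complex_of_real (cmod z powi k2))) \<or>
         (m = - of_int k1 \<and> k2 < min 2 (- k1 + 2) \<and>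
            (\<exists>C. AE z in dA. \<phi> (cmod z) = C * complex_of_real (cmod z powi (- k2))))"
    obtain C b where b: "AE z in dA. \<phi> (cmod z) = C * complex_of_real (cmod z powr b)" "b > -2" "m + b > -2"
      and cases: "(m = of_int k1 \<and> b = of_int k2) \<or> (m = - of_int k1 \<and> b = - of_int k2)"
    proof -
      from R show thesis
      proof (elim disjE conjE exE)
        fix C assume a: "m = of_int k1" "k2 > max (-2) (- k1 - 2)"
          "AE z in dA. \<phi> (cmod z) = C * complex_of_real (cmod z powi k2)"
        have "real_of_int k2 > -2" "real_of_int k1 + real_of_int k2 > -2" using a(2) by linarith+
        then show thesis using a(1,3) unfolding AE_powi_iff_powr by (intro that[of C "of_int k2"]) auto
      next
        fix C assume a: "m = - of_int k1" "k2 < min 2 (- k1 + 2)"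
          "AE z in dA. \<phi> (cmod z) = C * complex_of_real (cmod z powi (- k2))"
        have "- real_of_int k2 > -2" "- real_of_int k1 - real_of_int k2 > -2" using a(2) by linarith+
        then show thesis using a(1,3) unfolding AE_powi_iff_powr by (intro that[of C "- of_int k2"]) auto
      qed
    qed
    have Tu: "T_function u"
      unfolding u_def using m by (intro T_function_polar_power[where C = 1 and b = m]) (simp_all add: integrable_cmod_powr_iff)
    have Tv: "T_function v"
      unfolding v_def by (rule T_function_polar_power[OF \<phi> b(1,2)])
    have wm: "(\<lambda>z. complex_of_real (cmod z powr m) * \<phi> (cmod z)) \<in> borel_measurable dA"
      by (intro borel_measurable_times borel_measurable_integrable[OF \<phi>] measurable_dA_borelI) simp
    have wi: "integrable dA (\<lambda>z. complex_of_real (cmod z powr m) * \<phi> (cmod z))"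
      by (rule integrable_if_AE_power[where \<phi> = "\<lambda>r. complex_of_real (r powr m) * \<phi> r", OF wm w_power[OF b(1)] b(3)])
    have Tw: "T_function w"
      unfolding w_def by (rule T_function_polar_power[where \<phi> = "\<lambda>r. complex_of_real (r powr m) * \<phi> r", OF wi w_power[OF b(1)] b(3)])
    have rec_b: "moment_recurrence \<phi> b d" for d
      by (rule recurrence_if_AE_power[OF \<phi> b(1,2)])
    \<comment> \<open>In either case one step is zero and the other recurrence has the exponent of \<open>\<phi>\<close>.\<close>
    have rec_0: "moment_recurrence \<phi> c 0" for c by (simp add: moment_recurrence_def)
    have "moment_recurrence \<phi> (of_int k2) (of_int k1 + m) \<and> moment_recurrence \<phi> (- of_int k2) (m - of_int k1)"
      using cases rec_b rec_0 by auto
    then show "T_function u \<and> T_function v \<and> T_function w \<and>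
          finite_rank (\<lambda>h z. Toeplitz u (Toeplitz v h) z - Toeplitz w h z)"
      using rec_iff[OF Tu Tv Tw] Tu Tv Tw by blast
  qed
qed

end
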